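(* There exists a continuous section $\sigma\colon \mathcal{T}\mathrm{Gr}(2,n)\to \mathrm{Gr}(2,n)^{\mathrm{an}}$ to the tropicalization map $\mathrm{trop}\colon \mathrm{Gr}(2,n)^{\mathrm{an}}\to\mathcal{T}\mathrm{Gr}(2,n)$, i.e. a continuous map with $\mathrm{trop}\circ\sigma=\mathrm{id}$. Hence the tropical Grassmannian $\mathcal{T}\mathrm{Gr}(2,n)$ is homeomorphic to a closed subset of the Berkovich analytic space $\mathrm{Gr}(2,n)^{\mathrm{an}}$.
   Context: $K$ is a field that is complete with respect to a non-Archimedean absolute value $|\cdot|$ (the trivial absolute value is allowed). Write $[n]=\{1,\dots,n\}$ and $kl\in\binom{[n]}{2}$ for an unordered pair $\{k,l\}$. $\mathrm{Gr}(2,n)\subset\mathbb{P}_K^{\binom n2-1}$ is the Grassmannian of $2$-planes in $n$-space embedded by the Plücker embedding, with homogeneous coordinates $p_{kl}$ (the $2\times2$ minors; $p_{lk}=-p_{kl}$, one representative chosen for each pair). For a $K$-scheme $X$ of finite type, $X^{\mathrm{an}}$ is its Berkovich analytification; for $X=\operatorname{Spec}B$ its points are the multiplicative seminorms on $B$ extending $|\cdot|$, with the coarsest topology making all evaluations $\gamma\mapsto\gamma(f)$, $f\in B$, continuous. $\overline{\mathbb{R}}=\mathbb{R}\cup\{-\infty\}$, the intervals $[-\infty,a)$ being a basis of neighborhoods of $-\infty$; $\log 0=-\infty$. The tropical projective space is $\mathbb{TP}^{N}=(\overline{\mathbb R}^{N+1}\smallsetminus\{(-\infty,\dots,-\infty)\})/\mathbb{R}\cdot(1,\dots,1)$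 with the quotient topology. The map $\mathrm{trop}\colon\mathrm{Gr}(2,n)^{\mathrm{an}}\to\mathbb{TP}^{\binom n2-1}$ is the coordinatewise logarithm of absolute values of the Plücker coordinates: a point $\gamma$ lying over $\{p_{ij}\neq0\}$ maps to the class of $x$ with $x_{kl}-x_{ij}=\log\gamma(p_{kl}/p_{ij})$. $\mathcal{T}\mathrm{Gr}(2,n)$ is the image of $\mathrm{trop}$, with the subspace topology. *)

theory Defs
  imports
    "HOL-Analysis.Analysis"
    "HOL-Library.Poly_Mapping"
    "HOL-Computational_Algebra.Fraction_Field"
begin

section \<open>The base field\<close>

locale complete_nonarch_field =
  fixes nu :: "'k::field \<Rightarrow> real"
  assumes nu_nonneg: "0 \<le> nu a"
    and nu_eq_0_iff: "nu a = 0 \<longleftrightarrow> a = 0"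
    and nu_mult: "nu (a * b) = nu a * nu b"
    and nu_ultrametric: "nu (a + b) \<le> max (nu a) (nu b)"
    and nu_complete: "Metric_space.mcomplete UNIV (\<lambda>a b. nu (a - b))"


section \<open>Quotient topologies\<close>

text \<open>Meant for an equivalence relation on the underlying set of the space.\<close>

definition quotient_topology :: "'a topology \<Rightarrow> ('a \<times> 'a) set \<Rightarrow> 'a set topology" where
  "quotient_topology X R =
     topology (\<lambda>U. U \<subseteq> topspace X // R \<and> openin X {x \<in> topspace X. R `` {x} \<in> U})"

lemma openin_quotient_topology:
  "openin (quotient_topology X R) U \<longleftrightarrow>
     U \<subseteq> topspace X // R \<and> openin X {x \<in> topspace X. R `` {x} \<in> U}"
proof -
  have "istopology (\<lambda>U. U \<subseteq> topspace X // R \<and> openin X {x \<in> topspace X. R `` {x} \<in> U})"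
    unfolding istopology_def
  proof (intro conjI allI impI)
    fix S T
    assume S: "S \<subseteq> topspace X // R \<and> openin X {x \<in> topspace X. R `` {x} \<in> S}"
      and T: "T \<subseteq> topspace X // R \<and> openin X {x \<in> topspace X. R `` {x} \<in> T}"
    show "S \<inter> T \<subseteq> topspace X // R" using S by blast
    have "{x \<in> topspace X. R `` {x} \<in> S \<inter> T} =
        {x \<in> topspace X. R `` {x} \<in> S} \<inter> {x \<in> topspace X. R `` {x} \<in> T}" by blast
    then show "openin X {x \<in> topspace X. R `` {x} \<in> S \<inter> T}"
      using S T by (simp add: openin_Int)
  next
    fix \<K>
    assume K: "\<forall>U\<in>\<K>. U \<subseteq> topspace X // R \<and> openin X {x \<in> topspace X. R `` {x} \<in> U}"
    then show "\<Union>\<K> \<subseteq> topspace X // R" by blast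
    have "{x \<in> topspace X. R `` {x} \<in> \<Union>\<K>} =
        \<Union>((\<lambda>U. {x \<in> topspace X. R `` {x} \<in> U}) ` \<K>)" by blast
    moreover have "openin X (\<Union>((\<lambda>U. {x \<in> topspace X. R `` {x} \<in> U}) ` \<K>))"
      using K by (intro openin_Union) auto
    ultimately show "openin X {x \<in> topspace X. R `` {x} \<in> \<Union>\<K>}" by simp
  qed
  then show ?thesis
    unfolding quotient_topology_def by (simp add: topology_inverse')
qed

lemma topspace_quotient_topology: "topspace (quotient_topology X R) = topspace X // R"
proof -
  have "{x \<in> topspace X. R `` {x} \<in> topspace X // R} = topspace X"
    by (auto simp: quotient_def)
  then have "openin (quotient_topology X R) (topspace X // R)"
    by (simp add: openin_quotient_topology)
  then show ?thesis
    by (metis openin_quotient_topology openin_subset openin_topspace subset_antisym)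
qed

lemma quotient_map_quotient_topology:
  "quotient_map X (quotient_topology X R) (\<lambda>x. R `` {x})"
  unfolding quotient_map_def
  by (auto simp: topspace_quotient_topology openin_quotient_topology quotient_def)


section \<open>Affine Berkovich spaces\<close>

text \<open>
  \<open>K\<close>-algebras are given as subsets \<open>A\<close> of an ambient commutative ring, with structure map
  \<open>\<iota>\<close> from \<open>K\<close>. Points are extensional functions, so that a seminorm on \<open>A\<close> carries no
  information outside \<open>A\<close>.
\<close>

definition berk_points ::
    "('k \<Rightarrow> real) \<Rightarrow> ('k \<Rightarrow> 'b::comm_ring_1) \<Rightarrow> 'b set \<Rightarrow> ('b \<Rightarrow> real) set" where
  "berk_points nu \<iota> A =
     {\<gamma> \<in> extensional A.
        (\<forall>f\<in>A. 0 \<le> \<gamma> f) \<and>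
        (\<forall>c. \<gamma> (\<iota> c) = nu c) \<and>
        (\<forall>f\<in>A. \<forall>g\<in>A. \<gamma> (f + g) \<le> \<gamma> f + \<gamma> g) \<and>
        (\<forall>f\<in>A. \<forall>g\<in>A. \<gamma> (f * g) = \<gamma> f * \<gamma> g)}"

text \<open>
  The coarsest topology for which all evaluations at elements of \<open>A\<close> are continuous, i.e. the
  topology induced from the product of copies of the real line indexed by \<open>A\<close>.
\<close>

definition berk_affine ::
    "('k \<Rightarrow> real) \<Rightarrow> ('k \<Rightarrow> 'b::comm_ring_1) \<Rightarrow> 'b set \<Rightarrow> ('b \<Rightarrow> real) topology" where
  "berk_affine nu \<iota> A =
     subtopology (product_topology (\<lambda>_. euclideanreal) A) (berk_points nu \<iota> A)"

inductive_set alg_gen :: "('k \<Rightarrow> 'b::comm_ring_1) \<Rightarrow> 'b set \<Rightarrow> 'b set"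
  for \<iota> :: "'k \<Rightarrow> 'b" and G :: "'b set" where
  const: "\<iota> c \<in> alg_gen \<iota> G"
| gen: "g \<in> G \<Longrightarrow> g \<in> alg_gen \<iota> G"
| add: "\<lbrakk>f \<in> alg_gen \<iota> G; g \<in> alg_gen \<iota> G\<rbrakk> \<Longrightarrow> f + g \<in> alg_gen \<iota> G"
| mult: "\<lbrakk>f \<in> alg_gen \<iota> G; g \<in> alg_gen \<iota> G\<rbrakk> \<Longrightarrow> f * g \<in> alg_gen \<iota> G"


section \<open>The Grassmannian of planes\<close>

text \<open>
  Rational functions over \<open>K\<close> in the entries of a generic matrix with two rows. The variable
  with number \<open>2 * k + r\<close> is the entry in row \<open>r\<close> (\<open>r = 0, 1\<close>) and column \<open>k\<close>.
\<close>

type_synonym 'k ratfun = "((nat \<Rightarrow>\<^sub>0 nat) \<Rightarrow>\<^sub>0 'k) fract"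

definition rf_const :: "'k::field \<Rightarrow> 'k ratfun" where
  "rf_const c = Fraction_Field.Fract (Poly_Mapping.single 0 c) 1"

definition entry :: "nat \<Rightarrow> nat \<Rightarrow> 'k::field ratfun" where
  "entry r k =
     Fraction_Field.Fract (Poly_Mapping.single (Poly_Mapping.single (2 * k + r) 1) 1) 1"

definition plucker :: "nat \<times> nat \<Rightarrow> 'k::field ratfun" where
  "plucker = (\<lambda>(k, l). entry 0 k * entry 1 l - entry 0 l * entry 1 k)"

text \<open>The pair \<open>{k, l}\<close> is represented by \<open>(k, l)\<close> with \<open>k < l\<close>.\<close>

definition pairs :: "nat \<Rightarrow> (nat \<times> nat) set" where
  "pairs n = {(k, l). 1 \<le> k \<and> k < l \<and> l \<le> n}"

text \<open>
  The homogeneous coordinate ring of the Grassmannian is the \<open>K\<close>-algebra generated by the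
  minors \<open>p\<^sub>k\<^sub>l\<close> of the generic matrix. The open subset where \<open>p\<^sub>i \<noteq> 0\<close> for all \<open>i \<in> I\<close>
  (\<open>I\<close> a nonempty set of pairs) is therefore affine, with coordinate ring generated by the
  quotients \<open>p\<^sub>m / p\<^sub>i\<close>, where \<open>m\<close> is any pair and \<open>i \<in> I\<close>.
  It is used for one-element \<open>I\<close> (charts) and two-element \<open>I\<close> (overlaps of charts).
\<close>

definition coord_ring :: "nat \<Rightarrow> (nat \<times> nat) set \<Rightarrow> 'k::field ratfun set" where
  "coord_ring n I = alg_gen rf_const {plucker m / plucker i |m i. m \<in> pairs n \<and> i \<in> I}"

text \<open>
  The analytification is glued from the analytifications of the affine charts: points
  \<open>\<gamma>\<close> and \<open>\<gamma>'\<close> of two charts are identified if they come from a common point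
  \<open>\<delta>\<close> of the analytification of the overlap.
\<close>

definition chart_glue ::
    "('k::field \<Rightarrow> real) \<Rightarrow> nat \<Rightarrow>
     (((nat \<times> nat) \<times> ('k ratfun \<Rightarrow> real)) \<times> ((nat \<times> nat) \<times> ('k ratfun \<Rightarrow> real))) set" where
  "chart_glue nu n =
     {((i, \<gamma>), (j, \<gamma>')) |i j \<gamma> \<gamma>'.
        i \<in> pairs n \<and> j \<in> pairs n \<and>
        (\<exists>\<delta> \<in> berk_points nu rf_const (coord_ring n {i, j}).
           \<gamma> = restrict \<delta> (coord_ring n {i}) \<and> \<gamma>' = restrict \<delta> (coord_ring n {j}))}"

definition Gr_an ::
    "('k::field \<Rightarrow> real) \<Rightarrow> nat \<Rightarrow> ((nat \<times> nat) \<times> ('k ratfun \<Rightarrow> real)) set topology" where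
  "Gr_an nu n =
     quotient_topology
       (sum_topology (\<lambda>i. berk_affine nu rf_const (coord_ring n {i})) (pairs n))
       (chart_glue nu n)"


section \<open>Tropical projective space and the tropical Grassmannian\<close>

text \<open>
  \<open>\<real> \<union> {-\<infinity>}\<close> is the subspace of the extended reals obtained by removing \<open>\<infinity>\<close>;
  the coordinates of tropical projective space are indexed by \<open>pairs n\<close>.
\<close>

definition trop_affine :: "nat \<Rightarrow> (nat \<times> nat \<Rightarrow> ereal) topology" where
  "trop_affine n =
     subtopology
       (product_topology (\<lambda>_. subtopology (euclidean :: ereal topology) {x. x \<noteq> \<infinity>}) (pairs n))
       {x. \<exists>m\<in>pairs n. x m \<noteq> -\<infinity>}"

definition trop_rel :: "nat \<Rightarrow> ((nat \<times> nat \<Rightarrow> ereal) \<times> (nat \<times> nat \<Rightarrow> ereal)) set" where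
  "trop_rel n =
     {(x, y). x \<in> topspace (trop_affine n) \<and> y \<in> topspace (trop_affine n) \<and>
        (\<exists>c::real. \<forall>m\<in>pairs n. y m = x m + ereal c)}"

definition TP :: "nat \<Rightarrow> (nat \<times> nat \<Rightarrow> ereal) set topology" where
  "TP n = quotient_topology (trop_affine n) (trop_rel n)"

definition ext_ln :: "real \<Rightarrow> ereal" where
  "ext_ln r = (if r = 0 then -\<infinity> else ereal (ln r))"

definition chart_trop ::
    "nat \<Rightarrow> (nat \<times> nat) \<times> ('k::field ratfun \<Rightarrow> real) \<Rightarrow> (nat \<times> nat \<Rightarrow> ereal) set" where
  "chart_trop n =
     (\<lambda>(i, \<gamma>). trop_rel n `` {\<lambda>m\<in>pairs n. ext_ln (\<gamma> (plucker m / plucker i))})"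

text \<open>All representatives of a point of the analytification have the same tropicalization.\<close>

definition trop ::
    "nat \<Rightarrow> ((nat \<times> nat) \<times> ('k::field ratfun \<Rightarrow> real)) set \<Rightarrow> (nat \<times> nat \<Rightarrow> ereal) set" where
  "trop n z = the_elem (chart_trop n ` z)"

definition TGr :: "('k::field \<Rightarrow> real) \<Rightarrow> nat \<Rightarrow> (nat \<times> nat \<Rightarrow> ereal) set topology" where
  "TGr nu n = subtopology (TP n) (trop n ` topspace (Gr_an nu n))"

end

theory Submission
  imports Defs
begin

text \<open>
  Over the chart where the coordinate \<open>e = (i, j)\<close> does not vanish, the section sends a point
  \<open>x\<close> to the greatest multiplicative seminorm in its fibre. To see that it exists, regard a point of
  the fibre as a configuration of \<open>n\<close> columns over a valued field. Up to scaling, a column of norm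
  \<open>\<rho>\<^sub>k > 0\<close> is a point \<open>a\<^sub>k\<close> of the affine line, and
  \<open>|p\<^sub>k\<^sub>l| = \<rho>\<^sub>k \<rho>\<^sub>l |a\<^sub>k - a\<^sub>l|\<close> for an ultrametric \<open>|a\<^sub>k - a\<^sub>l| \<le> 1\<close>, which is given
  by the edge lengths \<open>r\<close> of a minimal spanning tree. Substituting
  independent variables for the scaling factors and for the differences of \<open>a\<close> along the edges, and taking
  the Gauss norm with radii \<open>\<rho>\<close> and \<open>r\<close>, gives a point of the fibre; any other point of the fibre is
  an evaluation of these variables at elements of norm at most \<open>\<rho>\<close> and \<open>r\<close>, hence is bounded by it.
  Therefore this Gauss norm depends only on \<open>x\<close>. As it is continuous in \<open>(x, r)\<close>, there are finitely
  many trees, and \<open>r\<close> ranges over a compact set, the section is continuous.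
  Its image is closed because on each chart it is the set of points fixed
  by a continuous self-map of a Hausdorff space.
\<close>

section \<open>Ultrametric multiplicative seminorms\<close>

text \<open>The obstacle is the boundary, where coordinates equal \<open>-\<infinity>\<close>. A
  column of norm zero has no slope of its own, so \<open>x\<close> alone determines neither the tree
  nor its edge lengths, and no continuous choice of them is attempted. Describing the section as a
  maximum removes the choice, and compactness of the set of \<open>r\<close> controls the limits in
  which a column degenerates. The price is paid in the upper bound: a column of norm zero must be
  given a slope that fits the tree, and the substitution then reproduces a seminorm only up to
  elements of its kernel. Kernels are also the reason for \<open>loc\<close>, which inverts the
  elements of nonzero seminorm and leaves the others alone. Maximality makes the local sections
  agree as well: within a fibre, a change of chart divides the value at a form of degree
  \<open>D\<close> by the \<open>D\<close>-th power of one fixed number, hence preserves the order.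
  Slopes require a linear form that has on every column the norm of that column. Over a small
  residue field none need exist with constant coefficients, so a variable of norm one is
  adjoined.\<close>

locale ultra_seminorm =
  fixes A :: "'b::comm_ring_1 set" and g :: "'b \<Rightarrow> real"
  assumes zero_mem: "0 \<in> A" and one_mem: "1 \<in> A"
    and add_mem: "\<lbrakk>a \<in> A; b \<in> A\<rbrakk> \<Longrightarrow> a + b \<in> A"
    and uminus_mem: "a \<in> A \<Longrightarrow> - a \<in> A"
    and mult_mem: "\<lbrakk>a \<in> A; b \<in> A\<rbrakk> \<Longrightarrow> a * b \<in> A"
    and nonneg: "a \<in> A \<Longrightarrow> 0 \<le> g a"
    and zero: "g 0 = 0" and one: "g 1 = 1"
    and mult: "\<lbrakk>a \<in> A; b \<in> A\<rbrakk> \<Longrightarrow> g (a * b) = g a * g b"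
    and ultra: "\<lbrakk>a \<in> A; b \<in> A\<rbrakk> \<Longrightarrow> g (a + b) \<le> max (g a) (g b)"
begin

lemma diff_mem: "\<lbrakk>a \<in> A; b \<in> A\<rbrakk> \<Longrightarrow> a - b \<in> A"
  using add_mem[of a "- b"] uminus_mem by simp

lemma sum_mem: "(\<And>i. i \<in> I \<Longrightarrow> f i \<in> A) \<Longrightarrow> sum f I \<in> A"
  by (induction I rule: infinite_finite_induct) (auto intro: zero_mem add_mem)

lemma prod_mem: "(\<And>i. i \<in> I \<Longrightarrow> f i \<in> A) \<Longrightarrow> prod f I \<in> A"
  by (induction I rule: infinite_finite_induct) (auto intro: one_mem mult_mem)

lemma power_mem: "a \<in> A \<Longrightarrow> a ^ k \<in> A"
  by (induction k) (auto intro: one_mem mult_mem)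

lemma power: "a \<in> A \<Longrightarrow> g (a ^ k) = g a ^ k"
  by (induction k) (auto simp: one mult power_mem)

lemma prod: "(\<And>i. i \<in> I \<Longrightarrow> f i \<in> A) \<Longrightarrow> g (prod f I) = (\<Prod>i\<in>I. g (f i))"
  by (induction I rule: infinite_finite_induct) (auto simp: one mult prod_mem)

lemma uminus: assumes "a \<in> A" shows "g (- a) = g a"
proof -
  have m: "- 1 \<in> A" by (intro uminus_mem one_mem)
  then have "g (- 1) * g (- 1) = 1" using mult[of "-1" "-1"] by (simp add: one)
  then have "g (- 1) = 1"
    using nonneg[OF m] by (metis abs_of_nonneg real_sqrt_abs2 real_sqrt_one)
  then show ?thesis using mult[OF m assms] by simp
qed

lemma ultra_diff: "\<lbrakk>a \<in> A; b \<in> A\<rbrakk> \<Longrightarrow> g (a - b) \<le> max (g a) (g b)"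
  using ultra[of a "- b"] uminus uminus_mem by simp

lemma diff_commute: "\<lbrakk>a \<in> A; b \<in> A\<rbrakk> \<Longrightarrow> g (a - b) = g (b - a)"
  using uminus[of "a - b"] diff_mem by simp

lemma sum_le:
  assumes "\<And>i. i \<in> I \<Longrightarrow> f i \<in> A" "\<And>i. i \<in> I \<Longrightarrow> g (f i) \<le> c" "0 \<le> c"
  shows "g (sum f I) \<le> c"
  using assms
proof (induction I rule: infinite_finite_induct)
  case (insert i I)
  have "g (f i + sum f I) \<le> max (g (f i)) (g (sum f I))"
    using insert by (intro ultra sum_mem) auto
  also have "\<dots> \<le> c" using insert by auto
  finally show ?case using insert by simp
qed (auto simp: zero)

lemma sum_less:
  assumes "\<And>i. i \<in> I \<Longrightarrow> f i \<in> A" "\<And>i. i \<in> I \<Longrightarrow> g (f i) < c" "0 < c"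
  shows "g (sum f I) < c"
  using assms
proof (induction I rule: infinite_finite_induct)
  case (insert i I)
  have "g (f i + sum f I) \<le> max (g (f i)) (g (sum f I))"
    using insert by (intro ultra sum_mem) auto
  also have "\<dots> < c" using insert by auto
  finally show ?case using insert by simp
qed (auto simp: zero)

text \<open>Writing \<open>a\<close> as \<open>(a + b) - b\<close> shows that \<open>b\<close> is
  too small to account for \<open>g a\<close>. It isolates the dominant monomial in the
  multiplicativity of the Gauss norm.\<close>

lemma add_eq:
  assumes "a \<in> A" "b \<in> A" "g b < g a" shows "g (a + b) = g a"
proof -
  have "g a \<le> max (g (a + b)) (g b)"
    using ultra_diff[of "a + b" b] assms add_mem by simp
  moreover have "g (a + b) \<le> g a" using ultra[of a b] assms by simp
  ultimately show ?thesis using assms(3) by simp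
qed

text \<open>Each of \<open>a\<close> and \<open>b\<close> differs from the other by an element of
  the kernel, which the ultrametric inequality ignores. Needed because the substitution that bounds
  a point reproduces it only modulo the kernel.\<close>

lemma eq_of_diff_zero:
  assumes "a \<in> A" "b \<in> A" "g (a - b) = 0" shows "g a = g b"
proof -
  have "g a \<le> g b"
    using ultra[of "a - b" b] assms diff_mem nonneg[of b] by (simp add: max_def split: if_splits)
  moreover have "g b \<le> g a"
    using ultra_diff[of a "a - b"] assms diff_mem nonneg[of a] by (simp add: max_def split: if_splits)
  ultimately show ?thesis by simp
qed

lemma unit_nonzero:
  assumes "a \<in> A" "b \<in> A" "a * b = 1" shows "g a \<noteq> 0"
  using mult[OF assms(1,2)] assms(3) one by auto

end

text \<open>The usual argument: apply the binomial theorem to \<open>(f + g)\<^sup>n\<close> and let \<open>n\<close> tend to infinity.\<close>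

lemma ultrametric_of_triangle:
  fixes A :: "'b::comm_ring_1 set"
  assumes one: "1 \<in> A" "g 1 = (1::real)" and zero: "0 \<in> A" "g 0 = 0"
    and add: "\<And>a b. \<lbrakk>a \<in> A; b \<in> A\<rbrakk> \<Longrightarrow> a + b \<in> A"
    and mult: "\<And>a b. \<lbrakk>a \<in> A; b \<in> A\<rbrakk> \<Longrightarrow> a * b \<in> A"
    and nonneg: "\<And>a. a \<in> A \<Longrightarrow> 0 \<le> g a"
    and gmult: "\<And>a b. \<lbrakk>a \<in> A; b \<in> A\<rbrakk> \<Longrightarrow> g (a * b) = g a * g b"
    and gadd: "\<And>a b. \<lbrakk>a \<in> A; b \<in> A\<rbrakk> \<Longrightarrow> g (a + b) \<le> g a + g b"
    and gnat: "\<And>n. of_nat n \<in> A" "\<And>n. g (of_nat n) \<le> 1"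
    and ab: "a \<in> A" "b \<in> A"
  shows "g (a + b) \<le> max (g a) (g b)"
proof -
  define M where "M = max (g a) (g b)"
  have M0: "0 \<le> M" using nonneg[OF ab(1)] by (simp add: M_def)
  have pow_mem: "x ^ k \<in> A" if "x \<in> A" for x k
    using that by (induction k) (auto intro: one mult)
  have pow: "g (x ^ k) = g x ^ k" if "x \<in> A" for x k
    using that by (induction k) (auto simp: one gmult pow_mem)
  have sum_mem: "sum f I \<in> A" if "\<And>i. i \<in> I \<Longrightarrow> f i \<in> A" for f and I :: "nat set"
    using that by (induction I rule: infinite_finite_induct) (auto intro: zero add)
  have sum: "g (sum f I) \<le> (\<Sum>i\<in>I. g (f i))" if "\<And>i. i \<in> I \<Longrightarrow> f i \<in> A" for f and I :: "nat set"
    using that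
  proof (induction I rule: infinite_finite_induct)
    case (insert i I)
    have "g (f i + sum f I) \<le> g (f i) + g (sum f I)"
      using insert by (intro gadd sum_mem) auto
    then show ?case using insert by fastforce
  qed (auto simp: zero)
  have key: "g (a + b) ^ n \<le> (real n + 1) * M ^ n" for n
  proof -
    have mem: "of_nat (n choose k) * a ^ k * b ^ (n - k) \<in> A" for k
      by (intro mult gnat pow_mem ab)
    have le: "g (of_nat (n choose k) * a ^ k * b ^ (n - k)) \<le> M ^ n" if "k \<le> n" for k
    proof -
      have "g (of_nat (n choose k) * a ^ k * b ^ (n - k))
          = g (of_nat (n choose k)) * (g a ^ k * g b ^ (n - k))"
        by (simp add: gmult mult gnat pow_mem ab pow mult.assoc)
      also have "\<dots> \<le> 1 * (M ^ k * M ^ (n - k))"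
        using nonneg ab M0 by (intro mult_mono gnat power_mono) (auto simp: M_def)
      also have "\<dots> = M ^ n" using that by (simp flip: power_add)
      finally show ?thesis .
    qed
    have "g (a + b) ^ n = g (\<Sum>k\<le>n. of_nat (n choose k) * a ^ k * b ^ (n - k))"
      using pow[OF add[OF ab], of n] by (simp add: binomial_ring)
    also have "\<dots> \<le> (\<Sum>k\<le>n. g (of_nat (n choose k) * a ^ k * b ^ (n - k)))"
      by (rule sum) (rule mem)
    also have "\<dots> \<le> (\<Sum>k\<le>n. M ^ n)" by (intro sum_mono le) auto
    finally show ?thesis by (simp add: algebra_simps)
  qed
  show ?thesis
  proof (rule ccontr)
    assume "\<not> ?thesis"
    then have lt: "M < g (a + b)" by (simp only: M_def not_le)
    show False
    proof (cases "M = 0")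
      case True
      then show False using key[of 1] lt by simp
    next
      case False
      with M0 have Mp: "0 < M" by simp
      define q where "q = g (a + b) / M"
      have q: "1 < q" using lt Mp by (simp add: q_def)
      have le: "q ^ n \<le> real n + 1" for n
        using key[of n] Mp by (simp add: q_def power_divide field_simps)
      have "(\<lambda>n. real n * (1 / q) ^ n) \<longlonglongrightarrow> 0"
        using powser_times_n_limit_0[of "1 / q"] q by simp
      moreover have "(\<lambda>n. (1 / q) ^ n) \<longlonglongrightarrow> 0"
        using q by (intro LIMSEQ_realpow_zero) auto
      ultimately have "(\<lambda>n. (real n + 1) * (1 / q) ^ n) \<longlonglongrightarrow> 0 + 0"
        unfolding distrib_right mult_1 by (rule tendsto_add)
      then have "eventually (\<lambda>n. (real n + 1) * (1 / q) ^ n < 1) sequentially"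
        by (rule order_tendstoD(2)) simp
      then obtain n where "(real n + 1) * (1 / q) ^ n < 1"
        by (auto simp: eventually_sequentially)
      then have "real n + 1 < q ^ n" using q by (simp add: power_divide field_simps)
      then show False using le[of n] by simp
    qed
  qed
qed

section \<open>Localization at the elements of nonzero seminorm\<close>

definition loc :: "'b::field set \<Rightarrow> ('b \<Rightarrow> real) \<Rightarrow> 'b set" where
  "loc A g = {a / b |a b. a \<in> A \<and> b \<in> A \<and> g b \<noteq> 0}"

definition loc_norm :: "'b::field set \<Rightarrow> ('b \<Rightarrow> real) \<Rightarrow> 'b \<Rightarrow> real" where
  "loc_norm A g h = (SOME r. \<exists>a\<in>A. \<exists>b\<in>A. g b \<noteq> 0 \<and> h = a / b \<and> r = g a / g b)"

text \<open>Equal fractions cross-multiply in the ambient field, and multiplicativity of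
  \<open>g\<close> turns this into equality of the quotients of values; so the choice in
  \<open>loc_norm\<close> is immaterial.\<close>

lemma loc_norm_divide:
  assumes "ultra_seminorm A g" "a \<in> A" "b \<in> A" "g b \<noteq> 0"
  shows "loc_norm A g (a / b) = g a / g b"
proof -
  interpret ultra_seminorm A g by fact
  have "\<exists>a'\<in>A. \<exists>b'\<in>A. g b' \<noteq> 0 \<and> a / b = a' / b' \<and> loc_norm A g (a / b) = g a' / g b'"
    unfolding loc_norm_def by (rule someI[of _ "g a / g b"]) (use assms in blast)
  then obtain a' b' where *: "a' \<in> A" "b' \<in> A" "g b' \<noteq> 0" "a / b = a' / b'"
      "loc_norm A g (a / b) = g a' / g b'" by blast
  have "b \<noteq> 0" "b' \<noteq> 0" using assms(4) *(3) zero by auto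
  then have "a * b' = a' * b" using *(4) by (simp add: field_simps)
  then have "g a * g b' = g a' * g b" using mult assms(2,3) *(1,2) by metis
  then have "g a / g b = g a' / g b'" using *(3) assms(4) by (simp add: frac_eq_eq)
  then show ?thesis using *(4,5) by simp
qed

lemma loc_divideI: "\<lbrakk>a \<in> A; b \<in> A; g b \<noteq> 0\<rbrakk> \<Longrightarrow> a / b \<in> loc A g"
  by (auto simp: loc_def)

lemma locE:
  assumes "h \<in> loc A g"
  obtains a b where "a \<in> A" "b \<in> A" "g b \<noteq> 0" "h = a / b"
  using assms by (auto simp: loc_def)

lemma ultra_seminorm_loc:
  assumes "ultra_seminorm A g"
  shows "ultra_seminorm (loc A g) (loc_norm A g)"
proof -
  interpret ultra_seminorm A g by fact
  note ed = loc_norm_divide[OF assms]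
  have nz: "b \<noteq> 0" if "g b \<noteq> 0" for b using that zero by auto
  have pos: "0 < g b" if "b \<in> A" "g b \<noteq> 0" for b using nonneg[OF that(1)] that(2) by simp
  show ?thesis
  proof
    show "0 \<in> loc A g" using loc_divideI[of 0 A 1 g] zero_mem one_mem one by simp
    show "1 \<in> loc A g" using loc_divideI[of 1 A 1 g] zero_mem one_mem one by simp
    show "loc_norm A g 0 = 0" using ed[of 0 1] zero_mem one_mem one zero by simp
    show "loc_norm A g 1 = 1" using ed[of 1 1] one_mem one by simp
  next
    fix h assume "h \<in> loc A g"
    then obtain a b where h: "a \<in> A" "b \<in> A" "g b \<noteq> 0" "h = a / b" by (rule locE)
    show "- h \<in> loc A g"
      using loc_divideI[of "- a" A b g] h uminus_mem by simp
    show "0 \<le> loc_norm A g h" using ed h nonneg by simp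
  next
    fix h h' assume "h \<in> loc A g" "h' \<in> loc A g"
    then obtain a b a' b' where h: "a \<in> A" "b \<in> A" "g b \<noteq> 0" "h = a / b"
      and h': "a' \<in> A" "b' \<in> A" "g b' \<noteq> 0" "h' = a' / b'" by (metis locE)
    have bb: "b * b' \<in> A" "g (b * b') = g b * g b'" "g (b * b') \<noteq> 0"
      using h h' mult mult_mem by auto
    have s: "h + h' = (a * b' + a' * b) / (b * b')" 
      using nz h h' by (simp add: field_simps)
    have sm: "a * b' + a' * b \<in> A" using h h' by (intro add_mem mult_mem)
    have p: "h * h' = (a * a') / (b * b')" using h h' by simp
    show "h + h' \<in> loc A g" unfolding s by (intro loc_divideI sm bb)
    show "h * h' \<in> loc A g" unfolding p by (intro loc_divideI mult_mem bb h h')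
    show "loc_norm A g (h * h') = loc_norm A g h * loc_norm A g h'"
      unfolding p using ed[of "a * a'" "b * b'"] ed[of a b] ed[of a' b'] h h' bb mult mult_mem
      by simp
    have "g (a * b' + a' * b) \<le> max (g a * g b') (g a' * g b)"
      using ultra[of "a * b'" "a' * b"] h h' mult mult_mem by simp
    then have "g (a * b' + a' * b) / (g b * g b') \<le> max (g a * g b') (g a' * g b) / (g b * g b')"
      using pos[OF h(2,3)] pos[OF h'(2,3)] by (intro divide_right_mono) auto
    also have "\<dots> = max (g a / g b) (g a' / g b')"
      using pos[OF h(2,3)] pos[OF h'(2,3)] by (simp add: max_def field_simps)
    finally show "loc_norm A g (h + h') \<le> max (loc_norm A g h) (loc_norm A g h')"
      unfolding s using ed[OF sm bb(1)] ed[of a b] ed[of a' b'] h h' bb by simp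
  qed
qed

lemma subset_loc: "ultra_seminorm A g \<Longrightarrow> a \<in> A \<Longrightarrow> a \<in> loc A g"
  using loc_divideI[of a A 1 g] ultra_seminorm.one_mem ultra_seminorm.one by fastforce

lemma loc_norm_eq: "ultra_seminorm A g \<Longrightarrow> a \<in> A \<Longrightarrow> loc_norm A g a = g a"
  using loc_norm_divide[of A g a 1] ultra_seminorm.one_mem ultra_seminorm.one by fastforce

text \<open>Multiplicativity forces \<open>d h * d b = d a\<close> for \<open>h = a / b\<close>. It
  shows that a point over an overlap of charts is determined by its restriction to one
  chart.\<close>

lemma loc_norm_unique:
  assumes g: "ultra_seminorm A g" and d: "ultra_seminorm B d"
    and AB: "A \<subseteq> B" "\<And>a. a \<in> A \<Longrightarrow> d a = g a"
    and h: "h \<in> loc A g" "h \<in> B"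
  shows "d h = loc_norm A g h"
proof -
  interpret g: ultra_seminorm A g by fact
  interpret d: ultra_seminorm B d by fact
  obtain a b where ab: "a \<in> A" "b \<in> A" "g b \<noteq> 0" "h = a / b" using h(1) by (rule locE)
  have "b \<noteq> 0" using ab g.zero by auto
  then have "d h * d b = d a" using d.mult[of h b] ab AB h(2) by auto
  then have "d h * g b = g a" using ab AB(2) by simp
  then have "d h = g a / g b" using ab(3) by (simp add: eq_divide_eq)
  then show ?thesis using loc_norm_divide[OF g ab(1-3)] ab(4) by simp
qed

section \<open>Finite maxima bounded below by zero\<close>

text \<open>Zero is included so that the empty maximum exists: the zero polynomial gets norm zero,
  and a vertex gets distance zero to itself.\<close>

definition fmax :: "'a set \<Rightarrow> ('a \<Rightarrow> real) \<Rightarrow> real" where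
  "fmax S f = Max (insert 0 (f ` S))"

lemma fmax_empty [simp]: "fmax {} f = 0"
  by (simp add: fmax_def)

lemma fmax_insert: "finite S \<Longrightarrow> fmax (insert i S) f = max (f i) (fmax S f)"
  by (simp add: fmax_def insert_commute[of 0])

lemma fmax_nonneg: "finite S \<Longrightarrow> 0 \<le> fmax S f"
  by (simp add: fmax_def)

lemma fmax_ge: "\<lbrakk>finite S; i \<in> S\<rbrakk> \<Longrightarrow> f i \<le> fmax S f"
  by (simp add: fmax_def)

lemma fmax_le_iff: "finite S \<Longrightarrow> fmax S f \<le> c \<longleftrightarrow> 0 \<le> c \<and> (\<forall>i\<in>S. f i \<le> c)"
  by (simp add: fmax_def)

lemma fmax_attained: 
  assumes "finite S" "fmax S f \<noteq> 0" obtains i where "i \<in> S" "f i = fmax S f"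
proof -
  have "fmax S f \<in> insert 0 (f ` S)" unfolding fmax_def using assms(1) by (intro Max_in) auto
  then show ?thesis using assms(2) that by auto
qed

lemma fmax_cong: "(\<And>i. i \<in> S \<Longrightarrow> f i = f' i) \<Longrightarrow> fmax S f = fmax S f'"
  by (simp add: fmax_def cong: image_cong)

lemma continuous_map_fmax:
  assumes "finite S" "\<And>i. i \<in> S \<Longrightarrow> continuous_map X euclideanreal (\<lambda>x. f x i)"
  shows "continuous_map X euclideanreal (\<lambda>x. fmax S (f x))"
  using assms
proof (induction S)
  case (insert i S)
  then show ?case by (simp add: fmax_insert continuous_map_real_max)
qed simp

lemma mult_less_of_less:
  fixes a b c d :: real
  assumes "a < c \<or> b < d" "0 \<le> a" "0 \<le> b" "0 < c" "0 < d" "a \<le> c" "b \<le> d"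
  shows "a * b < c * d"
  using assms(1)
proof
  assume "a < c"
  then have "a * b \<le> a * d" "a * d < c * d" using assms by (auto intro: mult_left_mono)
  then show ?thesis by simp
next
  assume "b < d"
  then have "a * b \<le> c * b" "c * b < c * d" using assms by (auto intro: mult_right_mono)
  then show ?thesis by simp
qed

section \<open>Polynomials\<close>

lemma poly_mapping_eq_sum_single:
  "P = (\<Sum>m\<in>Poly_Mapping.keys P. Poly_Mapping.single m (Poly_Mapping.lookup P m))"
proof (rule poly_mapping_eqI)
  fix k
  show "Poly_Mapping.lookup P k = Poly_Mapping.lookup
      (\<Sum>m\<in>Poly_Mapping.keys P. Poly_Mapping.single m (Poly_Mapping.lookup P m)) k"
    by (simp add: lookup_sum lookup_single when_def in_keys_iff)
qed

lemma poly_mapping_mult_eq_sum: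
  "P * Q = (\<Sum>(m, n)\<in>Poly_Mapping.keys P \<times> Poly_Mapping.keys Q.
      Poly_Mapping.single (m + n) (Poly_Mapping.lookup P m * Poly_Mapping.lookup Q n))"
proof -
  have "P * Q = (\<Sum>m\<in>Poly_Mapping.keys P. Poly_Mapping.single m (Poly_Mapping.lookup P m))
      * (\<Sum>m\<in>Poly_Mapping.keys Q. Poly_Mapping.single m (Poly_Mapping.lookup Q m))"
    by (simp flip: poly_mapping_eq_sum_single)
  then show ?thesis by (simp add: sum_product mult_single sum.cartesian_product)
qed

section \<open>Gauss norms\<close>

definition gauss :: "('b::zero \<Rightarrow> real) \<Rightarrow> ('a \<Rightarrow> real) \<Rightarrow> ('a \<Rightarrow>\<^sub>0 'b) \<Rightarrow> real" where
  "gauss g w P = fmax (Poly_Mapping.keys P) (\<lambda>m. g (Poly_Mapping.lookup P m) * w m)"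

lemma (in ultra_seminorm) gauss_coeff_le:
  assumes "\<And>m. Poly_Mapping.lookup P m \<in> A" "\<And>m. 0 \<le> w m"
  shows "g (Poly_Mapping.lookup P m) * w m \<le> gauss g w P"
proof (cases "m \<in> Poly_Mapping.keys P")
  case True
  then show ?thesis unfolding gauss_def by (rule fmax_ge[OF finite_keys])
next
  case False
  then show ?thesis by (simp add: in_keys_iff zero gauss_def fmax_nonneg)
qed

lemma (in ultra_seminorm) gauss_leI:
  assumes "\<And>m. g (Poly_Mapping.lookup P m) * w m \<le> c" "0 \<le> c"
  shows "gauss g w P \<le> c"
  unfolding gauss_def using assms by (subst fmax_le_iff) auto

text \<open>The Gauss lemma, for weights that are multiplicative on exponents and may vanish.
  General exponents serve two uses: exponent vectors weighted by radii, and powers of a single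
  variable of norm one. The linear order on exponents is what selects the extremal
  monomials.\<close>

theorem ultra_seminorm_gauss:
  fixes w :: "'a::{ordered_cancel_comm_monoid_add, linorder} \<Rightarrow> real"
  assumes "ultra_seminorm A g"
    and w: "\<And>m. 0 \<le> w m" "w 0 = 1" "\<And>m n. w (m + n) = w m * w n"
  shows "ultra_seminorm {P. \<forall>m. Poly_Mapping.lookup P m \<in> A} (gauss g w)"
proof -
  interpret ultra_seminorm A g by fact
  have nn: "0 \<le> gauss g w P" for P :: "'a \<Rightarrow>\<^sub>0 'b" by (simp add: gauss_def fmax_nonneg)
  have le: "g (Poly_Mapping.lookup P m) * w m \<le> gauss g w P"
    if "\<forall>m. Poly_Mapping.lookup P m \<in> A" for P :: "'a \<Rightarrow>\<^sub>0 'b" and m using gauss_coeff_le[of P w m] that w(1) by simp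
  show ?thesis
  proof
    show "gauss g w 0 = 0" by (simp add: gauss_def)
    have "gauss g w 1 = gauss g w (Poly_Mapping.single 0 1)" by simp
    also have "\<dots> = 1" using one w(2) by (simp add: gauss_def fmax_insert del: single_one)
    finally show "gauss g w 1 = 1" .
  next
    fix P Q :: "'a \<Rightarrow>\<^sub>0 'b" assume "P \<in> {P. \<forall>m. Poly_Mapping.lookup P m \<in> A}"
      and "Q \<in> {P. \<forall>m. Poly_Mapping.lookup P m \<in> A}"
    then have P: "\<forall>m. Poly_Mapping.lookup P m \<in> A" and Q: "\<forall>m. Poly_Mapping.lookup Q m \<in> A"
      by auto
    let ?S = "Poly_Mapping.keys P \<times> Poly_Mapping.keys Q"
    define T where "T k = (\<lambda>(m, n). if m + n = k
        then Poly_Mapping.lookup P m * Poly_Mapping.lookup Q n else 0)" for k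
    have lk: "Poly_Mapping.lookup (P * Q) k = sum (T k) ?S" for k
      unfolding T_def
      by (subst poly_mapping_mult_eq_sum)
        (simp add: lookup_sum case_prod_beta lookup_single when_def)
    have T_mem: "T k x \<in> A" for k x
      using P Q zero_mem mult_mem by (auto simp: T_def split: prod.splits)
    have TM: "g (T (m + n) (m, n)) * w (m + n)
        = g (Poly_Mapping.lookup P m) * w m * (g (Poly_Mapping.lookup Q n) * w n)" for m n
      using P Q by (simp add: T_def mult w(3))
    show mem: "P * Q \<in> {P. \<forall>m. Poly_Mapping.lookup P m \<in> A}"
      using T_mem by (auto simp: lk intro!: sum_mem)
    let ?c = "gauss g w P * gauss g w Q"
    have Tle: "g (T k x) * w k \<le> ?c" for k x
    proof (cases "fst x + snd x = k")
      case True
      then have "g (T k x) * w k = g (Poly_Mapping.lookup P (fst x)) * w (fst x)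
          * (g (Poly_Mapping.lookup Q (snd x)) * w (snd x))"
        using TM[of "fst x" "snd x"] by simp
      also have "\<dots> \<le> ?c" using le P Q nn nonneg w by (intro mult_mono) auto
      finally show ?thesis .
    next
      case False
      then show ?thesis using nn by (simp add: T_def case_prod_beta zero)
    qed
    \<comment> \<open>\<open>sum_le\<close> compares unweighted seminorms, so the weight is divided
      out first; weight zero leaves nothing to show.\<close>
    have up: "g (sum (T k) ?S) * w k \<le> ?c" for k
    proof (cases "w k = 0")
      case False
      then have wk: "0 < w k" using w(1)[of k] by simp
      have "g (sum (T k) ?S) \<le> ?c / w k"
        using Tle wk nn by (intro sum_le T_mem) (auto simp: pos_le_divide_eq)
      then show ?thesis using wk by (simp add: pos_le_divide_eq)
    qed (use nn in simp)
    have "gauss g w (P * Q) \<le> ?c" using up nn by (intro gauss_leI) (auto simp: lk)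
    moreover have "?c \<le> gauss g w (P * Q)"
    proof (cases "?c = 0")
      case True
      then show ?thesis using nn[of "P * Q"] by (simp only:)
    next
      case False
      then have P0: "0 < gauss g w P" and Q0: "0 < gauss g w Q"
        using nn[of P] nn[of Q] by auto
      \<comment> \<open>Among the monomials realizing the maximum, the largest ones of \<open>P\<close> and \<open>Q\<close> have a product
        that no other pair of monomials reaches with full weight.\<close>
      define SP where "SP = {m \<in> Poly_Mapping.keys P. g (Poly_Mapping.lookup P m) * w m = gauss g w P}"
      define SQ where "SQ = {m \<in> Poly_Mapping.keys Q. g (Poly_Mapping.lookup Q m) * w m = gauss g w Q}"
      have "SP \<noteq> {}" 
        using fmax_attained[of "Poly_Mapping.keys P" "\<lambda>m. g (Poly_Mapping.lookup P m) * w m"] P0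
        unfolding SP_def gauss_def by fastforce
      moreover have "SQ \<noteq> {}" 
        using fmax_attained[of "Poly_Mapping.keys Q" "\<lambda>m. g (Poly_Mapping.lookup Q m) * w m"] Q0
        unfolding SQ_def gauss_def by fastforce
      moreover have fin: "finite SP" "finite SQ" by (simp_all add: SP_def SQ_def)
      ultimately have "Max SP \<in> SP" "Max SQ \<in> SQ" by simp_all
      then obtain p q where p: "p = Max SP" "p \<in> SP" and q: "q = Max SQ" "q \<in> SQ" by blast
      let ?k = "p + q"
      have main: "g (T ?k (p, q)) * w ?k = ?c" using p(2) q(2) TM by (simp add: SP_def SQ_def)
      then have wk: "0 < w ?k" using False w(1)[of ?k] by (metis less_eq_real_def mult_zero_right)
      have less: "g (T ?k x) * w ?k < ?c" if x: "x \<in> ?S - {(p, q)}" for x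
      proof -
        obtain m n where mn: "x = (m, n)" "m \<in> Poly_Mapping.keys P" "n \<in> Poly_Mapping.keys Q"
          "(m, n) \<noteq> (p, q)" using x by (cases x) auto
        show ?thesis
        proof (cases "m + n = ?k")
          case False
          then show ?thesis using mn P0 Q0 by (simp add: T_def zero)
        next
          case True
          have "m \<notin> SP \<or> n \<notin> SQ"
          proof (rule ccontr)
            assume "\<not> ?thesis"
            then have "m \<le> p" "n \<le> q" using p(1) q(1) fin by auto
            moreover have "m \<noteq> p \<or> n \<noteq> q" using mn(4) by auto
            ultimately have "m + n < p + q"
              by (metis True add_le_cancel_right add_left_cancel add_right_cancel order_antisym
                  add_mono order_le_less)
            then show False using True by simp
          qed
          then have "g (Poly_Mapping.lookup P m) * w m < gauss g w P \<or>
              g (Poly_Mapping.lookup Q n) * w n < gauss g w Q"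
            using mn le[OF P, of m] le[OF Q, of n] by (auto simp: SP_def SQ_def)
          moreover have "0 \<le> g (Poly_Mapping.lookup P m) * w m" "0 \<le> g (Poly_Mapping.lookup Q n) * w n"
            using P Q nonneg w by auto
          ultimately have "g (Poly_Mapping.lookup P m) * w m * (g (Poly_Mapping.lookup Q n) * w n) < ?c"
            using P0 Q0 le[OF P, of m] le[OF Q, of n]
            by (intro mult_less_of_less) auto
          then show ?thesis using TM[of m n] True mn(1) by simp
        qed
      qed
      have pq: "(p, q) \<in> ?S" using p(2) q(2) by (auto simp: SP_def SQ_def)
      have c0: "0 < ?c" using P0 Q0 by simp
      have "g (sum (T ?k) (?S - {(p, q)})) < ?c / w ?k"
        using less wk c0 by (intro sum_less T_mem) (auto simp: pos_less_divide_eq)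
      moreover have "g (T ?k (p, q)) = ?c / w ?k" using main wk by (simp add: field_simps)
      ultimately have "g (T ?k (p, q) + sum (T ?k) (?S - {(p, q)})) = ?c / w ?k"
        using T_mem by (subst add_eq) (auto intro: sum_mem)
      moreover have "sum (T ?k) ?S = T ?k (p, q) + sum (T ?k) (?S - {(p, q)})"
        by (rule sum.remove) (use pq in auto)
      ultimately have "g (Poly_Mapping.lookup (P * Q) ?k) * w ?k = ?c"
        using wk lk by simp
      then show ?thesis using le[of "P * Q" ?k] mem by simp
    qed
    ultimately show "gauss g w (P * Q) = ?c" by simp
    show "P + Q \<in> {P. \<forall>m. Poly_Mapping.lookup P m \<in> A}" using P Q add_mem by (simp add: lookup_add)
    show "gauss g w (P + Q) \<le> max (gauss g w P) (gauss g w Q)"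
    proof (rule gauss_leI)
      fix m
      have "g (Poly_Mapping.lookup (P + Q) m) * w m
          \<le> max (g (Poly_Mapping.lookup P m)) (g (Poly_Mapping.lookup Q m)) * w m"
        using P Q w by (intro mult_right_mono) (auto simp: lookup_add intro: ultra)
      also have "\<dots> \<le> max (gauss g w P) (gauss g w Q)"
        using le[OF P, of m] le[OF Q, of m] by (auto simp: max_def)
      finally show "g (Poly_Mapping.lookup (P + Q) m) * w m \<le> max (gauss g w P) (gauss g w Q)" .
    qed (use nn in \<open>simp add: le_max_iff_disj\<close>)
  qed (auto simp: zero_mem one_mem uminus_mem lookup_one when_def nn)
qed

section \<open>Evaluation of monomials and polynomials\<close>

definition monom_eval :: "('i \<Rightarrow> 'c::comm_monoid_mult) \<Rightarrow> ('i \<Rightarrow>\<^sub>0 nat) \<Rightarrow> 'c" where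
  "monom_eval v m = (\<Prod>i\<in>Poly_Mapping.keys m. v i ^ Poly_Mapping.lookup m i)"

lemma monom_eval_superset:
  "\<lbrakk>finite S; Poly_Mapping.keys m \<subseteq> S\<rbrakk> \<Longrightarrow> monom_eval v m = (\<Prod>i\<in>S. v i ^ Poly_Mapping.lookup m i)"
  unfolding monom_eval_def by (intro prod.mono_neutral_left) (auto simp: in_keys_iff)

lemma monom_eval_zero [simp]: "monom_eval v 0 = 1"
  by (simp add: monom_eval_def)

lemma monom_eval_single [simp]: "monom_eval v (Poly_Mapping.single i k) = v i ^ k"
  by (cases "k = 0") (simp_all add: monom_eval_def)

lemma monom_eval_add: "monom_eval v (m + n) = monom_eval v m * monom_eval v n"
proof -
  let ?S = "Poly_Mapping.keys m \<union> Poly_Mapping.keys n"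
  have "monom_eval v (m + n) = (\<Prod>i\<in>?S. v i ^ Poly_Mapping.lookup (m + n) i)"
    using keys_add[of m n] by (intro monom_eval_superset) auto
  also have "\<dots> = monom_eval v m * monom_eval v n"
    by (simp add: lookup_add power_add prod.distrib monom_eval_superset[of ?S])
  finally show ?thesis .
qed

lemma monom_eval_nonneg: "(\<And>i. 0 \<le> v i) \<Longrightarrow> 0 \<le> (monom_eval v m :: real)"
  unfolding monom_eval_def by (intro prod_nonneg zero_le_power) auto

definition peval :: "('k::zero \<Rightarrow> 'c::comm_ring_1) \<Rightarrow> ('i \<Rightarrow> 'c) \<Rightarrow> (('i \<Rightarrow>\<^sub>0 nat) \<Rightarrow>\<^sub>0 'k) \<Rightarrow> 'c" where
  "peval h v P = (\<Sum>m\<in>Poly_Mapping.keys P. h (Poly_Mapping.lookup P m) * monom_eval v m)"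

locale coeff_hom =
  fixes h :: "'k::comm_ring_1 \<Rightarrow> 'c::comm_ring_1"
  assumes hom_zero: "h 0 = 0" and hom_one: "h 1 = 1"
    and hom_add: "h (a + b) = h a + h b" and hom_mult: "h (a * b) = h a * h b"
begin

lemma peval_add: "peval h v (P + Q) = peval h v P + peval h v Q"
  unfolding peval_def
  by (rule setsum_keys_plus_distrib) (simp_all add: hom_zero hom_add distrib_right)

lemma peval_zero: "peval h v 0 = 0"
  by (simp add: peval_def)

lemma peval_sum: "peval h v (sum f I) = (\<Sum>i\<in>I. peval h v (f i))"
  by (induction I rule: infinite_finite_induct) (auto simp: peval_zero peval_add)

lemma peval_single: "peval h v (Poly_Mapping.single m c) = h c * monom_eval v m"
  by (cases "c = 0") (auto simp: peval_def hom_zero)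

lemma peval_one: "peval h v 1 = 1"
  using peval_single[of v 0 1] by (simp add: hom_one)

lemma peval_uminus: "peval h v (- P) = - peval h v P"
  using peval_add[of v P "- P"] by (simp add: peval_zero eq_neg_iff_add_eq_0 add.commute)

lemma peval_diff: "peval h v (P - Q) = peval h v P - peval h v Q"
  using peval_add[of v P "- Q"] by (simp add: peval_uminus)

lemma peval_mult: "peval h v (P * Q) = peval h v P * peval h v Q"
proof -
  let ?S = "Poly_Mapping.keys P \<times> Poly_Mapping.keys Q"
  have "peval h v (P * Q) = (\<Sum>(m, n)\<in>?S. h (Poly_Mapping.lookup P m * Poly_Mapping.lookup Q n)
      * monom_eval v (m + n))"
    by (subst poly_mapping_mult_eq_sum) (simp add: peval_sum peval_single case_prod_beta)
  also have "\<dots> = (\<Sum>(m, n)\<in>?S. (h (Poly_Mapping.lookup P m) * monom_eval v m)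
      * (h (Poly_Mapping.lookup Q n) * monom_eval v n))"
    by (simp add: hom_mult monom_eval_add ac_simps)
  also have "\<dots> = peval h v P * peval h v Q"
    by (simp add: peval_def sum_product sum.cartesian_product)
  finally show ?thesis .
qed


end

text \<open>A termwise estimate followed by the ultrametric inequality. This is the source of
  maximality: the Gauss norm dominates every seminorm obtained by substituting for the variables
  elements of norm at most the radii.\<close>

lemma (in ultra_seminorm) peval_le_gauss:
  assumes "ultra_seminorm B nu" "B = UNIV"
    and h: "\<And>c. h c \<in> A" "\<And>c. g (h c) = nu c"
    and v: "\<And>i. v i \<in> A" "\<And>i. g (v i) \<le> rad i"
  shows "peval h v Q \<in> A" "g (peval h v Q) \<le> gauss nu (monom_eval rad) Q"
proof -
  interpret nu: ultra_seminorm UNIV nu using assms(1,2) by simp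
  have rad: "0 \<le> rad i" for i using v[of i] nonneg by fastforce
  have me: "monom_eval v m \<in> A" for m
    unfolding monom_eval_def by (intro prod_mem power_mem v)
  then show "peval h v Q \<in> A" unfolding peval_def by (intro sum_mem mult_mem h)
  have ml: "g (monom_eval v m) \<le> monom_eval rad m" for m
    unfolding monom_eval_def using v rad nonneg
    by (subst prod) (auto simp: power power_mem intro!: prod_mono power_mono)
  show "g (peval h v Q) \<le> gauss nu (monom_eval rad) Q"
    unfolding peval_def
  proof (rule sum_le)
    fix m
    show "h (Poly_Mapping.lookup Q m) * monom_eval v m \<in> A" by (intro mult_mem h me)
    have "g (h (Poly_Mapping.lookup Q m) * monom_eval v m)
        = nu (Poly_Mapping.lookup Q m) * g (monom_eval v m)"
      using h me by (simp add: mult)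
    also have "\<dots> \<le> nu (Poly_Mapping.lookup Q m) * monom_eval rad m"
      using ml nu.nonneg by (intro mult_left_mono) auto
    also have "\<dots> \<le> gauss nu (monom_eval rad) Q"
      using rad by (intro nu.gauss_coeff_le monom_eval_nonneg) auto
    finally show "g (h (Poly_Mapping.lookup Q m) * monom_eval v m) \<le> gauss nu (monom_eval rad) Q" .
  qed (simp add: gauss_def fmax_nonneg)
qed

section \<open>Finite ultrametrics and trees\<close>

text \<open>
  A rooted tree on the vertex set \<open>S\<close> is encoded by \<open>\<pi> k\<close>, the set of vertices other than the root
  on the path from the root to \<open>k\<close>; a vertex \<open>k\<close> stands for the edge to its parent \<open>y k\<close>, and the
  symmetric difference of \<open>\<pi> k\<close> and \<open>\<pi> l\<close> consists of the edges between \<open>k\<close> and \<open>l\<close>.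
\<close>

definition tree_on :: "'v set \<Rightarrow> 'v \<Rightarrow> ('v \<Rightarrow> 'v) \<Rightarrow> ('v \<Rightarrow> 'v set) \<Rightarrow> bool" where
  "tree_on S z y \<pi> \<longleftrightarrow> z \<in> S \<and> (\<forall>k\<in>S. \<pi> k \<subseteq> S \<and>
     (k = z \<and> \<pi> k = {} \<or> y k \<in> S \<and> k \<notin> \<pi> (y k) \<and> \<pi> k = insert k (\<pi> (y k))))"

definition treedist :: "('v \<Rightarrow> real) \<Rightarrow> ('v \<Rightarrow> 'v set) \<Rightarrow> 'v \<Rightarrow> 'v \<Rightarrow> real" where
  "treedist r \<pi> k l = fmax ((\<pi> k - \<pi> l) \<union> (\<pi> l - \<pi> k)) r"

lemma treedist_commute: "treedist r \<pi> k l = treedist r \<pi> l k"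
  by (simp add: treedist_def Un_commute)

lemma treedist_nonneg: "\<lbrakk>finite (\<pi> k); finite (\<pi> l)\<rbrakk> \<Longrightarrow> 0 \<le> treedist r \<pi> k l"
  by (simp add: treedist_def fmax_nonneg)

text \<open>An element that separates \<open>\<pi> k\<close> from \<open>\<pi> m\<close> separates
  \<open>\<pi> l\<close> from one of the two. This works for any finite sets, so vertices outside a
  tree can be given empty paths.\<close>

lemma treedist_ultra:
  assumes "finite (\<pi> k)" "finite (\<pi> l)" "finite (\<pi> m)"
  shows "treedist r \<pi> k m \<le> max (treedist r \<pi> k l) (treedist r \<pi> l m)"
proof -
  have "r i \<le> max (treedist r \<pi> k l) (treedist r \<pi> l m)"
    if "i \<in> (\<pi> k - \<pi> m) \<union> (\<pi> m - \<pi> k)" for i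
  proof (cases "i \<in> (\<pi> k - \<pi> l) \<union> (\<pi> l - \<pi> k)")
    case True
    then have "r i \<le> treedist r \<pi> k l" unfolding treedist_def by (intro fmax_ge) (use assms in auto)
    then show ?thesis by simp
  next
    case False
    then have "i \<in> (\<pi> l - \<pi> m) \<union> (\<pi> m - \<pi> l)" using that by auto
    then have "r i \<le> treedist r \<pi> l m" unfolding treedist_def by (intro fmax_ge) (use assms in auto)
    then show ?thesis by simp
  qed
  moreover have "0 \<le> max (treedist r \<pi> k l) (treedist r \<pi> l m)"
    using treedist_nonneg[of \<pi> k l r] assms by simp
  ultimately show ?thesis
    unfolding treedist_def[of r \<pi> k m] using assms by (subst fmax_le_iff) auto
qed

text \<open>Induction on the number of points, removing a leaf. Distinct points at distance zero are
  allowed, because slopes may coincide. The edge lengths are taken among the distances, which later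
  confines them to a compact interval.\<close>

lemma ultrametric_eq_treedist:
  fixes d :: "'v \<Rightarrow> 'v \<Rightarrow> real"
  assumes "finite S" "S \<noteq> {}"
    and sym: "\<And>u v. d u v = d v u" and refl: "\<And>u. d u u = 0" and nonneg: "\<And>u v. 0 \<le> d u v"
    and ultra: "\<And>u v w. d u w \<le> max (d u v) (d v w)"
  shows "\<exists>z y \<pi> r. tree_on S z y \<pi> \<and> (\<forall>k\<in>S. r k \<in> range (case_prod d)) \<and>
           (\<forall>k\<in>S. \<forall>l\<in>S. d k l = treedist r \<pi> k l)"
  using assms(1,2)
proof (induction "card S" arbitrary: S)
  case 0
  then show ?case by simp
next
  case (Suc N)
  show ?case
  proof (cases "\<exists>u. S = {u}")
    case True
    then obtain u where "S = {u}" by blast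
    moreover have "0 \<in> range (case_prod d)" using rangeI[of "case_prod d" "(u, u)"] refl by simp
    ultimately have "tree_on S u id (\<lambda>_. {}) \<and> (\<forall>k\<in>S. (\<lambda>_. 0) k \<in> range (case_prod d)) \<and>
        (\<forall>k\<in>S. \<forall>l\<in>S. d k l = treedist (\<lambda>_. 0) (\<lambda>_. {}) k l)"
      by (simp add: tree_on_def treedist_def refl)
    then show ?thesis
      by - (rule exI[of _ u], rule exI[of _ id], rule exI[of _ "\<lambda>_. {}"], rule exI[of _ "\<lambda>_. 0"])
  next
    case False
    \<comment> \<open>A closest pair \<open>(u, x)\<close>: seen from any third point, \<open>u\<close> and \<open>x\<close> have the same distance,
      so \<open>x\<close> can be added as a leaf at \<open>u\<close>.\<close>
    define Pr where "Pr = {(u, x). u \<in> S \<and> x \<in> S \<and> u \<noteq> x}"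
    have "finite Pr" by (rule finite_subset[of _ "S \<times> S"]) (use Suc in \<open>auto simp: Pr_def\<close>)
    moreover have "Pr \<noteq> {}"
    proof -
      obtain u where u: "u \<in> S" using Suc by auto
      then have "S \<noteq> {u}" using False by blast
      then obtain x where "x \<in> S" "x \<noteq> u" using u by blast
      then show ?thesis using u by (auto simp: Pr_def)
    qed
    ultimately obtain e where e: "e \<in> Pr" "\<And>e'. e' \<in> Pr \<Longrightarrow> case_prod d e \<le> case_prod d e'"
      using arg_min_if_finite(1)[of Pr "case_prod d"] arg_min_least[of Pr _ "case_prod d"] by metis
    obtain u x where ux: "e = (u, x)" by (cases e)
    have uS: "u \<in> S" "x \<in> S" "u \<noteq> x" using e(1) ux by (auto simp: Pr_def)
    have min: "d u x \<le> d k l" if "k \<in> S" "l \<in> S" "k \<noteq> l" for k l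
      using e(2)[of "(k, l)"] that ux by (auto simp: Pr_def)
    let ?S = "S - {x}"
    have "N = card ?S" using Suc uS by simp
    moreover have "finite ?S" "?S \<noteq> {}" using Suc uS by auto
    ultimately obtain z y \<pi> r where t: "tree_on ?S z y \<pi>" "\<forall>k\<in>?S. r k \<in> range (case_prod d)"
      "\<forall>k\<in>?S. \<forall>l\<in>?S. d k l = treedist r \<pi> k l" using Suc(1)[of ?S] by blast
    have psub: "\<pi> k \<subseteq> ?S" if "k \<in> ?S" for k using t(1) that by (auto simp: tree_on_def)
    define \<pi>' where "\<pi>' = \<pi>(x := insert x (\<pi> u))"
    define r' where "r' = r(x := d u x)"
    have "tree_on S z (y(x := u)) \<pi>'"
      unfolding tree_on_def
    proof (intro conjI ballI)
      show "z \<in> S" using t(1) by (simp add: tree_on_def)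
    next
      fix k assume k: "k \<in> S"
      show "\<pi>' k \<subseteq> S" using psub[of u] psub[of k] k uS by (cases "k = x") (auto simp: \<pi>'_def)
      show "k = z \<and> \<pi>' k = {} \<or> (y(x := u)) k \<in> S \<and> k \<notin> \<pi>' ((y(x := u)) k) \<and>
          \<pi>' k = insert k (\<pi>' ((y(x := u)) k))"
      proof (cases "k = x")
        case True
        then show ?thesis using uS psub[of u] by (auto simp: \<pi>'_def)
      next
        case False
        then have kS: "k \<in> ?S" using k by simp
        then have "k = z \<and> \<pi> k = {} \<or> y k \<in> ?S \<and> k \<notin> \<pi> (y k) \<and> \<pi> k = insert k (\<pi> (y k))"
          using t(1) unfolding tree_on_def by blast
        then show ?thesis using False by (auto simp: \<pi>'_def)
      qed
    qed
    moreover have "\<forall>k\<in>S. r' k \<in> range (case_prod d)" using t(2) by (auto simp: r'_def)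
    moreover have "d k l = treedist r' \<pi>' k l" if kl: "k \<in> S" "l \<in> S" for k l
    proof -
      have old: "treedist r' \<pi>' k l = d k l" if "k \<in> ?S" "l \<in> ?S" for k l
      proof -
        have "treedist r' \<pi>' k l = treedist r \<pi> k l"
          using psub[of k] psub[of l] that unfolding treedist_def
          by (auto simp: \<pi>'_def r'_def intro!: fmax_cong)
        then show ?thesis using t(3) that by simp
      qed
      have new: "treedist r' \<pi>' x l = d x l" if l: "l \<in> ?S" for l
      proof -
        have fin: "finite ((\<pi> u - \<pi> l) \<union> (\<pi> l - \<pi> u))"
          using psub[of u] psub[of l] uS l Suc by (auto dest: finite_subset)
        have "(\<pi>' x - \<pi>' l) \<union> (\<pi>' l - \<pi>' x) = insert x ((\<pi> u - \<pi> l) \<union> (\<pi> l - \<pi> u))"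
          using psub[of u] psub[of l] uS l by (auto simp: \<pi>'_def)
        then have "treedist r' \<pi>' x l = max (d u x) (fmax ((\<pi> u - \<pi> l) \<union> (\<pi> l - \<pi> u)) r')"
          unfolding treedist_def using fin by (simp add: fmax_insert r'_def)
        also have "fmax ((\<pi> u - \<pi> l) \<union> (\<pi> l - \<pi> u)) r' = fmax ((\<pi> u - \<pi> l) \<union> (\<pi> l - \<pi> u)) r"
          using psub[of u] psub[of l] uS l by (intro fmax_cong) (auto simp: r'_def)
        also have "\<dots> = d u l" using t(3) uS l by (simp add: treedist_def)
        also have "max (d u x) (d u l) = d x l"
        proof (cases "l = u")
          case True
          then show ?thesis using refl nonneg sym by simp
        next
          case False
          then show ?thesis
            using ultra[of x l u] ultra[of u l x] min[of u l] min[of x l] uS l sym[of x u] by auto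
        qed
        finally show ?thesis .
      qed
      have "treedist r' \<pi>' x x = 0" by (simp add: treedist_def)
      then show ?thesis
        using old new[of k] new[of l] kl by (metis DiffI singletonD refl sym treedist_commute)
    qed
    ultimately show ?thesis by blast
  qed
qed

text \<open>Every new point is placed at a nearest old one.\<close>

lemma (in ultra_seminorm) extend_ultrametric_map:
  assumes "finite T" "finite Q" "Q \<noteq> {}" "\<And>k. k \<in> Q \<Longrightarrow> a k \<in> A"
    and Q: "\<And>k l. \<lbrakk>k \<in> Q; l \<in> Q\<rbrakk> \<Longrightarrow> g (a k - a l) \<le> D k l"
    and D: "\<And>k l. 0 \<le> D k l" "\<And>k l. D k l = D l k" "\<And>k l m. D k m \<le> max (D k l) (D l m)"
  shows "\<exists>b. (\<forall>k\<in>Q. b k = a k) \<and> (\<forall>k\<in>Q \<union> T. b k \<in> A) \<and>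
             (\<forall>k\<in>Q \<union> T. \<forall>l\<in>Q \<union> T. g (b k - b l) \<le> D k l)"
  using assms(1)
proof (induction T)
  case empty
  then show ?case using assms(4) Q by auto
next
  case (insert x T)
  then obtain b where b: "\<forall>k\<in>Q. b k = a k" "\<forall>k\<in>Q \<union> T. b k \<in> A"
    "\<forall>k\<in>Q \<union> T. \<forall>l\<in>Q \<union> T. g (b k - b l) \<le> D k l" by blast
  show ?case
  proof (cases "x \<in> Q")
    case True
    then have "Q \<union> insert x T = Q \<union> T" by auto
    then show ?thesis using b by auto
  next
    case False
    have "finite (Q \<union> T)" "Q \<union> T \<noteq> {}" using insert assms by auto
    then have "arg_min_on (\<lambda>k. D k x) (Q \<union> T) \<in> Q \<union> T"
      "\<And>k. k \<in> Q \<union> T \<Longrightarrow> D (arg_min_on (\<lambda>k. D k x) (Q \<union> T)) x \<le> D k x"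
      by (rule arg_min_if_finite(1), rule arg_min_least)
    then obtain q where q: "q \<in> Q \<union> T" "\<And>k. k \<in> Q \<union> T \<Longrightarrow> D q x \<le> D k x" by metis
    let ?b = "b(x := b q)"
    have nx: "k \<noteq> x" if "k \<in> Q \<union> T" for k using that False insert by auto
    have qk: "g (b q - b k) \<le> D x k" if "k \<in> Q \<union> T" for k
    proof -
      have "g (b q - b k) \<le> D q k" using b q that by blast
      also have "\<dots> \<le> max (D q x) (D x k)" by (rule D)
      also have "\<dots> \<le> D x k" using q(2)[OF that] D(2)[of x k] by simp
      finally show ?thesis .
    qed
    have qk': "g (b k - b q) \<le> D k x" if "k \<in> Q \<union> T" for k
      using qk[OF that] diff_commute[of "b k" "b q"] b q that D(2)[of x k] by auto
    have "\<forall>k\<in>Q \<union> insert x T. \<forall>l\<in>Q \<union> insert x T. g (?b k - ?b l) \<le> D k l"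
      using qk qk' b(3) zero D(1) by auto
    moreover have "\<forall>k\<in>Q. ?b k = a k" using b(1) nx by auto
    moreover have "\<forall>k\<in>Q \<union> insert x T. ?b k \<in> A" using b(2) q by auto
    ultimately show ?thesis by blast
  qed
qed

text \<open>Telescoping along the path from the root \<open>z\<close> to \<open>k\<close>, by
  induction on the number of its edges; a nonempty path is what guarantees a parent. It recovers the
  slope \<open>b k\<close>, up to a translation common to all vertices, from the differences along
  the edges.\<close>

lemma tree_on_sum:
  fixes b :: "'v \<Rightarrow> 'c::ab_group_add"
  assumes t: "tree_on S z y \<pi>" "finite S" and k: "k \<in> S"
    and s: "\<And>k. \<lbrakk>k \<in> S; \<pi> k \<noteq> {}\<rbrakk> \<Longrightarrow> s k = b k - b (y k)"
  shows "(\<Sum>m\<in>\<pi> k. s m) = b k - b z"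
  using k
proof (induction "card (\<pi> k)" arbitrary: k rule: less_induct)
  case less
  from t less(2) consider "k = z" "\<pi> k = {}" 
    | "y k \<in> S" "k \<notin> \<pi> (y k)" "\<pi> k = insert k (\<pi> (y k))" "\<pi> k \<noteq> {}"
    unfolding tree_on_def by blast
  then show ?case
  proof cases
    case 1
    then show ?thesis by simp
  next
    case 2
    have fin: "finite (\<pi> (y k))" using t 2(1) unfolding tree_on_def by (meson finite_subset)
    have "card (\<pi> (y k)) < card (\<pi> k)" using 2 fin by simp
    from less(1)[OF this 2(1)] show ?thesis
      using 2 fin s[OF less(2)] by simp
  qed
qed

section \<open>Coordinate rings of the charts\<close>

lemma ultra_seminorm_nu:
  assumes "complete_nonarch_field nu" shows "ultra_seminorm UNIV nu"
proof -
  interpret complete_nonarch_field nu by fact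
  have "nu 1 * nu 1 = nu 1" "nu 1 \<noteq> 0" using nu_mult[of 1 1] nu_eq_0_iff[of 1] by auto
  then show ?thesis
    by unfold_locales (auto simp: nu_nonneg nu_eq_0_iff nu_mult nu_ultrametric)
qed

lemma (in ultra_seminorm) of_nat_le: "of_nat k \<in> A \<and> g (of_nat k) \<le> 1"
proof (induction k)
  case (Suc k)
  then show ?case using ultra[of 1 "of_nat k"] add_mem[of 1 "of_nat k"] one_mem one by auto
qed (simp add: zero_mem zero)

section \<open>Fractions and the minors of the generic matrix\<close>

definition to_fr :: "'a::idom \<Rightarrow> 'a fract" where
  "to_fr P = Fraction_Field.Fract P 1"

lemma to_fr_add: "to_fr (P + Q) = to_fr P + to_fr Q"
  and to_fr_diff: "to_fr (P - Q) = to_fr P - to_fr Q"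
  and to_fr_uminus: "to_fr (- P) = - to_fr P"
  and to_fr_mult: "to_fr (P * Q) = to_fr P * to_fr Q"
  and to_fr_zero [simp]: "to_fr 0 = 0" and to_fr_one [simp]: "to_fr 1 = 1"
  by (simp_all add: to_fr_def Zero_fract_def One_fract_def)

lemma to_fr_power: "to_fr (P ^ k) = to_fr P ^ k"
  by (induction k) (simp_all add: to_fr_mult)

lemma to_fr_eq_iff [simp]: "to_fr P = to_fr Q \<longleftrightarrow> P = Q"
  by (simp add: to_fr_def eq_fract)

definition pvar :: "nat \<Rightarrow> (nat \<Rightarrow>\<^sub>0 nat) \<Rightarrow>\<^sub>0 'k::comm_ring_1" where
  "pvar i = Poly_Mapping.single (Poly_Mapping.single i 1) 1"

definition minor :: "nat \<times> nat \<Rightarrow> (nat \<Rightarrow>\<^sub>0 nat) \<Rightarrow>\<^sub>0 'k::comm_ring_1" where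
  "minor = (\<lambda>(k, l). pvar (2 * k) * pvar (2 * l + 1) - pvar (2 * l) * pvar (2 * k + 1))"

lemma plucker_eq: "plucker m = to_fr (minor m)"
  by (cases m) (simp add: plucker_def minor_def entry_def to_fr_diff to_fr_mult pvar_def flip: to_fr_def)

lemma rf_const_eq: "rf_const c = to_fr (Poly_Mapping.single 0 c)"
  by (simp add: rf_const_def to_fr_def)

interpretation rf_const: coeff_hom rf_const
  by unfold_locales
    (simp_all add: rf_const_eq single_add to_fr_add mult_single flip: to_fr_mult)

lemma minor_nonzero:
  assumes "k \<noteq> l" shows "(minor (k, l) :: (nat \<Rightarrow>\<^sub>0 nat) \<Rightarrow>\<^sub>0 'k::comm_ring_1) \<noteq> 0"
proof -
  let ?m = "Poly_Mapping.single (2 * k) 1 + Poly_Mapping.single (2 * l + 1) 1 :: nat \<Rightarrow>\<^sub>0 nat"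
  let ?m' = "Poly_Mapping.single (2 * l) 1 + Poly_Mapping.single (2 * k + 1) 1 :: nat \<Rightarrow>\<^sub>0 nat"
  have "2 * l + 1 \<noteq> 2 * k" by presburger
  then have "Poly_Mapping.lookup ?m (2 * k) \<noteq> Poly_Mapping.lookup ?m' (2 * k)"
    using assms by (simp add: lookup_add lookup_single when_def)
  then have ne: "?m \<noteq> ?m'" by metis
  have "minor (k, l) = Poly_Mapping.single ?m (1::'k) - Poly_Mapping.single ?m' 1"
    by (simp add: minor_def pvar_def mult_single)
  then have "Poly_Mapping.lookup (minor (k, l) :: (nat \<Rightarrow>\<^sub>0 nat) \<Rightarrow>\<^sub>0 'k) ?m = 1"
    using ne by (simp add: lookup_minus lookup_single when_def)
  then show ?thesis by auto
qed

lemma plucker_nonzero: "m \<in> pairs n \<Longrightarrow> plucker m \<noteq> 0"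
  using minor_nonzero[of "fst m" "snd m"] to_fr_eq_iff[of "minor m" 0]
  by (auto simp: plucker_eq pairs_def split: prod.splits)

lemma plucker_swap: "plucker (l, k) = - plucker (k, l)"
  and plucker_self [simp]: "plucker (k, k) = 0"
  by (simp_all add: plucker_def)

text \<open>The three-term Pluecker relation. Divided by the square of
  \<open>plucker (i, j)\<close>, it expresses every minor by the coordinates of its two columns with
  respect to the columns \<open>i\<close> and \<open>j\<close>.\<close>

lemma plucker_relation:
  "plucker (k, j) * plucker (i, l) - plucker (l, j) * plucker (i, k) = plucker (k, l) * plucker (i, j)"
  by (simp add: plucker_def algebra_simps)

section \<open>Coordinate rings as algebras, and seminorms on them\<close>

lemma coord_ring_gen: "\<lbrakk>m \<in> pairs n; i \<in> I\<rbrakk> \<Longrightarrow> plucker m / plucker i \<in> coord_ring n I"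
  unfolding coord_ring_def by (rule alg_gen.gen) blast

lemma coord_ring_const: "rf_const c \<in> coord_ring n I"
  unfolding coord_ring_def by (rule alg_gen.const)

lemma coord_ring_zero: "0 \<in> coord_ring n I"
  using coord_ring_const[of 0] by (simp add: rf_const.hom_zero)

lemma coord_ring_one: "1 \<in> coord_ring n I"
  using coord_ring_const[of 1] by (simp add: rf_const.hom_one)

lemma coord_ring_add: "\<lbrakk>f \<in> coord_ring n I; g \<in> coord_ring n I\<rbrakk> \<Longrightarrow> f + g \<in> coord_ring n I"
  unfolding coord_ring_def by (rule alg_gen.add)

lemma coord_ring_mult: "\<lbrakk>f \<in> coord_ring n I; g \<in> coord_ring n I\<rbrakk> \<Longrightarrow> f * g \<in> coord_ring n I"
  unfolding coord_ring_def by (rule alg_gen.mult)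

lemma coord_ring_uminus:
  fixes f :: "'k::field ratfun"
  assumes "f \<in> coord_ring n I" shows "- f \<in> coord_ring n I"
proof -
  have "rf_const (- 1) + 1 = rf_const (- 1 + 1 :: 'k)"
    by (simp only: rf_const.hom_add rf_const.hom_one)
  then have "rf_const (- 1 :: 'k) = - 1" by (simp add: rf_const.hom_zero eq_neg_iff_add_eq_0)
  then show ?thesis using coord_ring_mult[OF coord_ring_const[of "- 1"] assms] by simp
qed

lemma coord_ring_induct [consumes 1, case_names const gen add mult]:
  assumes "f \<in> coord_ring n I"
    and "\<And>c. Q (rf_const c)" "\<And>m i. \<lbrakk>m \<in> pairs n; i \<in> I\<rbrakk> \<Longrightarrow> Q (plucker m / plucker i)"
    and "\<And>f g. \<lbrakk>f \<in> coord_ring n I; g \<in> coord_ring n I; Q f; Q g\<rbrakk> \<Longrightarrow> Q (f + g)"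
    and "\<And>f g. \<lbrakk>f \<in> coord_ring n I; g \<in> coord_ring n I; Q f; Q g\<rbrakk> \<Longrightarrow> Q (f * g)"
  shows "Q f"
  using assms(1)[unfolded coord_ring_def]
  by (induction rule: alg_gen.induct) (use assms(2-5) in \<open>auto simp: coord_ring_def\<close>)

lemma coord_ring_subset:
  assumes "ultra_seminorm B g" "\<And>c. rf_const c \<in> B"
    and "\<And>m i. \<lbrakk>m \<in> pairs n; i \<in> I\<rbrakk> \<Longrightarrow> plucker m / plucker i \<in> B"
  shows "coord_ring n I \<subseteq> B"
proof
  fix f :: "'a ratfun" assume "f \<in> coord_ring n I"
  then show "f \<in> B"
    by (induction rule: coord_ring_induct)
      (use assms in \<open>auto intro: ultra_seminorm.add_mem ultra_seminorm.mult_mem\<close>)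
qed

lemma coord_ring_mono:
  assumes "I \<subseteq> J" shows "coord_ring n I \<subseteq> coord_ring n J"
proof
  fix f :: "'a ratfun" assume "f \<in> coord_ring n I"
  then show "f \<in> coord_ring n J"
    by (induction rule: coord_ring_induct)
      (use assms in \<open>auto intro: coord_ring_const coord_ring_gen coord_ring_add coord_ring_mult\<close>)
qed

text \<open>The definition of a point asks only for the triangle inequality. Integers come from the
  base field, where they have norm at most one, and this forces the ultrametric inequality.\<close>

lemma berk_point_ultra:
  assumes nu: "complete_nonarch_field nu" and \<gamma>: "\<gamma> \<in> berk_points nu rf_const (coord_ring n I)"
  shows "ultra_seminorm (coord_ring n I) \<gamma>"
proof -
  interpret nu: ultra_seminorm UNIV nu by (rule ultra_seminorm_nu[OF nu])
  let ?A = "coord_ring n I :: 'a ratfun set"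
  have b: "\<And>f. f \<in> ?A \<Longrightarrow> 0 \<le> \<gamma> f" "\<And>c. \<gamma> (rf_const c) = nu c"
    "\<And>f g. \<lbrakk>f \<in> ?A; g \<in> ?A\<rbrakk> \<Longrightarrow> \<gamma> (f + g) \<le> \<gamma> f + \<gamma> g"
    "\<And>f g. \<lbrakk>f \<in> ?A; g \<in> ?A\<rbrakk> \<Longrightarrow> \<gamma> (f * g) = \<gamma> f * \<gamma> g"
    using \<gamma> by (auto simp: berk_points_def)
  have zero: "\<gamma> 0 = 0" and one: "\<gamma> 1 = 1"
    using b(2)[of 0] b(2)[of 1] by (auto simp: rf_const.hom_zero rf_const.hom_one nu.zero nu.one)
  have nat: "of_nat k = (rf_const (of_nat k) :: 'a ratfun)" for k
    by (induction k) (simp_all add: rf_const.hom_zero rf_const.hom_add rf_const.hom_one)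
  have ultra: "\<gamma> (f + g) \<le> max (\<gamma> f) (\<gamma> g)" if "f \<in> ?A" "g \<in> ?A" for f g
    by (rule ultrametric_of_triangle[where A = ?A])
      (use that b nu.of_nat_le in \<open>auto simp: zero one nat coord_ring_const
        intro: coord_ring_zero coord_ring_one coord_ring_add coord_ring_mult\<close>)
  show ?thesis
    by unfold_locales
      (use b ultra in \<open>auto simp: zero one
        intro: coord_ring_zero coord_ring_one coord_ring_add coord_ring_mult coord_ring_uminus\<close>)
qed

lemma berk_point_restrict:
  assumes "ultra_seminorm B g" "coord_ring n I \<subseteq> B" "\<And>c. g (rf_const c) = nu c"
  shows "restrict g (coord_ring n I) \<in> berk_points nu rf_const (coord_ring n I)"
proof -
  interpret ultra_seminorm B g by fact
  have "g (a + b) \<le> g a + g b" if "a \<in> coord_ring n I" "b \<in> coord_ring n I" for a b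
    using ultra[of a b] nonneg[of a] nonneg[of b] assms(2) that by (auto simp: subset_iff)
  then show ?thesis
    using assms(2,3)
    by (auto simp: berk_points_def coord_ring_const coord_ring_add coord_ring_mult subset_iff
        intro!: nonneg mult)
qed

section \<open>Forms in the minors as numerators\<close>

text \<open>The homogeneous coordinate ring, degree by degree: polynomials in the matrix entries
  that can be written as forms of degree \<open>D\<close> in the minors. Elements of a chart ring
  become such forms over \<open>plucker e ^ D\<close>. The same \<open>P\<close> then serves in
  every chart, and substitutions into the matrix entries apply to it directly.\<close>

inductive minor_poly :: "nat \<Rightarrow> nat \<Rightarrow> ((nat \<Rightarrow>\<^sub>0 nat) \<Rightarrow>\<^sub>0 'k::comm_ring_1) \<Rightarrow> bool" for n where
  const: "minor_poly n 0 (Poly_Mapping.single 0 c)"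
| step: "\<lbrakk>m \<in> pairs n; minor_poly n D P\<rbrakk> \<Longrightarrow> minor_poly n (Suc D) (minor m * P)"
| add: "\<lbrakk>minor_poly n D P; minor_poly n D Q\<rbrakk> \<Longrightarrow> minor_poly n D (P + Q)"

lemma minor_poly_mult:
  assumes "minor_poly n D P" "minor_poly n E Q" shows "minor_poly n (D + E) (P * Q)"
  using assms
proof (induction arbitrary: Q rule: minor_poly.induct)
  case (const c)
  then show ?case
  proof (induction rule: minor_poly.induct)
    case (const c')
    then show ?case using minor_poly.const[of n "c * c'"] by (simp add: mult_single)
  next
    case (step m D P)
    then show ?case using minor_poly.step[of m n D "Poly_Mapping.single 0 c * P"]
      by (simp add: ac_simps)
  next
    case (add D P Q)
    then show ?case by (auto simp: distrib_left intro: minor_poly.add)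
  qed
next
  case (step m D P)
  then show ?case using minor_poly.step[of m n "D + E" "P * Q"] by (simp add: mult.assoc)
next
  case (add D P P')
  then show ?case by (auto simp: distrib_right intro: minor_poly.add)
qed

lemma minor_poly_minor: "m \<in> pairs n \<Longrightarrow> minor_poly n 1 (minor m)"
  using minor_poly.step[OF _ minor_poly.const, of m n 1] by simp

lemma minor_poly_power: "m \<in> pairs n \<Longrightarrow> minor_poly n k (minor m ^ k)"
proof (induction k)
  case 0
  then show ?case using minor_poly.const[of n 1] by simp
qed (auto intro: minor_poly.step)

lemma coord_ring_to_fr:
  assumes "minor_poly n D P" "e \<in> pairs n"
  shows "to_fr P / plucker e ^ D \<in> coord_ring n {e}"
  using assms(1)
proof (induction rule: minor_poly.induct)
  case (const c)
  then show ?case using coord_ring_const[of c] by (simp add: rf_const_eq)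
next
  case (step m D P)
  have "to_fr (minor m * P) / plucker e ^ Suc D = (plucker m / plucker e) * (to_fr P / plucker e ^ D)"
    by (simp add: to_fr_mult plucker_eq)
  moreover have "\<dots> \<in> coord_ring n {e}"
    by (rule coord_ring_mult[OF coord_ring_gen step.IH]) (use step in auto)
  ultimately show ?case by (simp only:)
next
  case (add D P Q)
  then show ?case using coord_ring_add[OF add.IH] by (simp add: to_fr_add add_divide_distrib)
qed

text \<open>For sums, both numerators are brought to degree \<open>D + E\<close> by multiplying them
  with powers of \<open>minor e\<close>, which keeps them forms in the minors.\<close>

lemma coord_ring_eq_to_fr:
  fixes f :: "'k::field ratfun"
  assumes "f \<in> coord_ring n {e}" and e: "e \<in> pairs n"
  shows "\<exists>D P. minor_poly n D P \<and> f = to_fr P / plucker e ^ D"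
  using assms(1)
proof (induction rule: coord_ring_induct)
  case (const c)
  show ?case
    by (rule exI[of _ 0], rule exI[of _ "Poly_Mapping.single 0 c"])
      (simp add: minor_poly.const rf_const_eq)
next
  case (gen m i)
  show ?case
    by (rule exI[of _ 1], rule exI[of _ "minor m"])
      (use gen in \<open>simp add: minor_poly_minor[simplified] plucker_eq\<close>)
next
  case (add f g)
  then obtain D P E Q where P: "minor_poly n D P" "f = to_fr P / plucker e ^ D"
    and Q: "minor_poly n E Q" "g = to_fr Q / plucker e ^ E" by blast
  have "plucker e \<noteq> (0 :: 'k ratfun)" using plucker_nonzero[OF e] by simp
  then have "f + g = to_fr (P * minor e ^ E + minor e ^ D * Q) / plucker e ^ (D + E)"
    unfolding P Q by (simp add: to_fr_add to_fr_mult to_fr_power field_simps power_add flip: plucker_eq)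
  moreover have "minor_poly n (D + E) (P * minor e ^ E + minor e ^ D * Q)"
    by (intro minor_poly.add minor_poly_mult minor_poly_power e P Q)
  ultimately show ?case by blast
next
  case (mult f g)
  then obtain D P E Q where P: "minor_poly n D P" "f = to_fr P / plucker e ^ D"
    and Q: "minor_poly n E Q" "g = to_fr Q / plucker e ^ E" by blast
  have "f * g = to_fr (P * Q) / plucker e ^ (D + E)"
    unfolding P Q by (simp add: to_fr_mult power_add)
  then show ?case using minor_poly_mult[OF P(1) Q(1)] by blast
qed

section \<open>Glueing the charts\<close>

abbreviation chart_points :: "('k::field \<Rightarrow> real) \<Rightarrow> nat \<Rightarrow> nat \<times> nat \<Rightarrow> ('k ratfun \<Rightarrow> real) set" where
  "chart_points nu n i \<equiv> berk_points nu rf_const (coord_ring n {i})"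

text \<open>The transition map between charts: near such a point, the ring of the chart
  \<open>j\<close> lies in the localization of the ring of the chart \<open>i\<close>. It is
  meaningful only if \<open>\<gamma> (plucker j / plucker i) \<noteq> 0\<close>; otherwise some
  values of \<open>loc_norm\<close> may be unspecified.\<close>

definition change_chart ::
    "nat \<Rightarrow> nat \<times> nat \<Rightarrow> nat \<times> nat \<Rightarrow> ('k::field ratfun \<Rightarrow> real) \<Rightarrow> 'k ratfun \<Rightarrow> real" where
  "change_chart n i j \<gamma> = restrict (loc_norm (coord_ring n {i}) \<gamma>) (coord_ring n {j})"

context
  fixes nu :: "'k::field \<Rightarrow> real" and n :: nat
  assumes nu: "complete_nonarch_field nu"
begin

lemma coord_ring_subset_loc:
  assumes \<gamma>: "\<gamma> \<in> chart_points nu n i" and i: "i \<in> pairs n"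
    and I: "\<And>j. j \<in> I \<Longrightarrow> j \<in> pairs n \<and> \<gamma> (plucker j / plucker i) \<noteq> 0"
  shows "coord_ring n I \<subseteq> loc (coord_ring n {i}) \<gamma>"
proof -
  note g = berk_point_ultra[OF nu \<gamma>]
  show ?thesis
  proof (rule coord_ring_subset[OF ultra_seminorm_loc[OF g]])
    show "rf_const c \<in> loc (coord_ring n {i}) \<gamma>" for c
      by (rule subset_loc[OF g coord_ring_const])
  next
    fix m j assume mj: "m \<in> pairs n" "j \<in> I"
    have "(plucker m / plucker i) / (plucker j / plucker i) \<in> loc (coord_ring n {i}) \<gamma>"
      by (intro loc_divideI coord_ring_gen) (use mj I[of j] in simp_all)
    moreover have "plucker i \<noteq> (0 :: 'k ratfun)" by (rule plucker_nonzero[OF i])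
    ultimately show "plucker m / plucker j \<in> loc (coord_ring n {i}) \<gamma>" by simp
  qed
qed

lemma restrict_loc_norm_berk_point:
  assumes \<gamma>: "\<gamma> \<in> chart_points nu n i" and i: "i \<in> pairs n"
    and I: "\<And>j. j \<in> I \<Longrightarrow> j \<in> pairs n \<and> \<gamma> (plucker j / plucker i) \<noteq> 0"
  shows "restrict (loc_norm (coord_ring n {i}) \<gamma>) (coord_ring n I) \<in> berk_points nu rf_const (coord_ring n I)"
proof -
  note g = berk_point_ultra[OF nu \<gamma>]
  have "\<gamma> (rf_const c) = nu c" for c using \<gamma> by (simp add: berk_points_def)
  then show ?thesis
    using loc_norm_eq[OF g coord_ring_const]
    by (intro berk_point_restrict[OF ultra_seminorm_loc[OF g] coord_ring_subset_loc[OF assms]]) auto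
qed

lemma change_chart_self:
  assumes "\<gamma> \<in> chart_points nu n i" shows "change_chart n i i \<gamma> = \<gamma>"
proof -
  have "\<gamma> \<in> extensional (coord_ring n {i})" using assms by (simp add: berk_points_def)
  then show ?thesis
    using loc_norm_eq[OF berk_point_ultra[OF nu assms]]
    by (intro ext) (auto simp: change_chart_def extensional_def)
qed

text \<open>Over the overlap \<open>plucker j / plucker i\<close> is a unit, with inverse
  \<open>plucker i / plucker j\<close>, so its value is nonzero; conversely, a nonzero value lets
  \<open>\<gamma>\<close> extend to the ring of the overlap, in only one way. The glueing relation
  is thus the graph of a partial map between any two charts.\<close>

lemma chart_glue_iff:
  assumes \<gamma>: "\<gamma> \<in> chart_points nu n i" and i: "i \<in> pairs n"
  shows "((i, \<gamma>), (j, \<gamma>')) \<in> chart_glue nu n \<longleftrightarrow>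
    j \<in> pairs n \<and> \<gamma> (plucker j / plucker i) \<noteq> 0 \<and> \<gamma>' = change_chart n i j \<gamma>"
    (is "?L \<longleftrightarrow> ?R")
proof -
  note g = berk_point_ultra[OF nu \<gamma>]
  have sub: "coord_ring n {i} \<subseteq> (coord_ring n {i, j} :: 'k ratfun set)"
    "coord_ring n {j} \<subseteq> (coord_ring n {i, j} :: 'k ratfun set)"
    by (rule coord_ring_mono, simp)+
  show ?thesis
  proof
    assume ?L
    then obtain \<delta> where j: "j \<in> pairs n" and \<delta>: "\<delta> \<in> berk_points nu rf_const (coord_ring n {i, j})"
      and eq: "\<gamma> = restrict \<delta> (coord_ring n {i})" "\<gamma>' = restrict \<delta> (coord_ring n {j})"
      unfolding chart_glue_def by blast
    note d = berk_point_ultra[OF nu \<delta>]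
    have "\<delta> (plucker j / plucker i) \<noteq> 0"
    proof (rule ultra_seminorm.unit_nonzero[OF d])
      show "plucker j / plucker i \<in> coord_ring n {i, j}" "plucker i / plucker j \<in> coord_ring n {i, j}"
        using i j by (simp_all add: coord_ring_gen)
      show "plucker j / plucker i * (plucker i / plucker j) = (1 :: 'k ratfun)"
        using plucker_nonzero[OF i, where 'a='k] plucker_nonzero[OF j, where 'a='k] by simp
    qed
    moreover have mem: "plucker j / plucker i \<in> (coord_ring n {i} :: 'k ratfun set)" using j by (simp add: coord_ring_gen)
    ultimately have nz: "\<gamma> (plucker j / plucker i) \<noteq> 0" using eq(1) by simp
    have "\<delta> f = loc_norm (coord_ring n {i}) \<gamma> f" if "f \<in> coord_ring n {j}" for f
      by (rule loc_norm_unique[OF g d sub(1)])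
        (use that sub(2) coord_ring_subset_loc[OF \<gamma> i, of "{j}"] j nz in \<open>auto simp: eq(1)\<close>)
    then have "\<gamma>' = change_chart n i j \<gamma>"
      unfolding eq(2) change_chart_def by (intro restrict_ext) auto
    with j nz show ?R by simp
  next
    assume R: ?R
    have one: "\<gamma> (plucker i / plucker i) \<noteq> 0"
      using plucker_nonzero[OF i, where 'a='k] ultra_seminorm.one[OF g] by simp
    define \<delta> where "\<delta> = restrict (loc_norm (coord_ring n {i}) \<gamma>) (coord_ring n {i, j})"
    have "\<delta> \<in> berk_points nu rf_const (coord_ring n {i, j})"
      unfolding \<delta>_def by (rule restrict_loc_norm_berk_point[OF \<gamma> i]) (use R i one in auto)
    moreover have "change_chart n i i \<gamma> = restrict \<delta> (coord_ring n {i})"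
      unfolding \<delta>_def change_chart_def using sub(1) by (simp add: Int_absorb1)
    moreover have "change_chart n i j \<gamma> = restrict \<delta> (coord_ring n {j})"
      unfolding \<delta>_def change_chart_def using sub(2) by (simp add: Int_absorb1)
    ultimately show ?L
      using R i unfolding chart_glue_def change_chart_self[OF \<gamma>] by blast
  qed
qed

lemma chart_glue_sym: "(x, y) \<in> chart_glue nu n \<Longrightarrow> (y, x) \<in> chart_glue nu n"
  unfolding chart_glue_def by (fastforce simp: insert_commute)

lemma chart_glue_points:
  assumes "((i, \<gamma>), (j, \<gamma>')) \<in> chart_glue nu n"
  shows "i \<in> pairs n" "j \<in> pairs n" "\<gamma> \<in> chart_points nu n i" "\<gamma>' \<in> chart_points nu n j"
proof -
  obtain \<delta> where ij: "i \<in> pairs n" "j \<in> pairs n"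
    and \<delta>: "\<delta> \<in> berk_points nu rf_const (coord_ring n {i, j})"
    and eq: "\<gamma> = restrict \<delta> (coord_ring n {i})" "\<gamma>' = restrict \<delta> (coord_ring n {j})"
    using assms unfolding chart_glue_def by blast
  show "i \<in> pairs n" "j \<in> pairs n" by fact+
  have c: "\<delta> (rf_const c) = nu c" for c using \<delta> by (simp add: berk_points_def)
  show "\<gamma> \<in> chart_points nu n i" "\<gamma>' \<in> chart_points nu n j" unfolding eq
    by (rule berk_point_restrict[OF berk_point_ultra[OF nu \<delta>] coord_ring_mono c]; simp)+
qed

text \<open>Seen from the middle chart \<open>j\<close>, both outer coordinates are nonzero at the
  point, so its extension to the localization restricts to a point over the overlap of the outer
  charts.\<close>

lemma chart_glue_trans:
  assumes "(x, y) \<in> chart_glue nu n" "(y, z) \<in> chart_glue nu n"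
  shows "(x, z) \<in> chart_glue nu n"
proof -
  obtain i \<gamma> j \<gamma>' k \<gamma>'' where xyz: "x = (i, \<gamma>)" "y = (j, \<gamma>')" "z = (k, \<gamma>'')"
    by (cases x, cases y, cases z)
  have yx: "((j, \<gamma>'), (i, \<gamma>)) \<in> chart_glue nu n" and yz: "((j, \<gamma>'), (k, \<gamma>'')) \<in> chart_glue nu n"
    using chart_glue_sym[OF assms(1)] assms(2) xyz by auto
  note p = chart_glue_points[OF yx] chart_glue_points[OF yz]
  note x = yx[unfolded chart_glue_iff[OF p(3,1)]] and z = yz[unfolded chart_glue_iff[OF p(3,1)]]
  define \<delta> where "\<delta> = restrict (loc_norm (coord_ring n {j}) \<gamma>') (coord_ring n {i, k})"
  have "\<delta> \<in> berk_points nu rf_const (coord_ring n {i, k})"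
    unfolding \<delta>_def by (rule restrict_loc_norm_berk_point[OF p(3,1)]) (use x z in auto)
  moreover have "\<gamma> = restrict \<delta> (coord_ring n {i})"
    using x coord_ring_mono[of "{i}" "{i, k}" n, where 'a='k]
    by (simp add: \<delta>_def change_chart_def Int_absorb1)
  moreover have "\<gamma>'' = restrict \<delta> (coord_ring n {k})"
    using z coord_ring_mono[of "{k}" "{i, k}" n, where 'a='k]
    by (simp add: \<delta>_def change_chart_def Int_absorb1)
  ultimately show ?thesis using p unfolding xyz chart_glue_def by blast
qed

lemma chart_glue_refl:
  assumes "\<gamma> \<in> chart_points nu n i" "i \<in> pairs n"
  shows "((i, \<gamma>), (i, \<gamma>)) \<in> chart_glue nu n"
  using chart_glue_iff[OF assms, of i \<gamma>] assms change_chart_self[OF assms(1)]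
    plucker_nonzero[OF assms(2), where 'a='k] ultra_seminorm.one[OF berk_point_ultra[OF nu assms(1)]]
  by simp

lemma chart_glue_class_eq:
  assumes "((i, \<gamma>), (j, \<gamma>')) \<in> chart_glue nu n"
  shows "chart_glue nu n `` {(i, \<gamma>)} = chart_glue nu n `` {(j, \<gamma>')}"
  using assms chart_glue_sym chart_glue_trans by blast

lemma chart_glue_class_inj:
  assumes "\<gamma> \<in> chart_points nu n i" "\<gamma>' \<in> chart_points nu n i" "i \<in> pairs n"
    and "chart_glue nu n `` {(i, \<gamma>)} = chart_glue nu n `` {(i, \<gamma>')}"
  shows "\<gamma> = \<gamma>'"
proof -
  have "((i, \<gamma>), (i, \<gamma>')) \<in> chart_glue nu n"
    using chart_glue_refl[OF assms(2,3)] assms(4) by blast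
  then show ?thesis
    using chart_glue_iff[OF assms(1,3)] change_chart_self[OF assms(1)] by simp
qed

lemma change_chart_point:
  assumes \<gamma>: "\<gamma> \<in> chart_points nu n i" and i: "i \<in> pairs n"
    and j: "j \<in> pairs n" and nz: "\<gamma> (plucker j / plucker i) \<noteq> 0"
  shows "change_chart n i j \<gamma> \<in> chart_points nu n j"
  unfolding change_chart_def using restrict_loc_norm_berk_point[OF \<gamma> i, of "{j}"] j nz by auto

text \<open>Replacing the denominator \<open>plucker i ^ D\<close> by \<open>plucker j ^ D\<close>
  divides the fraction by \<open>(plucker j / plucker i) ^ D\<close>, whose value depends only on
  one Pluecker quotient and on the degree, not on \<open>P\<close>.\<close>

lemma change_chart_eval:
  assumes \<gamma>: "\<gamma> \<in> chart_points nu n i" and i: "i \<in> pairs n"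
    and j: "j \<in> pairs n" and nz: "\<gamma> (plucker j / plucker i) \<noteq> 0" and P: "minor_poly n D P"
  shows "change_chart n i j \<gamma> (to_fr P / plucker j ^ D)
    = \<gamma> (to_fr P / plucker i ^ D) / \<gamma> (plucker j / plucker i) ^ D"
proof -
  note g = berk_point_ultra[OF nu \<gamma>]
  have pj: "plucker j / plucker i \<in> coord_ring n {i}" using j by (simp add: coord_ring_gen)
  note pw = ultra_seminorm.power_mem[OF g pj, of D] ultra_seminorm.power[OF g pj, of D]
  have "to_fr P / plucker j ^ D = (to_fr P / plucker i ^ D) / (plucker j / plucker i) ^ D"
    using plucker_nonzero[OF i, where 'a='k] by (simp add: power_divide)
  then have "loc_norm (coord_ring n {i}) \<gamma> (to_fr P / plucker j ^ D)
      = \<gamma> (to_fr P / plucker i ^ D) / \<gamma> ((plucker j / plucker i) ^ D)"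
    using loc_norm_divide[OF g coord_ring_to_fr[OF P i] pw(1)] pw(2) power_not_zero[OF nz, of D]
    by (simp only: simp_thms)
  then show ?thesis
    using coord_ring_to_fr[OF P j] pw(2) by (simp add: change_chart_def)
qed

lemma change_chart_plucker:
  assumes \<gamma>: "\<gamma> \<in> chart_points nu n i" and i: "i \<in> pairs n"
    and j: "j \<in> pairs n" and nz: "\<gamma> (plucker j / plucker i) \<noteq> 0" and m: "m \<in> pairs n"
  shows "change_chart n i j \<gamma> (plucker m / plucker j)
    = \<gamma> (plucker m / plucker i) / \<gamma> (plucker j / plucker i)"
  using change_chart_eval[OF \<gamma> i j nz minor_poly_minor[OF m]] by (simp add: plucker_eq)

end

section \<open>Gauss seminorms attached to trees\<close>

lemma inv_to_fr [simp]: "inv to_fr (to_fr P) = P"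
  by (rule inv_f_f) (simp add: inj_def)

lemma ultra_seminorm_to_fr:
  fixes A :: "'b::idom set"
  assumes "ultra_seminorm A g"
  shows "ultra_seminorm (to_fr ` A) (\<lambda>f. g (inv to_fr f))"
proof -
  interpret ultra_seminorm A g by fact
  have "inv to_fr 0 = (0::'b)" "inv to_fr 1 = (1::'b)"
    using inv_to_fr[of "0::'b"] inv_to_fr[of "1::'b"] by simp_all
  then show ?thesis
    by unfold_locales
      (auto simp: zero one nonneg mult ultra simp flip: to_fr_add to_fr_mult to_fr_uminus
        intro: zero_mem one_mem add_mem mult_mem uminus_mem rev_image_eqI)
qed

text \<open>\<open>loc\<close> takes its fractions in an ambient field, so a seminorm on a subring
  of a domain is first transported to the fraction field.\<close>

lemma fraction_field_extension:
  fixes A :: "'b::idom set"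
  assumes g: "ultra_seminorm A g"
  obtains L N where "ultra_seminorm L N" "\<And>a. a \<in> A \<Longrightarrow> to_fr a \<in> L \<and> N (to_fr a) = g a"
    "\<And>a b. \<lbrakk>a \<in> A; b \<in> A; g b \<noteq> 0\<rbrakk>
       \<Longrightarrow> to_fr a / to_fr b \<in> L \<and> N (to_fr a / to_fr b) = g a / g b"
proof
  note f = ultra_seminorm_to_fr[OF g]
  let ?L = "loc (to_fr ` A) (\<lambda>f. g (inv to_fr f))" and ?N = "loc_norm (to_fr ` A) (\<lambda>f. g (inv to_fr f))"
  show "ultra_seminorm ?L ?N" by (rule ultra_seminorm_loc[OF f])
  show "to_fr a \<in> ?L \<and> ?N (to_fr a) = g a" if "a \<in> A" for a
    using subset_loc[OF f, of "to_fr a"] loc_norm_eq[OF f, of "to_fr a"] that by simp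
  show "to_fr a / to_fr b \<in> ?L \<and> ?N (to_fr a / to_fr b) = g a / g b"
    if "a \<in> A" "b \<in> A" "g b \<noteq> 0" for a b
    using loc_divideI[of "to_fr a" "to_fr ` A" "to_fr b" "\<lambda>f. g (inv to_fr f)"]
      loc_norm_divide[OF f, of "to_fr a" "to_fr b"] that by simp
qed

interpretation single0: coeff_hom "Poly_Mapping.single 0 :: 'k::comm_ring_1 \<Rightarrow> ('a::comm_monoid_add \<Rightarrow>\<^sub>0 'k)"
  by unfold_locales (simp_all add: single_add mult_single)

text \<open>
  In the target of \<open>tree_subst\<close> the variable with number \<open>2 * k\<close> is a scaling factor of the column
  \<open>k\<close> and the variable with number \<open>2 * m + 1\<close> is the length of the edge \<open>m\<close> of the tree \<open>\<pi>\<close>.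
  The column \<open>k\<close> of the generic matrix is sent to a multiple of \<open>(1, a)\<close>, where \<open>a\<close> is
  the sum of the lengths of the edges from the root to \<open>k\<close>.
\<close>

definition path_sum :: "(nat \<Rightarrow> nat set) \<Rightarrow> nat \<Rightarrow> (nat \<Rightarrow>\<^sub>0 nat) \<Rightarrow>\<^sub>0 'k::comm_ring_1" where
  "path_sum \<pi> k = (\<Sum>m\<in>\<pi> k. pvar (2 * m + 1))"

definition tree_subst ::
    "(nat \<Rightarrow> nat set) \<Rightarrow> ((nat \<Rightarrow>\<^sub>0 nat) \<Rightarrow>\<^sub>0 'k::comm_ring_1) \<Rightarrow> (nat \<Rightarrow>\<^sub>0 nat) \<Rightarrow>\<^sub>0 'k" where
  "tree_subst \<pi> = peval (Poly_Mapping.single 0)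
     (\<lambda>i. if even i then pvar i else pvar (i - 1) * path_sum \<pi> (i div 2))"

text \<open>Variables that belong to no column of \<open>{1..n}\<close> get radius zero, in
  accordance with the value \<open>0\<close> that is substituted for them in the proof of
  maximality.\<close>

definition radius :: "nat \<Rightarrow> (nat \<Rightarrow> real) \<Rightarrow> (nat \<Rightarrow> real) \<Rightarrow> nat \<Rightarrow> real" where
  "radius n \<rho> r i =
     (if i div 2 \<in> {1..n} then if even i then \<rho> (i div 2) else r (i div 2) else 0)"

definition tree_norm ::
    "('k::comm_ring_1 \<Rightarrow> real) \<Rightarrow> nat \<Rightarrow> (nat \<Rightarrow> nat set) \<Rightarrow> (nat \<Rightarrow> real) \<Rightarrow> (nat \<Rightarrow> real) \<Rightarrow>
      ((nat \<Rightarrow>\<^sub>0 nat) \<Rightarrow>\<^sub>0 'k) \<Rightarrow> real" where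
  "tree_norm nu n \<pi> \<rho> r P = gauss nu (monom_eval (radius n \<rho> r)) (tree_subst \<pi> P)"

lemma (in coeff_hom) peval_pvar: "peval h v (pvar i) = v i"
  by (simp add: pvar_def peval_single hom_one)

lemma tree_subst_minor:
  "tree_subst \<pi> (minor (k, l)) = pvar (2 * k) * pvar (2 * l) * (path_sum \<pi> l - path_sum \<pi> k)"
  by (simp add: tree_subst_def minor_def single0.peval_diff single0.peval_mult single0.peval_pvar
      algebra_simps)

lemma tree_subst_hom:
  "tree_subst \<pi> (P + Q) = tree_subst \<pi> P + tree_subst \<pi> Q"
  "tree_subst \<pi> (P * Q) = tree_subst \<pi> P * tree_subst \<pi> Q"
  "tree_subst \<pi> (- P) = - tree_subst \<pi> P"
  "tree_subst \<pi> (Poly_Mapping.single 0 c) = Poly_Mapping.single 0 c"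
  "tree_subst \<pi> 0 = 0" "tree_subst \<pi> 1 = 1"
  by (simp_all add: tree_subst_def single0.peval_add single0.peval_mult single0.peval_uminus
      single0.peval_single single0.peval_zero single0.peval_one)

lemma path_sum_coeff:
  assumes "finite (\<pi> k)"
  shows "Poly_Mapping.lookup (path_sum \<pi> k) (Poly_Mapping.single (2 * m + 1) 1) = (if m \<in> \<pi> k then 1 else 0)"
proof -
  have "Poly_Mapping.single (2 * i + 1) 1 = Poly_Mapping.single (2 * m + 1) (1::nat) \<longleftrightarrow> i = m" for i
    by (metis add_right_cancel lookup_single_eq lookup_single_not_eq mult_left_cancel
        zero_neq_numeral zero_neq_one)
  then show ?thesis
    using assms by (simp add: path_sum_def pvar_def lookup_sum lookup_single when_def)
qed

context
  fixes nu :: "'k::field \<Rightarrow> real" and n :: nat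
  assumes nu: "complete_nonarch_field nu"
begin

interpretation nu: ultra_seminorm UNIV nu by (rule ultra_seminorm_nu[OF nu])

context
  fixes \<pi> :: "nat \<Rightarrow> nat set" and \<rho> r :: "nat \<Rightarrow> real"
  assumes nonneg: "\<And>k. k \<in> {1..n} \<Longrightarrow> 0 \<le> \<rho> k \<and> 0 \<le> r k"
begin

lemma radius_nonneg: "0 \<le> radius n \<rho> r i"
  unfolding radius_def using nonneg by auto

lemma ultra_seminorm_radius: "ultra_seminorm UNIV (gauss nu (monom_eval (radius n \<rho> r)))"
  using ultra_seminorm_gauss[OF ultra_seminorm_nu[OF nu], of "monom_eval (radius n \<rho> r)"]
  by (simp add: monom_eval_nonneg radius_nonneg monom_eval_add)

lemma ultra_seminorm_tree_norm: "ultra_seminorm UNIV (tree_norm nu n \<pi> \<rho> r)"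
proof -
  interpret G: ultra_seminorm UNIV "gauss nu (monom_eval (radius n \<rho> r))"
    by (rule ultra_seminorm_radius)
  show ?thesis
    by unfold_locales
      (auto simp: tree_norm_def tree_subst_hom G.zero G.one G.mult intro: G.nonneg G.ultra)
qed

lemma gauss_pvar: "gauss nu (monom_eval (radius n \<rho> r)) (pvar i) = radius n \<rho> r i"
  using radius_nonneg[of i] by (simp add: gauss_def pvar_def fmax_insert nu.one)

text \<open>In the difference of two path sums the common edges cancel, and each edge in the
  symmetric difference keeps its own variable with coefficient \<open>1\<close> or
  \<open>-1\<close>. No further cancellation is possible, so the Gauss norm of the difference is the
  largest of these edge lengths.\<close>

lemma tree_norm_minor:
  assumes kl: "k \<in> {1..n}" "l \<in> {1..n}" and \<pi>: "\<pi> k \<subseteq> {1..n}" "\<pi> l \<subseteq> {1..n}"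
  shows "tree_norm nu n \<pi> \<rho> r (minor (k, l)) = \<rho> k * \<rho> l * treedist r \<pi> k l"
proof -
  let ?G = "gauss nu (monom_eval (radius n \<rho> r))"
  interpret G: ultra_seminorm UNIV ?G by (rule ultra_seminorm_radius)
  let ?a = "path_sum \<pi> l - path_sum \<pi> k :: (nat \<Rightarrow>\<^sub>0 nat) \<Rightarrow>\<^sub>0 'k"
  have fin: "finite (\<pi> k)" "finite (\<pi> l)" using \<pi> by (auto intro: finite_subset)
  have rm: "radius n \<rho> r (2 * m + 1) = r m" if "m \<in> \<pi> k \<union> \<pi> l" for m
    using that \<pi> by (auto simp: radius_def)
  have split: "(path_sum \<pi> k' :: (nat \<Rightarrow>\<^sub>0 nat) \<Rightarrow>\<^sub>0 'k) = (\<Sum>m\<in>\<pi> k' - \<pi> l'. pvar (2 * m + 1)) + (\<Sum>m\<in>\<pi> k' \<inter> \<pi> l'. pvar (2 * m + 1))"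
    if "finite (\<pi> k')" for k' l'
    unfolding path_sum_def using that
    by (subst sum.union_disjoint[symmetric]) (auto intro!: sum.cong)
  have a: "?a = (\<Sum>m\<in>\<pi> l - \<pi> k. pvar (2 * m + 1)) - (\<Sum>m\<in>\<pi> k - \<pi> l. pvar (2 * m + 1))"
    using split[OF fin(1), of l] split[OF fin(2), of k] by (simp add: Int_commute)
  have le: "?G (\<Sum>m\<in>S. pvar (2 * m + 1)) \<le> treedist r \<pi> k l"
    if "S \<subseteq> (\<pi> k - \<pi> l) \<union> (\<pi> l - \<pi> k)" for S
  proof (rule G.sum_le)
    fix m assume "m \<in> S"
    then have "r m \<le> treedist r \<pi> k l"
      unfolding treedist_def using that fin by (intro fmax_ge) auto
    then show "?G (pvar (2 * m + 1)) \<le> treedist r \<pi> k l"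
      using rm[of m] that \<open>m \<in> S\<close> unfolding gauss_pvar by auto
  qed (use treedist_nonneg fin in auto)
  have "?G ?a \<le> max (?G (\<Sum>m\<in>\<pi> l - \<pi> k. pvar (2 * m + 1))) (?G (\<Sum>m\<in>\<pi> k - \<pi> l. pvar (2 * m + 1)))"
    unfolding a by (rule G.ultra_diff) auto
  also have "\<dots> \<le> treedist r \<pi> k l"
    using le[of "\<pi> l - \<pi> k"] le[of "\<pi> k - \<pi> l"] by simp
  finally have "?G ?a \<le> treedist r \<pi> k l" .
  moreover have "treedist r \<pi> k l \<le> ?G ?a"
    unfolding treedist_def
  proof (subst fmax_le_iff, use fin in simp, intro conjI ballI)
    show "0 \<le> ?G ?a" by (simp add: G.nonneg)
    fix m assume m: "m \<in> (\<pi> k - \<pi> l) \<union> (\<pi> l - \<pi> k)"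
    let ?m = "Poly_Mapping.single (2 * m + 1) (1::nat)"
    have "nu (Poly_Mapping.lookup ?a ?m) = 1"
      using m fin nu.uminus[of 1] unfolding lookup_minus by (auto simp: path_sum_coeff[simplified] nu.one)
    then have "nu (Poly_Mapping.lookup ?a ?m) * monom_eval (radius n \<rho> r) ?m = r m"
      using rm[of m] m by auto
    then show "r m \<le> ?G ?a"
      using nu.gauss_coeff_le[of ?a "monom_eval (radius n \<rho> r)" ?m]
      by (simp add: monom_eval_nonneg radius_nonneg)
  qed
  ultimately have "?G ?a = treedist r \<pi> k l" by simp
  moreover have "radius n \<rho> r (2 * k) = \<rho> k" "radius n \<rho> r (2 * l) = \<rho> l"
    using kl by (simp_all add: radius_def)
  ultimately show ?thesis
    by (simp add: tree_norm_def tree_subst_minor G.mult gauss_pvar)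
qed

text \<open>The denominators occurring in the chart are powers of \<open>minor e\<close>. As this
  has norm one, they are invertible in the localization and do not change the values.\<close>

lemma tree_norm_berk_point:
  assumes e: "e \<in> pairs n" and one: "tree_norm nu n \<pi> \<rho> r (minor e) = 1"
  shows "\<exists>\<theta>\<in>chart_points nu n e. \<forall>D P. minor_poly n D P \<longrightarrow>
           \<theta> (to_fr P / plucker e ^ D) = tree_norm nu n \<pi> \<rho> r P"
proof -
  let ?t = "tree_norm nu n \<pi> \<rho> r"
  interpret t: ultra_seminorm UNIV ?t by (rule ultra_seminorm_tree_norm)
  obtain L N where LN: "ultra_seminorm L N"
    and N1: "\<And>P. to_fr P \<in> L \<and> N (to_fr P) = ?t P"
    and N2: "\<And>P Q. ?t Q \<noteq> 0 \<Longrightarrow> to_fr P / to_fr Q \<in> L \<and> N (to_fr P / to_fr Q) = ?t P / ?t Q"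
    using fraction_field_extension[OF ultra_seminorm_tree_norm] by (metis UNIV_I)
  have N: "to_fr P / plucker e ^ D \<in> L" "N (to_fr P / plucker e ^ D) = ?t P" for P D
    using N2[of "minor e ^ D" P] one t.power[of "minor e" D] by (simp_all add: to_fr_power plucker_eq)
  have "coord_ring n {e} \<subseteq> L"
    using coord_ring_eq_to_fr[OF _ e] N(1) by fastforce
  moreover have "N (rf_const c) = nu c" for c
    using N1 by (simp add: rf_const_eq tree_norm_def tree_subst_hom gauss_def fmax_insert nu.nonneg
        nu.zero split: if_splits) 
  ultimately have "restrict N (coord_ring n {e}) \<in> chart_points nu n e"
    by (intro berk_point_restrict[OF LN])
  then show ?thesis
    using N(2) coord_ring_to_fr[OF _ e] by (intro bexI[of _ "restrict N (coord_ring n {e})"]) auto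
qed

end

end

section \<open>Points of a chart and their trees\<close>

definition sym_ext :: "(nat \<times> nat \<Rightarrow> real) \<Rightarrow> nat \<Rightarrow> nat \<Rightarrow> real" where
  "sym_ext x k l = (if k < l then x (k, l) else if l < k then x (l, k) else 0)"

text \<open>The norm of the column \<open>k\<close> in the coordinates in which the columns of the pair \<open>e\<close> are
  the standard basis.\<close>

definition col_norm :: "nat \<times> nat \<Rightarrow> (nat \<times> nat \<Rightarrow> real) \<Rightarrow> nat \<Rightarrow> real" where
  "col_norm e x k = max (sym_ext x k (snd e)) (sym_ext x (fst e) k)"

definition pl_values :: "nat \<Rightarrow> nat \<times> nat \<Rightarrow> ('k::field ratfun \<Rightarrow> real) \<Rightarrow> nat \<times> nat \<Rightarrow> real" where
  "pl_values n e \<gamma> = (\<lambda>m\<in>pairs n. \<gamma> (plucker m / plucker e))"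

text \<open>Constants inside the fractions of polynomials in one further variable; this is the field
  in which slopes are formed.\<close>

definition emb :: "'k::field ratfun \<Rightarrow> (nat \<Rightarrow>\<^sub>0 'k ratfun) fract" where
  "emb f = to_fr (Poly_Mapping.single 0 f)"

lemma plucker_quot_mem:
  fixes e :: "nat \<times> nat"
  assumes "k \<in> {1..n}" "l \<in> {1..n}"
  shows "plucker (k, l) / plucker e \<in> (coord_ring n {e} :: 'k::field ratfun set)"
proof -
  consider "(k, l) \<in> pairs n" | "(l, k) \<in> pairs n" | "k = l"
    using assms by (fastforce simp: pairs_def)
  then show ?thesis
  proof cases
    case 1
    then show ?thesis by (simp add: coord_ring_gen)
  next
    case 2
    then have "- (plucker (l, k) / plucker e) \<in> (coord_ring n {e} :: 'k ratfun set)"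
      by (simp add: coord_ring_gen coord_ring_uminus)
    then show ?thesis by (simp add: plucker_swap[of k l])
  qed (simp add: coord_ring_zero)
qed

lemma sym_ext_pl_values:
  assumes nu: "complete_nonarch_field nu" and \<gamma>: "\<gamma> \<in> chart_points nu n e" and kl: "k \<in> {1..n}" "l \<in> {1..n}"
  shows "sym_ext (pl_values n e \<gamma>) k l = \<gamma> (plucker (k, l) / plucker e)"
proof -
  interpret \<gamma>: ultra_seminorm "coord_ring n {e}" \<gamma> by (rule berk_point_ultra[OF nu \<gamma>])
  have "\<gamma> (plucker (k, l) / plucker e) = \<gamma> (plucker (l, k) / plucker e)"
    using \<gamma>.uminus[OF plucker_quot_mem[OF kl]] by (simp add: plucker_swap[of k l])
  then show ?thesis
    using kl \<gamma>.zero by (auto simp: sym_ext_def pl_values_def pairs_def not_less)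
qed

interpretation emb: coeff_hom emb
  by unfold_locales (simp_all add: emb_def single_add to_fr_add single0.hom_mult to_fr_mult)

lemma emb_uminus: "emb (- f) = - emb f"
  using emb.hom_add[of f "- f"] by (simp add: emb.hom_zero eq_neg_iff_add_eq_0 add.commute)

lemma emb_diff: "emb (f - g) = emb f - emb g"
  using emb.hom_add[of f "- g"] by (simp add: emb_uminus)

lemma plucker_relation_quot:
  fixes i j k l :: nat
  assumes "(plucker (i, j) :: 'k::field ratfun) \<noteq> 0"
  shows "plucker (k, j) / plucker (i, j) * (plucker (i, l) / plucker (i, j))
    - plucker (l, j) / plucker (i, j) * (plucker (i, k) / plucker (i, j))
    = (plucker (k, l) / plucker (i, j) :: 'k ratfun)"
proof -
  have "plucker (k, j) / plucker (i, j) * (plucker (i, l) / plucker (i, j))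
    - plucker (l, j) / plucker (i, j) * (plucker (i, k) / plucker (i, j))
    = (plucker (k, j) * plucker (i, l) - plucker (l, j) * plucker (i, k))
      / (plucker (i, j) * (plucker (i, j) :: 'k ratfun))"
    by (simp add: diff_divide_distrib)
  also have "\<dots> = plucker (k, l) / plucker (i, j)"
    unfolding plucker_relation using assms by simp
  finally show ?thesis .
qed

text \<open>
  The columns \<open>(\<alpha>\<^sub>k, \<beta>\<^sub>k)\<close> are transformed so that none of them of positive norm
  is parallel to \<open>(0, 1)\<close>: \<open>T\<^sub>k = \<alpha>\<^sub>k + w \<beta>\<^sub>k\<close> for a new variable \<open>w\<close> of norm one has the same
  norm as the column, and \<open>a\<^sub>k = \<beta>\<^sub>k / T\<^sub>k\<close> is its slope. Columns of norm zero get an arbitrary slope.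
\<close>

lemma chart_point_slopes:
  fixes nu :: "'k::field \<Rightarrow> real"
  assumes nu: "complete_nonarch_field nu" and e: "e \<in> pairs n"
    and \<gamma>: "\<gamma> \<in> chart_points nu n e"
  obtains L N and T a :: "nat \<Rightarrow> (nat \<Rightarrow>\<^sub>0 'k ratfun) fract"
  where "ultra_seminorm L N"
    "\<And>f. f \<in> coord_ring n {e} \<Longrightarrow> emb f \<in> L \<and> N (emb f) = \<gamma> f"
    "\<And>k. k \<in> {1..n} \<Longrightarrow> T k \<in> L \<and> N (T k) = col_norm e (pl_values n e \<gamma>) k"
    "\<And>k. a k \<in> L \<and> N (a k) \<le> 1"
    "\<And>k l. \<lbrakk>k \<in> {1..n}; l \<in> {1..n}; N (T k) \<noteq> 0; N (T l) \<noteq> 0\<rbrakk>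
       \<Longrightarrow> T k * T l * (a l - a k) = emb (plucker (k, l) / plucker e)"
proof -
  obtain i j where ij: "e = (i, j)" by (cases e)
  have ijn: "i \<in> {1..n}" "j \<in> {1..n}" using e ij by (auto simp: pairs_def)
  have pe: "(plucker (i, j) :: 'k ratfun) \<noteq> 0" using plucker_nonzero[OF e] ij by simp
  let ?A = "coord_ring n {e} :: 'k ratfun set"
  define \<alpha> \<beta> where "\<alpha> k = (plucker (k, j) / plucker e :: 'k ratfun)"
    and "\<beta> k = (plucker (i, k) / plucker e :: 'k ratfun)" for k
  note g = berk_point_ultra[OF nu \<gamma>]
  interpret \<gamma>: ultra_seminorm ?A \<gamma> by (rule g)
  have ab: "\<alpha> k \<in> ?A" "\<beta> k \<in> ?A" if "k \<in> {1..n}" for k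
    unfolding \<alpha>_def \<beta>_def using that ijn by (auto intro: plucker_quot_mem)
  let ?B = "{P :: nat \<Rightarrow>\<^sub>0 'k ratfun. \<forall>m. Poly_Mapping.lookup P m \<in> ?A}"
  let ?g = "gauss \<gamma> (\<lambda>_::nat. 1)"
  have B: "ultra_seminorm ?B ?g" by (rule ultra_seminorm_gauss[OF g]) auto
  interpret B: ultra_seminorm ?B ?g by (rule B)
  obtain L N where L: "ultra_seminorm L N"
    and N1: "\<And>P. P \<in> ?B \<Longrightarrow> to_fr P \<in> L \<and> N (to_fr P) = ?g P"
    and N2: "\<And>P Q. \<lbrakk>P \<in> ?B; Q \<in> ?B; ?g Q \<noteq> 0\<rbrakk>
      \<Longrightarrow> to_fr P / to_fr Q \<in> L \<and> N (to_fr P / to_fr Q) = ?g P / ?g Q"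
    by (rule fraction_field_extension[OF B]) blast
  interpret L: ultra_seminorm L N by (rule L)
  have single: "Poly_Mapping.single m f \<in> ?B" "?g (Poly_Mapping.single m f) = \<gamma> f" if "f \<in> ?A" for m f
    using that \<gamma>.zero_mem \<gamma>.zero \<gamma>.nonneg[OF that]
    by (auto simp: lookup_single when_def gauss_def fmax_insert max_def)
  define Tp where "Tp k = Poly_Mapping.single 0 (\<alpha> k) + Poly_Mapping.single (1::nat) (\<beta> k)" for k
  have Tp: "Tp k \<in> ?B" "?g (Tp k) = max (\<gamma> (\<alpha> k)) (\<gamma> (\<beta> k))" if k: "k \<in> {1..n}" for k
  proof -
    show mem: "Tp k \<in> ?B" unfolding Tp_def by (intro B.add_mem single ab k)
    have "?g (Tp k) \<le> max (\<gamma> (\<alpha> k)) (\<gamma> (\<beta> k))"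
      unfolding Tp_def
      using B.ultra[OF single(1)[OF ab(1)[OF k], of 0] single(1)[OF ab(2)[OF k], of 1]]
        single(2)[OF ab(1)[OF k], of 0] single(2)[OF ab(2)[OF k], of 1] by simp
    moreover have "Poly_Mapping.lookup (Tp k) 0 = \<alpha> k" "Poly_Mapping.lookup (Tp k) 1 = \<beta> k"
      by (simp_all add: Tp_def lookup_add lookup_single)
    then have "\<gamma> (\<alpha> k) \<le> ?g (Tp k)" "\<gamma> (\<beta> k) \<le> ?g (Tp k)"
      using \<gamma>.gauss_coeff_le[of "Tp k" "\<lambda>_. 1" 0] \<gamma>.gauss_coeff_le[of "Tp k" "\<lambda>_. 1" 1] mem by auto
    ultimately show "?g (Tp k) = max (\<gamma> (\<alpha> k)) (\<gamma> (\<beta> k))" by simp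
  qed
  define T where "T k = to_fr (Tp k)" for k
  define a where "a k = (if k \<in> {1..n} \<and> ?g (Tp k) \<noteq> 0 then emb (\<beta> k) / T k else 0)" for k
  have T: "T k \<in> L" "N (T k) = ?g (Tp k)" if "k \<in> {1..n}" for k
    unfolding T_def using N1[OF Tp(1)[OF that]] by auto
  show ?thesis
  proof (rule that[OF L, of T a])
    show "emb f \<in> L \<and> N (emb f) = \<gamma> f" if "f \<in> coord_ring n {e}" for f
      using N1[OF single(1)[OF that]] single(2)[OF that] by (simp add: emb_def)
    show "T k \<in> L \<and> N (T k) = col_norm e (pl_values n e \<gamma>) k" if "k \<in> {1..n}" for k
      using T[OF that] Tp(2)[OF that] sym_ext_pl_values[OF nu \<gamma>] that ijn
      by (simp add: col_norm_def ij \<alpha>_def \<beta>_def)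
    show "a k \<in> L \<and> N (a k) \<le> 1" for k
    proof (cases "k \<in> {1..n} \<and> ?g (Tp k) \<noteq> 0")
      case True
      then have k: "k \<in> {1..n}" by simp
      have "0 < ?g (Tp k)" using True B.nonneg[OF Tp(1)[OF k]] by simp
      moreover have "\<gamma> (\<beta> k) \<le> ?g (Tp k)" using Tp(2)[OF k] by simp
      ultimately show ?thesis
        using N2[OF single(1)[OF ab(2)[OF k], of 0] Tp(1)[OF k]] single(2)[OF ab(2)[OF k], of 0] True
        by (simp add: a_def T_def emb_def)
    next
      case False
      then have "a k = 0" unfolding a_def by (rule if_not_P)
      then show ?thesis by (simp add: L.zero_mem L.zero)
    qed
    fix k l assume kl: "k \<in> {1..n}" "l \<in> {1..n}" and nz: "N (T k) \<noteq> 0" "N (T l) \<noteq> 0"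
    then have T0: "T k \<noteq> 0" "T l \<noteq> 0" using L.zero by auto
    have ak: "a k = emb (\<beta> k) / T k" "a l = emb (\<beta> l) / T l"
      using kl nz T(2) by (simp_all add: a_def)
    define w where "w = to_fr (Poly_Mapping.single (1::nat) (1 :: 'k ratfun))"
    have Tw: "T k = emb (\<alpha> k) + w * emb (\<beta> k)" for k
      by (simp add: T_def Tp_def to_fr_add emb_def w_def mult_single flip: to_fr_mult)
    have "T k * T l * (a l - a k) = emb (\<beta> l) * T k - emb (\<beta> k) * T l"
      unfolding ak using T0 by (simp add: field_simps)
    \<comment> \<open>The two multiples of \<open>w\<close> cancel, and the Pluecker relation
      identifies the remaining determinant.\<close>
    also have "\<dots> = emb (\<beta> l) * emb (\<alpha> k) - emb (\<beta> k) * emb (\<alpha> l)"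
      unfolding Tw by (simp add: algebra_simps)
    also have "\<dots> = emb (\<alpha> k * \<beta> l - \<alpha> l * \<beta> k)"
      by (simp add: emb_diff emb.hom_mult mult.commute)
    also have "\<alpha> k * \<beta> l - \<alpha> l * \<beta> k = plucker (k, l) / plucker e"
      unfolding \<alpha>_def \<beta>_def ij by (rule plucker_relation_quot[OF pe])
    finally show "T k * T l * (a l - a k) = emb (plucker (k, l) / plucker e)" .
  qed
qed

text \<open>The Pluecker relation writes the minor as a combination of the two coordinates of the
  column \<open>k\<close>, both of which have seminorm zero.\<close>

lemma plucker_eq_zero:
  assumes nu: "complete_nonarch_field nu" and e: "e \<in> pairs n" and \<gamma>: "\<gamma> \<in> chart_points nu n e"
    and kl: "k \<in> {1..n}" "l \<in> {1..n}" and k0: "col_norm e (pl_values n e \<gamma>) k = 0"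
  shows "\<gamma> (plucker (k, l) / plucker e) = 0" "\<gamma> (plucker (l, k) / plucker e) = 0"
proof -
  obtain i j where ij: "e = (i, j)" by (cases e)
  have ijn: "i \<in> {1..n}" "j \<in> {1..n}" using e ij by (auto simp: pairs_def)
  let ?A = "coord_ring n {e} :: 'a ratfun set"
  interpret \<gamma>: ultra_seminorm ?A \<gamma> by (rule berk_point_ultra[OF nu \<gamma>])
  let ?p = "\<lambda>k l. plucker (k, l) / plucker e :: 'a ratfun"
  have mem: "?p k j \<in> ?A" "?p i l \<in> ?A" "?p l j \<in> ?A" "?p i k \<in> ?A" "?p k l \<in> ?A"
    using kl ijn by (auto intro: plucker_quot_mem)
  have "max (\<gamma> (?p k j)) (\<gamma> (?p i k)) = 0"
    using k0 sym_ext_pl_values[OF nu \<gamma>] kl ijn by (simp add: col_norm_def ij)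
  then have "\<gamma> (?p k j) = 0" "\<gamma> (?p i k) = 0"
    using \<gamma>.nonneg mem by (metis max.cobounded1 order_antisym, metis max.cobounded2 order_antisym mem \<gamma>.nonneg)
  then have z: "\<gamma> (?p k j * ?p i l) = 0" "\<gamma> (?p l j * ?p i k) = 0"
    unfolding \<gamma>.mult[OF mem(1,2)] \<gamma>.mult[OF mem(3,4)] by simp_all
  have "?p k j * ?p i l - ?p l j * ?p i k = ?p k l"
    unfolding ij by (rule plucker_relation_quot) (use plucker_nonzero[OF e] ij in simp)
  then have "\<gamma> (?p k l) \<le> max 0 0"
    using \<gamma>.ultra_diff[OF \<gamma>.mult_mem[OF mem(1,2)] \<gamma>.mult_mem[OF mem(3,4)]] by (simp only: z)
  then have "\<gamma> (?p k l) \<le> 0" by simp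
  then show "\<gamma> (?p k l) = 0" using \<gamma>.nonneg[OF mem(5)] by simp
  then show "\<gamma> (?p l k) = 0"
    using \<gamma>.uminus[OF mem(5)] by (simp add: plucker_swap[of l k])
qed

text \<open>At Pluecker values of a point, a pair containing a column of norm zero puts no condition
  on \<open>r\<close>, since both sides vanish; hence \<open>r\<close> need not be determined by
  \<open>x\<close>.\<close>

definition tree_rep ::
    "nat \<Rightarrow> nat \<times> nat \<Rightarrow> (nat \<times> nat \<Rightarrow> real) \<Rightarrow> (nat \<Rightarrow> nat set) \<Rightarrow> (nat \<Rightarrow> real) \<Rightarrow> bool" where
  "tree_rep n e x \<pi> r \<longleftrightarrow> (\<forall>(k, l)\<in>pairs n. x (k, l) = col_norm e x k * col_norm e x l * treedist r \<pi> k l)"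

text \<open>The tree represents the distances of the slopes. These have norm at most one, so all
  distances, and with them the edge lengths, lie in \<open>{0..1}\<close>. Columns of norm zero take
  part with their arbitrary slope.\<close>

lemma tree_rep_exists:
  fixes nu :: "'k::field \<Rightarrow> real"
  assumes nu: "complete_nonarch_field nu" and e: "e \<in> pairs n" and \<gamma>: "\<gamma> \<in> chart_points nu n e"
  shows "\<exists>z y \<pi> r. tree_on {1..n} z y \<pi> \<and> (\<forall>k\<in>{1..n}. r k \<in> {0..1}) \<and>
           tree_rep n e (pl_values n e \<gamma>) \<pi> r"
proof -
  obtain L N and T a :: "nat \<Rightarrow> (nat \<Rightarrow>\<^sub>0 'k ratfun) fract" where L: "ultra_seminorm L N"
    and E: "\<And>f. f \<in> coord_ring n {e} \<Longrightarrow> emb f \<in> L \<and> N (emb f) = \<gamma> f"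
    and T: "\<And>k. k \<in> {1..n} \<Longrightarrow> T k \<in> L \<and> N (T k) = col_norm e (pl_values n e \<gamma>) k"
    and a: "\<And>k. a k \<in> L \<and> N (a k) \<le> 1"
    and Ta: "\<And>k l. \<lbrakk>k \<in> {1..n}; l \<in> {1..n}; N (T k) \<noteq> 0; N (T l) \<noteq> 0\<rbrakk>
       \<Longrightarrow> T k * T l * (a l - a k) = emb (plucker (k, l) / plucker e)"
    by (rule chart_point_slopes[OF nu e \<gamma>]) blast
  interpret L: ultra_seminorm L N by (rule L)
  define d where "d k l = N (a k - a l)" for k l
  have d: "d k l = d l k" "d k k = 0" "0 \<le> d k l" "d k m \<le> max (d k l) (d l m)" for k l m
  proof -
    show "d k l = d l k" unfolding d_def using a by (intro L.diff_commute) auto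
    show "0 \<le> d k l" unfolding d_def using a by (intro L.nonneg L.diff_mem) auto
    show "d k k = 0" by (simp add: d_def L.zero)
    have "N (a k - a l + (a l - a m)) \<le> max (d k l) (d l m)"
      unfolding d_def using a by (intro L.ultra L.diff_mem) auto
    then show "d k m \<le> max (d k l) (d l m)" by (simp add: d_def)
  qed
  have d1: "d k l \<in> {0..1}" for k l
    using L.ultra_diff[of "a k" "a l"] a[of k] a[of l] d(3)[of k l] by (auto simp: d_def)
  have "{1..n} \<noteq> {}" using e by (auto simp: pairs_def)
  then obtain z y \<pi> r where t: "tree_on {1..n} z y \<pi>" "\<forall>k\<in>{1..n}. r k \<in> range (case_prod d)"
      "\<forall>k\<in>{1..n}. \<forall>l\<in>{1..n}. d k l = treedist r \<pi> k l"
    using ultrametric_eq_treedist[of "{1..n}" d] d by blast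
  have "tree_rep n e (pl_values n e \<gamma>) \<pi> r"
    unfolding tree_rep_def
  proof (clarify)
    fix k l assume p: "(k, l) \<in> pairs n"
    then have kl: "k \<in> {1..n}" "l \<in> {1..n}" by (auto simp: pairs_def)
    have x: "pl_values n e \<gamma> (k, l) = \<gamma> (plucker (k, l) / plucker e)"
      using p by (simp add: pl_values_def)
    show "pl_values n e \<gamma> (k, l) = col_norm e (pl_values n e \<gamma>) k * col_norm e (pl_values n e \<gamma>) l *
        treedist r \<pi> k l"
    proof (cases "N (T k) = 0 \<or> N (T l) = 0")
      case True
      then show ?thesis
        using plucker_eq_zero[OF nu e \<gamma>] kl T x by (metis mult_zero_left mult_zero_right)
    next
      case False
      have "\<gamma> (plucker (k, l) / plucker e) = N (T k * T l * (a l - a k))"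
        using E[OF plucker_quot_mem[OF kl]] Ta[OF kl] False by simp
      also have "\<dots> = N (T k) * N (T l) * d l k"
        using T kl a by (simp add: d_def L.mult L.mult_mem L.diff_mem)
      finally show ?thesis using x T kl t(3) d(1) by simp
    qed
  qed
  moreover have "\<forall>k\<in>{1..n}. r k \<in> {0..1}" using t(2) d1 by fastforce
  ultimately show ?thesis using t(1) by blast
qed

text \<open>Between columns of positive norm the slopes \<open>a\<close> already have the tree
  distances. Columns of norm zero receive new slopes \<open>b\<close>, chosen such that the tree
  metric still bounds every distance; the differences of \<open>b\<close> along the edges then have
  norm at most \<open>r\<close>. Substituting them for the edge variables bounds the result by the
  Gauss norm.\<close>

theorem tree_norm_maximal:
  fixes nu :: "'k::field \<Rightarrow> real"
  assumes nu: "complete_nonarch_field nu" and e: "e \<in> pairs n" and \<gamma>: "\<gamma> \<in> chart_points nu n e"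
    and tree: "tree_on {1..n} z y \<pi>" and r: "\<And>k. k \<in> {1..n} \<Longrightarrow> 0 \<le> r k"
    and rep: "tree_rep n e (pl_values n e \<gamma>) \<pi> r"
    and P: "minor_poly n D P"
  shows "\<gamma> (to_fr P / plucker e ^ D) \<le> tree_norm nu n \<pi> (col_norm e (pl_values n e \<gamma>)) r P"
proof -
  obtain L N and T a :: "nat \<Rightarrow> (nat \<Rightarrow>\<^sub>0 'k ratfun) fract" where L: "ultra_seminorm L N"
    and E: "\<And>f. f \<in> coord_ring n {e} \<Longrightarrow> emb f \<in> L \<and> N (emb f) = \<gamma> f"
    and T: "\<And>k. k \<in> {1..n} \<Longrightarrow> T k \<in> L \<and> N (T k) = col_norm e (pl_values n e \<gamma>) k"
    and a: "\<And>k. a k \<in> L \<and> N (a k) \<le> 1"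
    and Ta: "\<And>k l. \<lbrakk>k \<in> {1..n}; l \<in> {1..n}; N (T k) \<noteq> 0; N (T l) \<noteq> 0\<rbrakk>
       \<Longrightarrow> T k * T l * (a l - a k) = emb (plucker (k, l) / plucker e)"
    by (rule chart_point_slopes[OF nu e \<gamma>]) blast
  interpret L: ultra_seminorm L N by (rule L)
  interpret \<gamma>: ultra_seminorm "coord_ring n {e}" \<gamma> by (rule berk_point_ultra[OF nu \<gamma>])
  let ?\<rho> = "col_norm e (pl_values n e \<gamma>)"
  let ?p = "\<lambda>k l. plucker (k, l) / plucker e :: 'k ratfun"
  have "\<pi> k \<subseteq> {1..n}" if "k \<in> {1..n}" for k
    using tree that unfolding tree_on_def by blast
  then have fin: "finite (\<pi> k)" "\<pi> k \<subseteq> {1..n}" if "k \<in> {1..n}" for k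
    using that by (auto intro: finite_subset)
  \<comment> \<open>\<open>extend_ultrametric_map\<close> expects an ultrametric on all indices;
    empty paths outside \<open>{1..n}\<close> provide one.\<close>
  define \<pi>' where "\<pi>' k = (if k \<in> {1..n} then \<pi> k else {})" for k
  have fin': "finite (\<pi>' k)" for k using fin(1) by (auto simp: \<pi>'_def)
  define Q where "Q = {k \<in> {1..n}. N (T k) \<noteq> 0}"
  have Q: "N (a k - a l) \<le> treedist r \<pi>' k l" if kl: "k \<in> Q" "l \<in> Q" for k l
  proof -
    have kln: "k \<in> {1..n}" "l \<in> {1..n}" and nz: "N (T k) \<noteq> 0" "N (T l) \<noteq> 0"
      using kl by (auto simp: Q_def)
    have eq: "N (a k - a l) = treedist r \<pi>' k l"
      if "(k, l) \<in> pairs n" "N (T k) \<noteq> 0" "N (T l) \<noteq> 0" for k l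
    proof -
      have kl: "k \<in> {1..n}" "l \<in> {1..n}" using that(1) by (auto simp: pairs_def)
      have "N (T k) * N (T l) * N (a l - a k) = N (T k * T l * (a l - a k))"
        using T kl a by (simp add: L.mult L.mult_mem L.diff_mem)
      also have "\<dots> = \<gamma> (?p k l)" using Ta[OF kl that(2,3)] E[OF plucker_quot_mem[OF kl]] by simp
      also have "\<dots> = pl_values n e \<gamma> (k, l)" using that(1) by (simp add: pl_values_def)
      also have "\<dots> = ?\<rho> k * ?\<rho> l * treedist r \<pi> k l"
        using rep that(1) unfolding tree_rep_def by blast
      also have "\<dots> = N (T k) * N (T l) * treedist r \<pi>' k l" using T kl
        by (simp add: \<pi>'_def treedist_def)
      finally have "N (a l - a k) = treedist r \<pi>' k l" using that by simp
      then show ?thesis using L.diff_commute[of "a k" "a l"] a by simp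
    qed
    consider "(k, l) \<in> pairs n" | "(l, k) \<in> pairs n" | "k = l"
      using kln by (fastforce simp: pairs_def)
    then show ?thesis
    proof cases
      case 1
      then show ?thesis using eq nz by simp
    next
      case 2
      then show ?thesis using eq[of l k] nz L.diff_commute[of "a k" "a l"] a treedist_commute[of r \<pi>' k l]
        by simp
    next
      case 3
      then show ?thesis using treedist_nonneg[OF fin' fin'] by (simp add: L.zero)
    qed
  qed
  \<comment> \<open>The extension has to start from some column of positive norm. One coordinate of
    the column \<open>fst e\<close> is \<open>plucker e / plucker e\<close>, so its norm is at least
    one.\<close>
  have "fst e \<in> Q"
  proof -
    have en: "fst e \<in> {1..n}" "snd e \<in> {1..n}" using e by (auto simp: pairs_def)
    have "1 = \<gamma> (?p (fst e) (snd e))"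
      using plucker_nonzero[OF e, where 'a='k] by (simp add: \<gamma>.one)
    also have "\<dots> \<le> ?\<rho> (fst e)" using sym_ext_pl_values[OF nu \<gamma> en] by (simp add: col_norm_def)
    finally show ?thesis using T en by (simp add: Q_def)
  qed
  then have Q0: "Q \<noteq> {}" by auto
  have "finite Q" by (simp add: Q_def)
  have "\<exists>b. (\<forall>k\<in>Q. b k = a k) \<and> (\<forall>k\<in>Q \<union> {1..n}. b k \<in> L) \<and>
      (\<forall>k\<in>Q \<union> {1..n}. \<forall>l\<in>Q \<union> {1..n}. N (b k - b l) \<le> treedist r \<pi>' k l)"
    by (rule L.extend_ultrametric_map[OF _ \<open>finite Q\<close> Q0])
      (use a Q treedist_nonneg[OF fin' fin'] treedist_ultra[OF fin' fin' fin'] in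
        \<open>auto intro: treedist_commute\<close>)
  then obtain b where b: "\<And>k. k \<in> Q \<Longrightarrow> b k = a k" "\<And>k. k \<in> {1..n} \<Longrightarrow> b k \<in> L"
    "\<And>k l. \<lbrakk>k \<in> {1..n}; l \<in> {1..n}\<rbrakk> \<Longrightarrow> N (b k - b l) \<le> treedist r \<pi>' k l" by blast
  define s where "s k = (if k \<in> {1..n} \<and> \<pi> k \<noteq> {} then b k - b (y k) else 0)" for k
  have s: "s k \<in> L \<and> N (s k) \<le> r k" if k: "k \<in> {1..n}" for k
  proof (cases "\<pi> k = {}")
    case True
    then show ?thesis using r[OF k] by (simp add: s_def L.zero_mem L.zero)
  next
    case False
    then have y: "y k \<in> {1..n}" "k \<notin> \<pi> (y k)" "\<pi> k = insert k (\<pi> (y k))"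
      using tree k unfolding tree_on_def by blast+
    \<comment> \<open>A vertex and its parent are separated by the edge \<open>k\<close> alone, so
      their tree distance is the single length \<open>r k\<close>.\<close>
    then have "(\<pi>' k - \<pi>' (y k)) \<union> (\<pi>' (y k) - \<pi>' k) = {k}" using k by (auto simp: \<pi>'_def)
    then have "treedist r \<pi>' k (y k) = r k"
      unfolding treedist_def using r[OF k] by (simp add: fmax_insert)
    then show ?thesis using b(3)[OF k y(1)] b(2)[OF k] b(2)[OF y(1)] False k
      by (simp add: s_def L.diff_mem)
  qed
  let ?R = "radius n ?\<rho> r"
  define v where "v i = (if i div 2 \<in> {1..n} then if even i then T (i div 2) else s (i div 2) else 0)" for i
  have v: "v i \<in> L" "N (v i) \<le> ?R i" for i
    using T s unfolding v_def radius_def by (auto simp: L.zero_mem L.zero)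
  let ?h = "\<lambda>c. emb (rf_const c)"
  interpret h: coeff_hom ?h
    by unfold_locales (simp_all add: emb.hom_zero emb.hom_one emb.hom_add emb.hom_mult
      rf_const.hom_zero rf_const.hom_one rf_const.hom_add rf_const.hom_mult)
  have h: "?h c \<in> L" "N (?h c) = nu c" for c
    using E[OF coord_ring_const] \<gamma> by (auto simp: berk_points_def)
  note le = L.peval_le_gauss[where v = v and rad = ?R, OF ultra_seminorm_nu[OF nu] refl h v]
  let ?E = "\<lambda>P. peval ?h v (tree_subst \<pi> P)"
  have path: "peval ?h v (path_sum \<pi> k) = b k - b z" if k: "k \<in> {1..n}" for k
  proof -
    have "peval ?h v (path_sum \<pi> k) = (\<Sum>m\<in>\<pi> k. s m)"
      unfolding path_sum_def h.peval_sum h.peval_pvar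
      using fin(2)[OF k] by (intro sum.cong) (auto simp: v_def)
    also have "\<dots> = b k - b z"
      by (rule tree_on_sum[OF tree _ k]) (simp_all add: s_def)
    finally show ?thesis .
  qed
  have EM: "N (?E (minor (k, l)) - emb (?p k l)) = 0" if p: "(k, l) \<in> pairs n" for k l
  proof -
    have kl: "k \<in> {1..n}" "l \<in> {1..n}" using p by (auto simp: pairs_def)
    have "?E (minor (k, l)) = T k * T l * (b l - b k)"
      using kl by (simp add: tree_subst_minor h.peval_mult h.peval_diff h.peval_pvar path v_def)
    moreover have "N (T k * T l * (b l - b k) - emb (?p k l)) = 0"
    proof (cases "N (T k) = 0 \<or> N (T l) = 0")
      case True
      then have "\<gamma> (?p k l) = 0" using plucker_eq_zero[OF nu e \<gamma>] kl T by metis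
      then have 1: "emb (?p k l) \<in> L" "N (emb (?p k l)) = 0" using E[OF plucker_quot_mem[OF kl]] by auto
      have 2: "T k * T l * (b l - b k) \<in> L" using T kl b(2) by (intro L.mult_mem L.diff_mem) auto
      have "N (T k * T l * (b l - b k)) = 0"
        using T kl b(2) True by (auto simp: L.mult L.mult_mem L.diff_mem)
      then show ?thesis
        using L.ultra_diff[OF 2 1(1)] 1(2) L.nonneg[OF L.diff_mem[OF 2 1(1)]] by simp
    next
      case False
      then have "T k * T l * (b l - b k) = emb (?p k l)" using Ta[OF kl] b(1) kl by (simp add: Q_def)
      then show ?thesis by (simp add: L.zero)
    qed
    ultimately show ?thesis by simp
  qed
  \<comment> \<open>Congruence modulo the kernel of \<open>N\<close> is preserved by sums and
    products, so it passes from the minors to all forms in them.\<close>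
  have "N (?E P - emb (to_fr P / plucker e ^ D)) = 0"
    using P
  proof (induction rule: minor_poly.induct)
    case (const c)
    show ?case by (simp add: tree_subst_hom h.peval_single L.zero flip: rf_const_eq)
  next
    case (step m D P)
    obtain k l where m: "m = (k, l)" by (cases m)
    let ?X = "?E (minor (k, l))" and ?x = "emb (?p k l)"
      and ?Y = "?E P" and ?y = "emb (to_fr P / plucker e ^ D)"
    have kl: "k \<in> {1..n}" "l \<in> {1..n}" using step m by (auto simp: pairs_def)
    have mem: "?X \<in> L" "?Y \<in> L" "?x \<in> L" "?y \<in> L"
      using le(1) E[OF plucker_quot_mem[OF kl]] E[OF coord_ring_to_fr[OF step.hyps(2) e]] by auto
    have "?E (minor m * P) - emb (to_fr (minor m * P) / plucker e ^ Suc D) = ?X * ?Y - ?x * ?y"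
      by (simp add: m tree_subst_hom h.peval_mult to_fr_mult plucker_eq flip: emb.hom_mult)
    also have "\<dots> = ?X * (?Y - ?y) + (?X - ?x) * ?y" by (simp add: algebra_simps)
    finally have eq: "?E (minor m * P) - emb (to_fr (minor m * P) / plucker e ^ Suc D)
        = ?X * (?Y - ?y) + (?X - ?x) * ?y" .
    have "N (?X * (?Y - ?y)) = 0" "N ((?X - ?x) * ?y) = 0"
      using step EM[of k l] m mem by (simp_all add: L.mult L.diff_mem)
    then have "N (?X * (?Y - ?y) + (?X - ?x) * ?y) \<le> 0"
      using L.ultra[of "?X * (?Y - ?y)" "(?X - ?x) * ?y"] mem by (simp add: L.mult_mem L.diff_mem)
    moreover have "0 \<le> N (?X * (?Y - ?y) + (?X - ?x) * ?y)"
      using mem by (intro L.nonneg L.add_mem L.mult_mem L.diff_mem)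
    ultimately show ?case unfolding eq by simp
  next
    case (add D P Q)
    have mem: "?E P \<in> L" "?E Q \<in> L" "emb (to_fr P / plucker e ^ D) \<in> L" "emb (to_fr Q / plucker e ^ D) \<in> L"
      using le(1) E[OF coord_ring_to_fr[OF add.hyps(1) e]] E[OF coord_ring_to_fr[OF add.hyps(2) e]]
      by auto
    have eq: "?E (P + Q) - emb (to_fr (P + Q) / plucker e ^ D)
        = (?E P - emb (to_fr P / plucker e ^ D)) + (?E Q - emb (to_fr Q / plucker e ^ D))"
      by (simp add: tree_subst_hom h.peval_add to_fr_add add_divide_distrib emb.hom_add)
    show ?case
      unfolding eq using add.IH mem
        L.ultra[OF L.diff_mem[OF mem(1,3)] L.diff_mem[OF mem(2,4)]]
        L.nonneg[OF L.add_mem[OF L.diff_mem[OF mem(1,3)] L.diff_mem[OF mem(2,4)]]] by simp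
  qed
  then have "N (?E P) = N (emb (to_fr P / plucker e ^ D))"
    using le(1) E[OF coord_ring_to_fr[OF P e]] by (intro L.eq_of_diff_zero) auto
  also have "\<dots> = \<gamma> (to_fr P / plucker e ^ D)" using E[OF coord_ring_to_fr[OF P e]] by simp
  finally show ?thesis using le(2)[of "tree_subst \<pi> P"] by (simp add: tree_norm_def)
qed

section \<open>The section on a chart\<close>

text \<open>Path functions are made extensional so that only finitely many remain.\<close>

abbreviation trees :: "nat \<Rightarrow> (nat \<Rightarrow> nat set) set" where
  "trees n \<equiv> {\<pi> \<in> {1..n} \<rightarrow>\<^sub>E Pow {1..n}. \<exists>z y. tree_on {1..n} z y \<pi>}"

lemma finite_trees: "finite (trees n)"
  by (rule finite_subset[OF _ finite_PiE[of "{1..n}" "\<lambda>_. Pow {1..n}"]]) auto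

lemma tree_rep_exists_trees:
  fixes nu :: "'k::field \<Rightarrow> real"
  assumes nu: "complete_nonarch_field nu" and e: "e \<in> pairs n" and \<gamma>: "\<gamma> \<in> chart_points nu n e"
  shows "\<exists>\<pi>\<in>trees n. \<exists>r\<in>{1..n} \<rightarrow>\<^sub>E {0..1}. tree_rep n e (pl_values n e \<gamma>) \<pi> r"
proof -
  obtain z y \<pi> r where t: "tree_on {1..n} z y \<pi>" and r: "\<forall>k\<in>{1..n}. r k \<in> {0..1}"
    and rep: "tree_rep n e (pl_values n e \<gamma>) \<pi> r"
    using tree_rep_exists[OF nu e \<gamma>] by blast
  have sub: "\<pi> k \<subseteq> {1..n}" if "k \<in> {1..n}" for k
    using t that unfolding tree_on_def by blast
  let ?\<pi> = "restrict \<pi> {1..n}" and ?r = "restrict r {1..n}"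
  have "treedist ?r ?\<pi> k l = treedist r \<pi> k l" if "(k, l) \<in> pairs n" for k l
  proof -
    have kl: "k \<in> {1..n}" "l \<in> {1..n}" using that by (auto simp: pairs_def)
    then show ?thesis
      using sub[OF kl(1)] sub[OF kl(2)] unfolding treedist_def by (auto intro!: fmax_cong)
  qed
  then have "tree_rep n e (pl_values n e \<gamma>) ?\<pi> ?r" using rep by (fastforce simp: tree_rep_def)
  moreover have "tree_on {1..n} z y ?\<pi>"
    unfolding tree_on_def
  proof (intro conjI ballI)
    show "z \<in> {1..n}" using t unfolding tree_on_def by blast
    fix k assume k: "k \<in> {1..n}"
    then have "k = z \<and> \<pi> k = {} \<or> y k \<in> {1..n} \<and> k \<notin> \<pi> (y k) \<and> \<pi> k = insert k (\<pi> (y k))"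
      using t unfolding tree_on_def by blast
    then show "k = z \<and> ?\<pi> k = {} \<or> y k \<in> {1..n} \<and> k \<notin> ?\<pi> (y k) \<and> ?\<pi> k = insert k (?\<pi> (y k))"
      using k by auto
    show "?\<pi> k \<subseteq> {1..n}" using sub[OF k] k by simp
  qed
  moreover have "?\<pi> \<in> {1..n} \<rightarrow>\<^sub>E Pow {1..n}" using sub by auto
  moreover have "?r \<in> {1..n} \<rightarrow>\<^sub>E {0..1}" using r by auto
  ultimately show ?thesis by blast
qed

section \<open>The greatest point of a fibre and its continuity\<close>

definition is_max_point ::
    "('k::field \<Rightarrow> real) \<Rightarrow> nat \<Rightarrow> nat \<times> nat \<Rightarrow> (nat \<times> nat \<Rightarrow> real) \<Rightarrow> ('k ratfun \<Rightarrow> real) \<Rightarrow> bool" where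
  "is_max_point nu n e x \<theta> \<longleftrightarrow> \<theta> \<in> chart_points nu n e \<and> pl_values n e \<theta> = x \<and>
     (\<forall>\<gamma>\<in>chart_points nu n e. pl_values n e \<gamma> = x \<longrightarrow> (\<forall>f\<in>coord_ring n {e}. \<gamma> f \<le> \<theta> f))"

definition max_point ::
    "('k::field \<Rightarrow> real) \<Rightarrow> nat \<Rightarrow> nat \<times> nat \<Rightarrow> (nat \<times> nat \<Rightarrow> real) \<Rightarrow> 'k ratfun \<Rightarrow> real" where
  "max_point nu n e x = (THE \<theta>. is_max_point nu n e x \<theta>)"

lemma is_max_point_unique:
  assumes "is_max_point nu n e x \<theta>" "is_max_point nu n e x \<theta>'" shows "\<theta> = \<theta>'"
proof
  fix f
  have "\<theta> \<in> extensional (coord_ring n {e})" "\<theta>' \<in> extensional (coord_ring n {e})"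
    using assms by (auto simp: is_max_point_def berk_points_def)
  then show "\<theta> f = \<theta>' f"
    using assms unfolding is_max_point_def
    by (cases "f \<in> coord_ring n {e}") (auto intro: antisym simp: extensional_def)
qed

lemma max_point_eq: "is_max_point nu n e x \<theta> \<Longrightarrow> max_point nu n e x = \<theta>"
  unfolding max_point_def by (rule the_equality) (auto intro: is_max_point_unique)

text \<open>The condition \<open>tree_rep\<close> refers only to \<open>x\<close>. A tree obtained
  from one point of the fibre therefore bounds every other point of it, while the values at the
  minors place the tree norm itself in the fibre.\<close>

lemma is_max_point_tree_norm:
  fixes nu :: "'k::field \<Rightarrow> real"
  assumes nu: "complete_nonarch_field nu" and e: "e \<in> pairs n"
    and x: "x \<in> pl_values n e ` chart_points nu n e"
    and \<pi>: "\<pi> \<in> trees n" and r: "r \<in> {1..n} \<rightarrow>\<^sub>E {0..1}" and rep: "tree_rep n e x \<pi> r"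
  obtains \<theta> where "is_max_point nu n e x \<theta>"
    "\<And>D P. minor_poly n D P \<Longrightarrow> \<theta> (to_fr P / plucker e ^ D) = tree_norm nu n \<pi> (col_norm e x) r P"
proof -
  obtain \<gamma> where \<gamma>: "\<gamma> \<in> chart_points nu n e" "x = pl_values n e \<gamma>" using x by blast
  interpret \<gamma>: ultra_seminorm "coord_ring n {e}" \<gamma> by (rule berk_point_ultra[OF nu \<gamma>(1)])
  let ?\<rho> = "col_norm e x"
  have nn: "0 \<le> ?\<rho> k \<and> 0 \<le> r k" if k: "k \<in> {1..n}" for k
  proof -
    have en: "fst e \<in> {1..n}" "snd e \<in> {1..n}" using e by (auto simp: pairs_def)
    have "0 \<le> sym_ext x (fst e) k"
      unfolding \<gamma>(2) sym_ext_pl_values[OF nu \<gamma>(1) en(1) k] by (intro \<gamma>.nonneg plucker_quot_mem en k)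
    moreover have "r k \<in> {0..1}" using r k by blast
    ultimately show ?thesis by (simp add: col_norm_def le_max_iff_disj)
  qed
  have minor: "tree_norm nu n \<pi> ?\<rho> r (minor m) = x m" if m: "m \<in> pairs n" for m
  proof -
    obtain k l where kl: "m = (k, l)" by (cases m)
    have "k \<in> {1..n}" "l \<in> {1..n}" using m kl by (auto simp: pairs_def)
    moreover from this have "\<pi> k \<subseteq> {1..n}" "\<pi> l \<subseteq> {1..n}" using \<pi> by auto
    ultimately have "tree_norm nu n \<pi> ?\<rho> r (minor m) = ?\<rho> k * ?\<rho> l * treedist r \<pi> k l"
      unfolding kl by (intro tree_norm_minor[where \<rho> = ?\<rho> and r = r, OF nu nn])
    also have "\<dots> = x m" using rep m kl by (auto simp: tree_rep_def)
    finally show ?thesis .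
  qed
  have one: "x e = 1"
    using e plucker_nonzero[OF e, where 'a='k] \<gamma>.one by (simp add: \<gamma>(2) pl_values_def)
  have "tree_norm nu n \<pi> ?\<rho> r (minor e) = 1" using minor[OF e] one by simp
  then obtain \<theta> where \<theta>: "\<theta> \<in> chart_points nu n e"
    and val: "\<And>D P. minor_poly n D P \<Longrightarrow> \<theta> (to_fr P / plucker e ^ D) = tree_norm nu n \<pi> ?\<rho> r P"
    using tree_norm_berk_point[where \<pi> = \<pi> and \<rho> = ?\<rho> and r = r, OF nu nn e] by blast
  have fib: "pl_values n e \<theta> = x"
  proof (rule extensionalityI[where A = "pairs n"])
    show "pl_values n e \<theta> \<in> extensional (pairs n)" by (simp add: pl_values_def)
    show "x \<in> extensional (pairs n)" by (simp add: \<gamma>(2) pl_values_def)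
    show "pl_values n e \<theta> m = x m" if "m \<in> pairs n" for m
      using val[OF minor_poly_minor[OF that]] minor[OF that] that by (simp add: plucker_eq pl_values_def)
  qed
  obtain z y where tree: "tree_on {1..n} z y \<pi>" using \<pi> by blast
  have "\<gamma>' f \<le> \<theta> f"
    if \<gamma>': "\<gamma>' \<in> chart_points nu n e" "pl_values n e \<gamma>' = x" and f: "f \<in> coord_ring n {e}" for \<gamma>' f
  proof -
    obtain D P where P: "minor_poly n D P" "f = to_fr P / plucker e ^ D"
      using coord_ring_eq_to_fr[OF f e] by blast
    have "\<gamma>' (to_fr P / plucker e ^ D) \<le> tree_norm nu n \<pi> (col_norm e (pl_values n e \<gamma>')) r P"
      using nn rep by (intro tree_norm_maximal[OF nu e \<gamma>'(1) tree _ _ P(1)]) (auto simp only: \<gamma>'(2))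
    then show ?thesis unfolding P(2) val[OF P(1)] \<gamma>'(2) .
  qed
  then have "is_max_point nu n e x \<theta>" using \<theta> fib by (simp add: is_max_point_def)
  then show ?thesis using val that by blast
qed

lemma is_max_point_max_point:
  assumes nu: "complete_nonarch_field nu" and e: "e \<in> pairs n"
    and x: "x \<in> pl_values n e ` chart_points nu n e"
  shows "is_max_point nu n e x (max_point nu n e x)"
proof -
  obtain \<gamma> where \<gamma>: "\<gamma> \<in> chart_points nu n e" "x = pl_values n e \<gamma>" using x by blast
  obtain \<pi> r where "\<pi> \<in> trees n" "r \<in> {1..n} \<rightarrow>\<^sub>E {0..1}" "tree_rep n e x \<pi> r"
    using tree_rep_exists_trees[OF nu e \<gamma>(1)] \<gamma>(2) by blast
  from is_max_point_tree_norm[OF nu e x this] obtain \<theta> where "is_max_point nu n e x \<theta>" by blast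
  then show ?thesis using max_point_eq[of nu n e x \<theta>] by simp
qed

lemma max_point_tree_norm:
  assumes nu: "complete_nonarch_field nu" and e: "e \<in> pairs n"
    and x: "x \<in> pl_values n e ` chart_points nu n e"
    and \<pi>: "\<pi> \<in> trees n" and r: "r \<in> {1..n} \<rightarrow>\<^sub>E {0..1}" and rep: "tree_rep n e x \<pi> r"
    and P: "minor_poly n D P"
  shows "max_point nu n e x (to_fr P / plucker e ^ D) = tree_norm nu n \<pi> (col_norm e x) r P"
  using is_max_point_tree_norm[OF nu e x \<pi> r rep] P max_point_eq by metis

abbreviation pl_topology :: "('k::field \<Rightarrow> real) \<Rightarrow> nat \<Rightarrow> nat \<times> nat \<Rightarrow> (nat \<times> nat \<Rightarrow> real) topology" where
  "pl_topology nu n e \<equiv> subtopology (product_topology (\<lambda>_. euclideanreal) (pairs n))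
     (pl_values n e ` chart_points nu n e)"

text \<open>
  The preimage of a closed set is the union over the finitely many trees of projections
  along the compact space of edge lengths.
\<close>

theorem continuous_map_max_point:
  fixes nu :: "'k::field \<Rightarrow> real"
  assumes nu: "complete_nonarch_field nu" and e: "e \<in> pairs n"
  shows "continuous_map (pl_topology nu n e) (berk_affine nu rf_const (coord_ring n {e}))
           (max_point nu n e)"
proof -
  let ?X = "pl_topology nu n e"
  let ?Y = "product_topology (\<lambda>_. top_of_set {0..1::real}) {1..n}"
  let ?Z = "prod_topology ?X ?Y"
  have topX: "topspace ?X = pl_values n e ` chart_points nu n e"
    by (auto simp: PiE_def pl_values_def)
  have topY: "topspace ?Y = {1..n} \<rightarrow>\<^sub>E {0..1}" by simp
  have Y: "compact_space ?Y"
    by (simp add: compact_space_product_topology compact_space_subtopology)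
  have coord: "continuous_map ?X euclideanreal (\<lambda>x. x m)" if "m \<in> pairs n" for m
    using that by (intro continuous_map_from_subtopology continuous_map_product_projection)
  have sym: "continuous_map ?X euclideanreal (\<lambda>x. sym_ext x k l)" if "k \<in> {1..n}" "l \<in> {1..n}" for k l
  proof (cases k l rule: linorder_cases)
    case less
    then have "(k, l) \<in> pairs n" using that by (simp add: pairs_def)
    from coord[OF this] show ?thesis using less by (simp add: sym_ext_def)
  next
    case greater
    then have "(l, k) \<in> pairs n" using that by (simp add: pairs_def)
    from coord[OF this] show ?thesis using greater by (simp add: sym_ext_def)
  qed (simp add: sym_ext_def)
  have en: "fst e \<in> {1..n}" "snd e \<in> {1..n}" using e by (auto simp: pairs_def)
  have fst: "continuous_map ?Z ?X fst" and snd: "continuous_map ?Z ?Y snd"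
    by (auto simp: continuous_map_fst continuous_map_snd)
  have col: "continuous_map ?Z euclideanreal (\<lambda>z. col_norm e (fst z) k)" if "k \<in> {1..n}" for k
    unfolding col_norm_def
    using continuous_map_compose[OF fst sym[OF that en(2)]] continuous_map_compose[OF fst sym[OF en(1) that]]
    by (intro continuous_map_real_max) (simp_all add: o_def)
  have edge: "continuous_map ?Z euclideanreal (\<lambda>z. snd z k)" if "k \<in> {1..n}" for k
  proof -
    have "continuous_map ?Y euclideanreal (\<lambda>r. r k)"
      using continuous_map_product_projection[OF that, of "\<lambda>_. top_of_set {0..1::real}"]
        continuous_map_into_fulltopology by blast
    from continuous_map_compose[OF snd this] show ?thesis by (simp add: o_def)
  qed
  have dist: "continuous_map ?Z euclideanreal (\<lambda>z. treedist (snd z) \<pi> k l)"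
    if "\<pi> k \<subseteq> {1..n}" "\<pi> l \<subseteq> {1..n}" for \<pi> k l
    unfolding treedist_def using that
    by (intro continuous_map_fmax edge) (auto intro: finite_subset)
  \<comment> \<open>Once \<open>\<pi>\<close> and \<open>P\<close> are fixed, so is the polynomial
    \<open>tree_subst \<pi> P\<close>; only the weights of its finitely many monomials vary with the
    point, and they are products of powers of radii.\<close>
  have norm: "continuous_map ?Z euclideanreal (\<lambda>z. tree_norm nu n \<pi> (col_norm e (fst z)) (snd z) P)" for \<pi> P
  proof -
    have "continuous_map ?Z euclideanreal (\<lambda>z. radius n (col_norm e (fst z)) (snd z) i)" for i
    proof (cases "i div 2 \<in> {1..n}")
      case True
      then show ?thesis using col[OF True] edge[OF True] by (cases "even i") (simp_all add: radius_def)
    next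
      case False
      then have "radius n \<rho> r i = 0" for \<rho> r unfolding radius_def by (rule if_not_P)
      then show ?thesis by simp
    qed
    then show ?thesis
      unfolding tree_norm_def gauss_def monom_eval_def
      by (intro continuous_map_fmax continuous_map_real_mult continuous_map_prod
          continuous_map_real_pow) auto
  qed
  have rep: "closedin ?Z {z \<in> topspace ?Z. tree_rep n e (fst z) \<pi> (snd z)}" if \<pi>: "\<pi> \<in> trees n" for \<pi>
  proof -
    have "closedin ?Z {z \<in> topspace ?Z. fst z (k, l) =
        col_norm e (fst z) k * col_norm e (fst z) l * treedist (snd z) \<pi> k l}"
      if m: "(k, l) \<in> pairs n" for k l
    proof -
      have kl: "k \<in> {1..n}" "l \<in> {1..n}" using m by (auto simp: pairs_def)
      have "\<pi> k \<subseteq> {1..n}" "\<pi> l \<subseteq> {1..n}" using \<pi> kl by auto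
      then show ?thesis
        using continuous_map_compose[OF fst coord[OF m]] kl
        by (intro closedin_continuous_maps_eq[of euclideanreal] continuous_map_real_mult col dist)
          (auto simp: o_def)
    qed
    then have "closedin ?Z (\<Inter>m\<in>pairs n. {z \<in> topspace ?Z. fst z m =
        col_norm e (fst z) (fst m) * col_norm e (fst z) (snd m) * treedist (snd z) \<pi> (fst m) (snd m)})"
      using e by (intro closedin_INT) auto
    also have "(\<Inter>m\<in>pairs n. {z \<in> topspace ?Z. fst z m =
        col_norm e (fst z) (fst m) * col_norm e (fst z) (snd m) * treedist (snd z) \<pi> (fst m) (snd m)})
        = {z \<in> topspace ?Z. tree_rep n e (fst z) \<pi> (snd z)}"
      using e unfolding tree_rep_def by (auto simp: case_prod_beta)
    finally show ?thesis .
  qed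
  have cont: "continuous_map ?X euclideanreal (\<lambda>x. max_point nu n e x f)" if f: "f \<in> coord_ring n {e}" for f
    unfolding continuous_map_closedin
  proof (intro conjI allI impI)
    obtain D P where P: "minor_poly n D P" "f = to_fr P / plucker e ^ D"
      using coord_ring_eq_to_fr[OF f e] by blast
    fix C :: "real set" assume C: "closedin euclidean C"
    let ?W = "\<lambda>\<pi>. {z \<in> topspace ?Z. tree_rep n e (fst z) \<pi> (snd z)} \<inter>
        {z \<in> topspace ?Z. tree_norm nu n \<pi> (col_norm e (fst z)) (snd z) P \<in> C}"
    have "closedin ?X (fst ` ?W \<pi>)" if "\<pi> \<in> trees n" for \<pi>
    proof -
      have "closedin ?Z (?W \<pi>)"
        using rep[OF that] closedin_continuous_map_preimage[OF norm C] by (intro closedin_Int)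
      then show ?thesis using closed_map_fst[OF Y, of ?X] by (simp add: closed_map_def)
    qed
    then have "closedin ?X (\<Union>\<pi>\<in>trees n. fst ` ?W \<pi>)"
      using finite_trees by (intro closedin_Union) auto
    \<comment> \<open>Independence of the tree gives the inclusion from left to right; the converse
      also uses that some tree represents \<open>x\<close>.\<close>
    also have "(\<Union>\<pi>\<in>trees n. fst ` ?W \<pi>) = {x \<in> topspace ?X. max_point nu n e x f \<in> C}"
    proof (intro equalityI subsetI)
      fix x assume "x \<in> (\<Union>\<pi>\<in>trees n. fst ` ?W \<pi>)"
      then obtain \<pi> z where \<pi>: "\<pi> \<in> trees n" and z: "z \<in> ?W \<pi>" "x = fst z" by blast
      then have "z \<in> topspace ?X \<times> topspace ?Y" by (simp only: Int_iff mem_Collect_eq topspace_prod_topology)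
      then have x: "x \<in> topspace ?X" and r: "snd z \<in> topspace ?Y" unfolding z(2) by (auto simp only: mem_Times_iff)
      have "max_point nu n e x f = tree_norm nu n \<pi> (col_norm e x) (snd z) P"
        unfolding P(2)
        by (rule max_point_tree_norm[OF nu e x[unfolded topX] \<pi> r[unfolded topY] _ P(1)]) (use z in blast)
      then show "x \<in> {x \<in> topspace ?X. max_point nu n e x f \<in> C}" using x z by simp
    next
      fix x assume "x \<in> {x \<in> topspace ?X. max_point nu n e x f \<in> C}"
      then have x: "x \<in> topspace ?X" and C: "max_point nu n e x f \<in> C" by auto
      then have xX: "x \<in> pl_values n e ` chart_points nu n e" unfolding topX by simp
      then obtain \<gamma> where "\<gamma> \<in> chart_points nu n e" "x = pl_values n e \<gamma>" by blast
      then obtain \<pi> r where pr: "\<pi> \<in> trees n" "r \<in> {1..n} \<rightarrow>\<^sub>E {0..1}" "tree_rep n e x \<pi> r"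
        using tree_rep_exists_trees[OF nu e, of \<gamma>] by blast
      have "(x, r) \<in> topspace ?Z"
        using x pr(2) unfolding topspace_prod_topology topY by (rule SigmaI)
      moreover have "tree_norm nu n \<pi> (col_norm e x) r P \<in> C"
        using max_point_tree_norm[OF nu e xX pr P(1)] C P(2) by (simp only:)
      ultimately have "(x, r) \<in> ?W \<pi>"
        using pr(3) by (simp only: Int_iff mem_Collect_eq fst_conv snd_conv)
      then have "x \<in> fst ` ?W \<pi>" by (rule image_eqI[rotated]) simp
      then show "x \<in> (\<Union>\<pi>\<in>trees n. fst ` ?W \<pi>)" using pr(1) by blast
    qed
    finally show "closedin ?X {x \<in> topspace ?X. max_point nu n e x f \<in> C}" .
  qed simp
  have mem: "max_point nu n e x \<in> chart_points nu n e" if "x \<in> topspace ?X" for x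
    using is_max_point_max_point[OF nu e, of x] that unfolding topX by (simp add: is_max_point_def)
  have "max_point nu n e x \<in> extensional (coord_ring n {e})" if "x \<in> topspace ?X" for x
    using mem[OF that] by (simp add: berk_points_def)
  then show ?thesis
    unfolding berk_affine_def continuous_map_in_subtopology continuous_map_componentwise
    using cont mem by auto
qed

lemma continuous_map_pl_values:
  assumes "e \<in> pairs n"
  shows "continuous_map (berk_affine nu rf_const (coord_ring n {e})) (pl_topology nu n e) (pl_values n e)"
proof -
  have "continuous_map (berk_affine nu rf_const (coord_ring n {e})) euclideanreal
      (\<lambda>\<gamma>. \<gamma> (plucker m / plucker e))" if "m \<in> pairs n" for m
    unfolding berk_affine_def
    by (intro continuous_map_from_subtopology continuous_map_product_projection)
      (use that in \<open>simp add: coord_ring_gen\<close>)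
  then show ?thesis
    unfolding continuous_map_in_subtopology continuous_map_componentwise
    by (auto simp: pl_values_def berk_affine_def)
qed

section \<open>Tropical projective space\<close>

text \<open>The inverse of \<open>ext_ln\<close>. The value \<open>1\<close> that results at
  \<open>\<infinity>\<close> is only a default: this point is excluded from the tropical
  line.\<close>

definition eexp :: "ereal \<Rightarrow> real" where
  "eexp y = (if y = -\<infinity> then 0 else exp (real_of_ereal y))"

lemma eexp_ext_ln: "0 \<le> r \<Longrightarrow> eexp (ext_ln r) = r"
  by (simp add: eexp_def ext_ln_def)

lemma eexp_nonneg: "0 \<le> eexp y"
  by (simp add: eexp_def)

lemma eexp_eq_0_iff: "eexp y = 0 \<longleftrightarrow> y = -\<infinity>"
  by (simp add: eexp_def)

lemma eexp_add: "y \<noteq> \<infinity> \<Longrightarrow> eexp (y + ereal c) = eexp y * exp c"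
  by (cases y) (simp_all add: eexp_def exp_add)

lemma ext_ln_not_PInf: "ext_ln r \<noteq> \<infinity>"
  by (simp add: ext_ln_def)

lemma ext_ln_divide: "\<lbrakk>0 \<le> a; 0 < b\<rbrakk> \<Longrightarrow> ext_ln (a / b) = ext_ln a + ereal (- ln b)"
  by (simp add: ext_ln_def ln_div)

text \<open>The two functions are increasing and inverse to each other. In this form strict bounds
  pass from one side to the other, which yields continuity of both in the order topologies,
  including at \<open>0\<close> and \<open>-\<infinity>\<close>.\<close>

lemma ext_ln_less_iff:
  assumes "0 \<le> r" "y \<noteq> \<infinity>"
  shows "ext_ln r < y \<longleftrightarrow> r < eexp y" "y < ext_ln r \<longleftrightarrow> eexp y < r"
proof -
  have "ln r < x \<longleftrightarrow> r < exp x" "x < ln r \<longleftrightarrow> exp x < r" if "0 < r" for x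
    using that by (metis exp_less_cancel_iff exp_ln)+
  then show "ext_ln r < y \<longleftrightarrow> r < eexp y" "y < ext_ln r \<longleftrightarrow> eexp y < r"
    using assms by (cases y; cases "r = 0"; simp add: ext_ln_def eexp_def)+
qed

lemma continuous_on_eexp: "continuous_on {y. y \<noteq> \<infinity>} eexp"
  unfolding continuous_on_def
proof (intro ballI order_tendstoI)
  fix y :: ereal and a assume y: "y \<in> {y. y \<noteq> \<infinity>}"
  have id: "((\<lambda>x. x) \<longlongrightarrow> y) (at y within {y. y \<noteq> \<infinity>})" by (rule tendsto_ident_at)
  have S: "\<forall>\<^sub>F x in at y within {y. y \<noteq> \<infinity>}. x \<noteq> \<infinity>"
    by (simp add: eventually_at_filter)
  {
    assume a: "a < eexp y"
    show "\<forall>\<^sub>F x in at y within {y. y \<noteq> \<infinity>}. a < eexp x"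
    proof (cases "a < 0")
      case True
      then show ?thesis using eexp_nonneg by (intro always_eventually allI) (rule less_le_trans)
    next
      case False
      then have "ext_ln a < y" using a y ext_ln_less_iff(1) by simp
      from order_tendstoD(1)[OF id this] S show ?thesis
        by eventually_elim (use False ext_ln_less_iff(1) in simp)
    qed
  next
    assume a: "eexp y < a"
    then have a0: "0 \<le> a" using eexp_nonneg[of y] by simp
    then have "y < ext_ln a" using a y ext_ln_less_iff(2) by simp
    from order_tendstoD(2)[OF id this] S show "\<forall>\<^sub>F x in at y within {y. y \<noteq> \<infinity>}. eexp x < a"
      by eventually_elim (use a0 ext_ln_less_iff(2) in simp)
  }
qed

lemma continuous_on_ext_ln: "continuous_on {0..} ext_ln"
  unfolding continuous_on_def
proof (intro ballI order_tendstoI)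
  fix r :: real and a assume r: "r \<in> {0..}"
  have id: "((\<lambda>x. x) \<longlongrightarrow> r) (at r within {0..})" by (rule tendsto_ident_at)
  have S: "\<forall>\<^sub>F x in at r within {0..}. 0 \<le> x" by (simp add: eventually_at_filter)
  {
    assume a: "a < ext_ln r"
    then have a0: "a \<noteq> \<infinity>" by auto
    then have "eexp a < r" using a r ext_ln_less_iff(2) by simp
    from order_tendstoD(1)[OF id this] S show "\<forall>\<^sub>F x in at r within {0..}. a < ext_ln x"
      by eventually_elim (use a0 ext_ln_less_iff(2) in simp)
  next
    assume a: "ext_ln r < a"
    show "\<forall>\<^sub>F x in at r within {0..}. ext_ln x < a"
    proof (cases "a = \<infinity>")
      case True
      then show ?thesis using ext_ln_not_PInf by (simp add: less_top)
    next
      case False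
      then have "r < eexp a" using a r ext_ln_less_iff(1) by simp
      from order_tendstoD(2)[OF id this] S show ?thesis
        by eventually_elim (use False ext_ln_less_iff(1) in simp)
    qed
  }
qed

lemma topspace_trop_affine:
  "topspace (trop_affine n) =
    {y \<in> extensional (pairs n). (\<forall>m\<in>pairs n. y m \<noteq> \<infinity>) \<and> (\<exists>m\<in>pairs n. y m \<noteq> -\<infinity>)}"
  by (auto simp: trop_affine_def PiE_def)

lemma trop_rel_iff:
  "(x, y) \<in> trop_rel n \<longleftrightarrow> x \<in> topspace (trop_affine n) \<and> y \<in> topspace (trop_affine n) \<and>
    (\<exists>c::real. \<forall>m\<in>pairs n. y m = x m + ereal c)"
  by (simp add: trop_rel_def)

lemma equiv_trop_rel: "equiv (topspace (trop_affine n)) (trop_rel n)"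
proof (rule equivI)
  show "trop_rel n \<subseteq> topspace (trop_affine n) \<times> topspace (trop_affine n)"
    by (auto simp: trop_rel_def)
  show "refl_on (topspace (trop_affine n)) (trop_rel n)"
    unfolding refl_on_def by (auto simp: trop_rel_iff intro: exI[of _ "0::real"])
  show "sym (trop_rel n)"
  proof (rule symI)
    fix x y assume "(x, y) \<in> trop_rel n"
    then obtain c :: real where xy: "x \<in> topspace (trop_affine n)" "y \<in> topspace (trop_affine n)"
      and c: "\<forall>m\<in>pairs n. y m = x m + ereal c" by (auto simp: trop_rel_iff)
    have "x m = y m + ereal (- c)" if "m \<in> pairs n" for m
      using bspec[OF c that] by (cases "x m") auto
    with xy show "(y, x) \<in> trop_rel n" unfolding trop_rel_iff by blast
  qed
  show "trans (trop_rel n)"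
  proof (rule transI)
    fix x y z assume "(x, y) \<in> trop_rel n" "(y, z) \<in> trop_rel n"
    then obtain c d :: real where xz: "x \<in> topspace (trop_affine n)" "z \<in> topspace (trop_affine n)"
      and c: "\<forall>m\<in>pairs n. y m = x m + ereal c" "\<forall>m\<in>pairs n. z m = y m + ereal d"
      unfolding trop_rel_iff by blast
    have "z m = x m + ereal (c + d)" if "m \<in> pairs n" for m
      using bspec[OF c(1) that] bspec[OF c(2) that] by (simp add: add.assoc)
    with xz show "(x, z) \<in> trop_rel n" unfolding trop_rel_iff by blast
  qed
qed

section \<open>Affine charts of tropical projective space\<close>

text \<open>Affine coordinates in multiplicative form: adding a constant to \<open>y\<close> scales
  numerator and denominator alike. These are the coordinates in which \<open>pl_values\<close> takes
  its values.\<close>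

definition trop_normalize :: "nat \<Rightarrow> nat \<times> nat \<Rightarrow> (nat \<times> nat \<Rightarrow> ereal) \<Rightarrow> nat \<times> nat \<Rightarrow> real" where
  "trop_normalize n e y = (\<lambda>m\<in>pairs n. eexp (y m) / eexp (y e))"

lemma trop_normalize_rel:
  assumes "(x, y) \<in> trop_rel n" "e \<in> pairs n"
  shows "trop_normalize n e x = trop_normalize n e y" "x e = -\<infinity> \<longleftrightarrow> y e = -\<infinity>"
proof -
  obtain c :: real where x: "x \<in> topspace (trop_affine n)"
    and c: "\<forall>m\<in>pairs n. y m = x m + ereal c" using assms(1) by (auto simp: trop_rel_iff)
  have "eexp (y m) = eexp (x m) * exp c" if "m \<in> pairs n" for m
    using c x that by (auto simp: topspace_trop_affine intro!: eexp_add)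
  then show "trop_normalize n e x = trop_normalize n e y" "x e = -\<infinity> \<longleftrightarrow> y e = -\<infinity>"
    using assms(2) by (auto simp: trop_normalize_def simp flip: eexp_eq_0_iff)
qed

lemma continuous_map_eexp_coord:
  assumes "m \<in> pairs n" shows "continuous_map (trop_affine n) euclideanreal (\<lambda>y. eexp (y m))"
proof -
  have "continuous_map (subtopology euclidean {y. y \<noteq> \<infinity>}) euclideanreal eexp"
    using continuous_on_eexp by simp
  moreover have "continuous_map (trop_affine n) (subtopology euclidean {y. y \<noteq> \<infinity>}) (\<lambda>y. y m)"
    unfolding trop_affine_def
    by (rule continuous_map_from_subtopology) (rule continuous_map_product_projection[OF assms])
  ultimately show ?thesis using continuous_map_compose[unfolded o_def] by blast
qed

definition TP_chart :: "nat \<Rightarrow> nat \<times> nat \<Rightarrow> (nat \<times> nat \<Rightarrow> ereal) set set" where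
  "TP_chart n e = {X \<in> topspace (TP n). \<forall>y\<in>X. y e \<noteq> -\<infinity>}"

lemma TP_class_in_chart:
  assumes "y \<in> topspace (trop_affine n)" "e \<in> pairs n"
  shows "trop_rel n `` {y} \<in> TP_chart n e \<longleftrightarrow> y e \<noteq> -\<infinity>"
proof -
  have "(y, y) \<in> trop_rel n" using equiv_trop_rel assms(1) by (auto simp: equiv_def refl_on_def)
  moreover have "trop_rel n `` {y} \<in> topspace (TP n)"
    using assms(1) by (auto simp: TP_def topspace_quotient_topology quotient_def)
  moreover have "z e \<noteq> -\<infinity>" if "y e \<noteq> -\<infinity>" "z \<in> trop_rel n `` {y}" for z
    using trop_normalize_rel(2)[of y z n e] that assms(2) by simp
  ultimately show ?thesis unfolding TP_chart_def by blast
qed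

lemma openin_TP_chart:
  assumes e: "e \<in> pairs n" shows "openin (TP n) (TP_chart n e)"
proof -
  have "{y \<in> topspace (trop_affine n). trop_rel n `` {y} \<in> TP_chart n e}
      = {y \<in> topspace (trop_affine n). eexp (y e) \<in> {0<..}}"
  proof (intro Collect_cong conj_cong refl)
    fix y assume y: "y \<in> topspace (trop_affine n)"
    have "eexp (y e) \<in> {0<..} \<longleftrightarrow> eexp (y e) \<noteq> 0" using eexp_nonneg[of "y e"] by auto
    then show "trop_rel n `` {y} \<in> TP_chart n e \<longleftrightarrow> eexp (y e) \<in> {0<..}"
      using TP_class_in_chart[OF y e] by (simp add: eexp_eq_0_iff)
  qed
  moreover have "openin (trop_affine n) {y \<in> topspace (trop_affine n). eexp (y e) \<in> {0<..}}"
    by (rule openin_continuous_map_preimage[OF continuous_map_eexp_coord[OF e]]) simp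
  moreover have "TP_chart n e \<subseteq> topspace (trop_affine n) // trop_rel n"
    by (auto simp: TP_chart_def TP_def topspace_quotient_topology)
  ultimately show ?thesis by (simp add: TP_def openin_quotient_topology)
qed

definition TP_coords :: "nat \<Rightarrow> nat \<times> nat \<Rightarrow> (nat \<times> nat \<Rightarrow> ereal) set \<Rightarrow> nat \<times> nat \<Rightarrow> real" where
  "TP_coords n e X = the_elem (trop_normalize n e ` X)"

lemma TP_coords_class:
  assumes "y \<in> topspace (trop_affine n)" "e \<in> pairs n"
  shows "TP_coords n e (trop_rel n `` {y}) = trop_normalize n e y"
proof -
  have "y \<in> trop_rel n `` {y}" by (rule equiv_class_self[OF equiv_trop_rel assms(1)])
  then have ne: "trop_rel n `` {y} \<noteq> {}" by (rule ex_in_conv[THEN iffD1, OF exI])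
  have "trop_normalize n e z = trop_normalize n e y" if "z \<in> trop_rel n `` {y}" for z
    using trop_normalize_rel(1)[of y z n e] that assms(2) by simp
  then show ?thesis unfolding TP_coords_def by (rule the_elem_image_unique[OF ne])
qed

text \<open>A quotient map restricted to the preimage of an open set is again a quotient map, so
  continuity can be tested on vectors, where the denominator \<open>eexp (y e)\<close> is
  nonzero.\<close>

lemma continuous_map_TP_coords:
  assumes e: "e \<in> pairs n"
  shows "continuous_map (subtopology (TP n) (TP_chart n e))
    (product_topology (\<lambda>_. euclideanreal) (pairs n)) (TP_coords n e)"
proof -
  let ?V = "{y \<in> topspace (trop_affine n). trop_rel n `` {y} \<in> TP_chart n e}"
  have q: "quotient_map (subtopology (trop_affine n) ?V) (subtopology (TP n) (TP_chart n e))
      (\<lambda>y. trop_rel n `` {y})"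
    by (rule quotient_map_restriction[OF _ refl])
      (use openin_TP_chart[OF e] in \<open>auto simp: TP_def quotient_map_quotient_topology\<close>)
  have "continuous_map (subtopology (trop_affine n) ?V) euclideanreal (\<lambda>y. eexp (y m) / eexp (y e))"
    if "m \<in> pairs n" for m
    using TP_class_in_chart[OF _ e]
    by (intro continuous_map_real_divide continuous_map_from_subtopology continuous_map_eexp_coord that e)
      (auto simp: eexp_eq_0_iff)
  then have "continuous_map (subtopology (trop_affine n) ?V) (product_topology (\<lambda>_. euclideanreal) (pairs n))
      (trop_normalize n e)"
    unfolding continuous_map_componentwise by (auto simp: trop_normalize_def)
  then have "continuous_map (subtopology (trop_affine n) ?V) (product_topology (\<lambda>_. euclideanreal) (pairs n))
      (TP_coords n e \<circ> (\<lambda>y. trop_rel n `` {y}))"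
    by (rule continuous_map_eq) (auto simp: TP_coords_class[OF _ e])
  then show ?thesis using continuous_compose_quotient_map_eq[OF q] by blast
qed

section \<open>The section\<close>

definition trop_vector :: "nat \<Rightarrow> nat \<times> nat \<Rightarrow> ('k::field ratfun \<Rightarrow> real) \<Rightarrow> nat \<times> nat \<Rightarrow> ereal" where
  "trop_vector n i \<gamma> = (\<lambda>m\<in>pairs n. ext_ln (\<gamma> (plucker m / plucker i)))"

abbreviation Gr_class ::
    "('k::field \<Rightarrow> real) \<Rightarrow> nat \<Rightarrow> (nat \<times> nat) \<times> ('k ratfun \<Rightarrow> real) \<Rightarrow> ((nat \<times> nat) \<times> ('k ratfun \<Rightarrow> real)) set"
  where "Gr_class nu n x \<equiv> chart_glue nu n `` {x}"

abbreviation Gr_charts :: "('k::field \<Rightarrow> real) \<Rightarrow> nat \<Rightarrow> ((nat \<times> nat) \<times> ('k ratfun \<Rightarrow> real)) topology" where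
  "Gr_charts nu n \<equiv> sum_topology (\<lambda>i. berk_affine nu rf_const (coord_ring n {i})) (pairs n)"

lemma topspace_berk_affine: "topspace (berk_affine nu \<iota> A) = berk_points nu \<iota> A"
  by (auto simp: berk_affine_def berk_points_def PiE_def)

context
  fixes nu :: "'k::field \<Rightarrow> real" and n :: nat
  assumes nu: "complete_nonarch_field nu"
begin

section \<open>Tropicalization in the charts\<close>

lemma pl_nonneg:
  assumes \<gamma>: "\<gamma> \<in> chart_points nu n i" and m: "m \<in> pairs n"
  shows "0 \<le> \<gamma> (plucker m / plucker i)"
  using ultra_seminorm.nonneg[OF berk_point_ultra[OF nu \<gamma>]] m by (simp add: coord_ring_gen)

lemma pl_self:
  assumes \<gamma>: "\<gamma> \<in> chart_points nu n i" and i: "i \<in> pairs n"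
  shows "\<gamma> (plucker i / plucker i) = 1"
  using ultra_seminorm.one[OF berk_point_ultra[OF nu \<gamma>]] plucker_nonzero[OF i, where 'a='k] by simp

lemma trop_vector_mem:
  assumes \<gamma>: "\<gamma> \<in> chart_points nu n i" and i: "i \<in> pairs n"
  shows "trop_vector n i \<gamma> \<in> topspace (trop_affine n)"
  using pl_self[OF assms] i ext_ln_not_PInf
  by (auto simp: topspace_trop_affine trop_vector_def ext_ln_def intro!: bexI[of _ i])

lemma trop_vector_normalize:
  assumes \<gamma>: "\<gamma> \<in> chart_points nu n e" and e: "e \<in> pairs n"
  shows "trop_normalize n e (trop_vector n e \<gamma>) = pl_values n e \<gamma>"
  using pl_nonneg[OF \<gamma>] pl_self[OF \<gamma> e] e
  by (auto simp: trop_normalize_def trop_vector_def pl_values_def eexp_ext_ln intro!: restrict_ext)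

lemma trop_vector_change_chart:
  assumes \<gamma>: "\<gamma> \<in> chart_points nu n i" and i: "i \<in> pairs n"
    and j: "j \<in> pairs n" and nz: "\<gamma> (plucker j / plucker i) \<noteq> 0"
  shows "(trop_vector n i \<gamma>, trop_vector n j (change_chart n i j \<gamma>)) \<in> trop_rel n"
  unfolding trop_rel_iff
proof (intro conjI exI ballI)
  show "trop_vector n i \<gamma> \<in> topspace (trop_affine n)"
    "trop_vector n j (change_chart n i j \<gamma>) \<in> topspace (trop_affine n)"
    using assms by (auto intro!: trop_vector_mem change_chart_point nu)
  show "trop_vector n j (change_chart n i j \<gamma>) m = trop_vector n i \<gamma> m + ereal (- ln (\<gamma> (plucker j / plucker i)))"
    if "m \<in> pairs n" for m
    using ext_ln_divide[OF pl_nonneg[OF \<gamma> that], of "\<gamma> (plucker j / plucker i)"]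
      pl_nonneg[OF \<gamma> j] nz that change_chart_plucker[OF nu \<gamma> i j nz that]
    by (simp add: trop_vector_def)
qed

text \<open>Justifies the use of \<open>the_elem\<close> in \<open>trop\<close>: other
  representatives arise by changing the chart, which only translates the tropical vector.\<close>

lemma trop_Gr_class:
  assumes \<gamma>: "\<gamma> \<in> chart_points nu n i" and i: "i \<in> pairs n"
  shows "trop n (Gr_class nu n (i, \<gamma>)) = trop_rel n `` {trop_vector n i \<gamma>}"
proof -
  have const: "chart_trop n (j, \<gamma>') = trop_rel n `` {trop_vector n i \<gamma>}"
    if "((i, \<gamma>), (j, \<gamma>')) \<in> chart_glue nu n" for j \<gamma>'
  proof -
    have j: "j \<in> pairs n" "\<gamma> (plucker j / plucker i) \<noteq> 0" and eq: "\<gamma>' = change_chart n i j \<gamma>"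
      using that chart_glue_iff[OF nu \<gamma> i] by auto
    show ?thesis
      using equiv_class_eq[OF equiv_trop_rel trop_vector_change_chart[OF \<gamma> i j]]
      by (simp add: chart_trop_def eq trop_vector_def)
  qed
  have refl_rel: "((i, \<gamma>), (i, \<gamma>)) \<in> chart_glue nu n" by (rule chart_glue_refl[OF nu \<gamma> i])
  then have mem: "(i, \<gamma>) \<in> Gr_class nu n (i, \<gamma>)" by simp
  have "chart_trop n x = chart_trop n (i, \<gamma>)" if "x \<in> Gr_class nu n (i, \<gamma>)" for x
  proof -
    obtain j \<gamma>' where x: "x = (j, \<gamma>')" by (cases x)
    have "((i, \<gamma>), (j, \<gamma>')) \<in> chart_glue nu n" using that x by simp
    then show ?thesis using const const[OF refl_rel] x by simp
  qed
  moreover have "Gr_class nu n (i, \<gamma>) \<noteq> {}" by (rule ex_in_conv[THEN iffD1, OF exI, OF mem])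
  ultimately have "trop n (Gr_class nu n (i, \<gamma>)) = chart_trop n (i, \<gamma>)"
    unfolding trop_def by (rule the_elem_image_unique[rotated])
  then show ?thesis using const[OF refl_rel] by simp
qed

lemma topspace_Gr_charts: "topspace (Gr_charts nu n) = Sigma (pairs n) (chart_points nu n)"
  by (auto simp: topspace_berk_affine)

lemma topspace_Gr_an: "topspace (Gr_an nu n) = Gr_class nu n ` Sigma (pairs n) (chart_points nu n)"
  unfolding Gr_an_def topspace_quotient_topology topspace_Gr_charts by (auto simp: quotient_def)

lemma Gr_class_quotient_map: "quotient_map (Gr_charts nu n) (Gr_an nu n) (Gr_class nu n)"
  unfolding Gr_an_def by (rule quotient_map_quotient_topology)

lemma continuous_map_trop: "continuous_map (Gr_an nu n) (TP n) (trop n)"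
proof -
  have vec: "continuous_map (berk_affine nu rf_const (coord_ring n {i})) (trop_affine n) (trop_vector n i)"
    if i: "i \<in> pairs n" for i
  proof -
    have "continuous_map (berk_affine nu rf_const (coord_ring n {i})) (subtopology euclidean {x. x \<noteq> \<infinity>})
        (\<lambda>\<gamma>. ext_ln (\<gamma> (plucker m / plucker i)))" if m: "m \<in> pairs n" for m
    proof -
      have "continuous_map (berk_affine nu rf_const (coord_ring n {i})) (top_of_set {0..})
          (\<lambda>\<gamma>. \<gamma> (plucker m / plucker i))"
        unfolding continuous_map_in_subtopology
      proof
        show "continuous_map (berk_affine nu rf_const (coord_ring n {i})) euclideanreal
            (\<lambda>\<gamma>. \<gamma> (plucker m / plucker i))"
          unfolding berk_affine_def
          by (intro continuous_map_from_subtopology continuous_map_product_projection)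
            (use m in \<open>simp add: coord_ring_gen\<close>)
      qed (use pl_nonneg m in \<open>auto simp: topspace_berk_affine\<close>)
      moreover have "continuous_map (top_of_set {0..}) (subtopology euclidean {x. x \<noteq> \<infinity>}) ext_ln"
        using continuous_on_ext_ln ext_ln_not_PInf by (auto simp: continuous_map_in_subtopology)
      ultimately show ?thesis using continuous_map_compose[unfolded o_def] by blast
    qed
    then have "continuous_map (berk_affine nu rf_const (coord_ring n {i}))
        (product_topology (\<lambda>_. subtopology euclidean {x. x \<noteq> \<infinity>}) (pairs n)) (trop_vector n i)"
      unfolding continuous_map_componentwise by (auto simp: trop_vector_def)
    then show ?thesis
      unfolding trop_affine_def continuous_map_in_subtopology
      using trop_vector_mem[OF _ i] by (auto simp: topspace_berk_affine topspace_trop_affine)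
  qed
  have "continuous_map (Gr_charts nu n) (TP n) (trop n \<circ> Gr_class nu n)"
    unfolding continuous_map_def
  proof (intro conjI allI impI)
    have TPc: "continuous_map (trop_affine n) (TP n) (\<lambda>y. trop_rel n `` {y})"
      unfolding TP_def by (rule quotient_imp_continuous_map[OF quotient_map_quotient_topology])
    have comp: "continuous_map (berk_affine nu rf_const (coord_ring n {i})) (TP n)
        (\<lambda>\<gamma>. trop_rel n `` {trop_vector n i \<gamma>})" if "i \<in> pairs n" for i
      using continuous_map_compose[OF vec[OF that] TPc] by (simp add: o_def)
    show "trop n \<circ> Gr_class nu n \<in> topspace (Gr_charts nu n) \<rightarrow> topspace (TP n)"
      using continuous_map_funspace[OF comp] trop_Gr_class
      unfolding topspace_Gr_charts topspace_berk_affine by (fastforce simp: Pi_iff)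
    fix U assume U: "openin (TP n) U"
    show "openin (Gr_charts nu n) {x \<in> topspace (Gr_charts nu n). (trop n \<circ> Gr_class nu n) x \<in> U}"
      unfolding openin_sum_topology topspace_Gr_charts
    proof (intro conjI ballI)
      fix i assume i: "i \<in> pairs n"
      have "{\<gamma>. (i, \<gamma>) \<in> {x \<in> Sigma (pairs n) (chart_points nu n). (trop n \<circ> Gr_class nu n) x \<in> U}}
          = {\<gamma> \<in> topspace (berk_affine nu rf_const (coord_ring n {i})). trop_rel n `` {trop_vector n i \<gamma>} \<in> U}"
        using i trop_Gr_class[OF _ i] by (auto simp: topspace_berk_affine)
      then show "openin (berk_affine nu rf_const (coord_ring n {i}))
          {\<gamma>. (i, \<gamma>) \<in> {x \<in> Sigma (pairs n) (chart_points nu n). (trop n \<circ> Gr_class nu n) x \<in> U}}"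
        using openin_continuous_map_preimage[OF comp[OF i] U] by simp
    qed (auto simp: topspace_berk_affine)
  qed
  then show ?thesis using continuous_compose_quotient_map_eq[OF Gr_class_quotient_map] by blast
qed

lemma topspace_TGr: "topspace (TGr nu n) = trop n ` topspace (Gr_an nu n)"
  using continuous_map_image_subset_topspace[OF continuous_map_trop]
  by (auto simp: TGr_def)

lemma TGr_cases:
  assumes "X \<in> topspace (TGr nu n)"
  obtains i \<gamma> where "i \<in> pairs n" "\<gamma> \<in> chart_points nu n i" "X = trop n (Gr_class nu n (i, \<gamma>))"
proof -
  obtain p where "p \<in> Sigma (pairs n) (chart_points nu n)" "X = trop n (Gr_class nu n p)"
    using assms[unfolded topspace_TGr topspace_Gr_an] by (elim imageE) simp
  then show ?thesis using that[of "fst p" "snd p"] by (cases p) simp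
qed

text \<open>A finite coordinate \<open>e\<close> of the tropicalization means that
  \<open>plucker e\<close> does not vanish at the point above, which can therefore be moved to the
  chart \<open>e\<close>.\<close>

lemma TGr_point_in_chart:
  assumes X: "X \<in> topspace (TGr nu n)" and e: "e \<in> pairs n" and Xe: "X \<in> TP_chart n e"
  obtains \<gamma> where "\<gamma> \<in> chart_points nu n e" "X = trop n (Gr_class nu n (e, \<gamma>))"
    "TP_coords n e X = pl_values n e \<gamma>"
proof -
  obtain i \<gamma> where i: "i \<in> pairs n" and \<gamma>: "\<gamma> \<in> chart_points nu n i" and X: "X = trop n (Gr_class nu n (i, \<gamma>))"
    by (rule TGr_cases[OF X])
  have "trop_vector n i \<gamma> e \<noteq> -\<infinity>"
    using Xe TP_class_in_chart[OF trop_vector_mem[OF \<gamma> i] e] unfolding X trop_Gr_class[OF \<gamma> i] by simp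
  then have nz: "\<gamma> (plucker e / plucker i) \<noteq> 0" using e by (auto simp: trop_vector_def ext_ln_def)
  let ?\<gamma> = "change_chart n i e \<gamma>"
  have p: "?\<gamma> \<in> chart_points nu n e" by (rule change_chart_point[OF nu \<gamma> i e nz])
  have "((i, \<gamma>), (e, ?\<gamma>)) \<in> chart_glue nu n" using chart_glue_iff[OF nu \<gamma> i] e nz by simp
  then have X': "X = trop n (Gr_class nu n (e, ?\<gamma>))" using X chart_glue_class_eq[OF nu] by simp
  have "TP_coords n e X = pl_values n e ?\<gamma>"
    unfolding X' trop_Gr_class[OF p e] TP_coords_class[OF trop_vector_mem[OF p e] e]
    by (rule trop_vector_normalize[OF p e])
  with p X' show ?thesis by (rule that)
qed

lemma trop_in_TP_chart:
  assumes "\<gamma> \<in> chart_points nu n e" "e \<in> pairs n"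
  shows "trop n (Gr_class nu n (e, \<gamma>)) \<in> TP_chart n e"
  unfolding trop_Gr_class[OF assms] TP_class_in_chart[OF trop_vector_mem[OF assms] assms(2)]
  using pl_self[OF assms] assms(2) by (simp add: trop_vector_def ext_ln_def)

section \<open>Glueing the local sections\<close>

text \<open>A change of chart matches the two fibres, and its effect on a form of degree
  \<open>D\<close> is a positive factor common to the whole fibre. Hence the greatest point of one
  fibre goes to the greatest point of the other.\<close>

lemma max_point_change_chart:
  assumes e: "e \<in> pairs n" and j: "j \<in> pairs n" and \<gamma>: "\<gamma> \<in> chart_points nu n e"
    and nz: "\<gamma> (plucker j / plucker e) \<noteq> 0"
  defines "\<theta> \<equiv> max_point nu n e (pl_values n e \<gamma>)"
  shows "max_point nu n j (pl_values n j (change_chart n e j \<gamma>)) = change_chart n e j \<theta>"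
    and "\<theta> (plucker j / plucker e) \<noteq> 0"
proof -
  have max: "is_max_point nu n e (pl_values n e \<gamma>) \<theta>"
    unfolding \<theta>_def by (rule is_max_point_max_point[OF nu e]) (use \<gamma> in blast)
  then have \<theta>: "\<theta> \<in> chart_points nu n e" and val: "pl_values n e \<theta> = pl_values n e \<gamma>"
    by (auto simp: is_max_point_def)
  have val': "\<theta> (plucker m / plucker e) = \<gamma> (plucker m / plucker e)" if "m \<in> pairs n" for m
    using fun_cong[OF val, of m] that by (simp add: pl_values_def)
  show nz': "\<theta> (plucker j / plucker e) \<noteq> 0" using val'[OF j] nz by simp
  have pos: "0 < \<gamma> (plucker j / plucker e)" using pl_nonneg[OF \<gamma> j] nz by simp
  \<comment> \<open>A competitor in the chart \<open>j\<close> is moved back to the chart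
    \<open>e\<close>, where it lands in the fibre in which \<open>\<theta>\<close> is
    greatest.\<close>
  have back_eq: "pl_values n e (change_chart n j e \<gamma>') = pl_values n e \<gamma>"
    "\<gamma>' (plucker e / plucker j) = 1 / \<gamma> (plucker j / plucker e)"
    if \<gamma>': "\<gamma>' \<in> chart_points nu n j" "pl_values n j \<gamma>' = pl_values n j (change_chart n e j \<gamma>)" for \<gamma>'
  proof -
    have v: "\<gamma>' (plucker m / plucker j) = \<gamma> (plucker m / plucker e) / \<gamma> (plucker j / plucker e)"
      if "m \<in> pairs n" for m
      using fun_cong[OF \<gamma>'(2), of m] that change_chart_plucker[OF nu \<gamma> e j nz that]
      by (simp add: pl_values_def)
    show 1: "\<gamma>' (plucker e / plucker j) = 1 / \<gamma> (plucker j / plucker e)"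
      using v[OF e] pl_self[OF \<gamma> e] by simp
    then have "change_chart n j e \<gamma>' (plucker m / plucker e) = \<gamma> (plucker m / plucker e)"
      if "m \<in> pairs n" for m
      using change_chart_plucker[OF nu \<gamma>'(1) j e _ that] v[OF that] pos by simp
    then show "pl_values n e (change_chart n j e \<gamma>') = pl_values n e \<gamma>"
      unfolding pl_values_def by (intro restrict_ext) auto
  qed
  have "is_max_point nu n j (pl_values n j (change_chart n e j \<gamma>)) (change_chart n e j \<theta>)"
    unfolding is_max_point_def
  proof (intro conjI ballI impI)
    show "change_chart n e j \<theta> \<in> chart_points nu n j" by (rule change_chart_point[OF nu \<theta> e j nz'])
    show "pl_values n j (change_chart n e j \<theta>) = pl_values n j (change_chart n e j \<gamma>)"
      unfolding pl_values_def
      using change_chart_plucker[OF nu \<theta> e j nz'] change_chart_plucker[OF nu \<gamma> e j nz] val' j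
      by (intro restrict_ext) auto
    fix \<gamma>' and f :: "'k ratfun"
    assume \<gamma>': "\<gamma>' \<in> chart_points nu n j" "pl_values n j \<gamma>' = pl_values n j (change_chart n e j \<gamma>)"
      and f: "f \<in> coord_ring n {j}"
    note b = back_eq[OF \<gamma>']
    have nzj: "\<gamma>' (plucker e / plucker j) \<noteq> 0" using b(2) pos by simp
    obtain D P where P: "minor_poly n D P" "f = to_fr P / plucker j ^ D"
      using coord_ring_eq_to_fr[OF f j] by blast
    have "\<gamma>' (to_fr P / plucker j ^ D) / (1 / \<gamma> (plucker j / plucker e)) ^ D
        = change_chart n j e \<gamma>' (to_fr P / plucker e ^ D)"
      using change_chart_eval[OF nu \<gamma>'(1) j e nzj P(1)] b(2) by simp
    also have "\<dots> \<le> \<theta> (to_fr P / plucker e ^ D)"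
      using max change_chart_point[OF nu \<gamma>'(1) j e nzj] b(1) coord_ring_to_fr[OF P(1) e]
      unfolding is_max_point_def by blast
    finally have "\<gamma>' (to_fr P / plucker j ^ D) \<le> \<theta> (to_fr P / plucker e ^ D) / \<gamma> (plucker j / plucker e) ^ D"
      using pos by (simp add: power_one_over pos_le_divide_eq)
    also have "\<dots> = change_chart n e j \<theta> (to_fr P / plucker j ^ D)"
      using change_chart_eval[OF nu \<theta> e j nz' P(1)] val'[OF j] by simp
    finally show "\<gamma>' f \<le> change_chart n e j \<theta> f" unfolding P(2) .
  qed
  then show "max_point nu n j (pl_values n j (change_chart n e j \<gamma>)) = change_chart n e j \<theta>"
    by (rule max_point_eq)
qed

definition chart_section :: "nat \<times> nat \<Rightarrow> (nat \<times> nat \<Rightarrow> ereal) set \<Rightarrow> ((nat \<times> nat) \<times> ('k ratfun \<Rightarrow> real)) set" where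
  "chart_section e X = Gr_class nu n (e, max_point nu n e (TP_coords n e X))"

lemma continuous_map_chart_section:
  assumes e: "e \<in> pairs n"
  shows "continuous_map (subtopology (TGr nu n) (topspace (TGr nu n) \<inter> TP_chart n e)) (Gr_an nu n) (chart_section e)"
proof -
  let ?T = "topspace (TGr nu n) \<inter> TP_chart n e"
  have sub: "subtopology (TGr nu n) ?T = subtopology (subtopology (TP n) (TP_chart n e)) ?T"
    unfolding TGr_def topspace_TGr[unfolded TGr_def]
    by (simp add: subtopology_subtopology Int_ac)
  have "continuous_map (subtopology (TGr nu n) ?T) (product_topology (\<lambda>_. euclideanreal) (pairs n)) (TP_coords n e)"
    unfolding sub by (rule continuous_map_from_subtopology[OF continuous_map_TP_coords[OF e]])
  moreover have "TP_coords n e X \<in> pl_values n e ` chart_points nu n e" if "X \<in> ?T" for X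
    using that TGr_point_in_chart[of X e] e by (metis IntD1 IntD2 imageI)
  ultimately have "continuous_map (subtopology (TGr nu n) ?T) (pl_topology nu n e) (TP_coords n e)"
    unfolding continuous_map_in_subtopology by auto
  from continuous_map_compose[OF this continuous_map_max_point[OF nu e]]
  have "continuous_map (subtopology (TGr nu n) ?T) (berk_affine nu rf_const (coord_ring n {e}))
      (max_point nu n e \<circ> TP_coords n e)" .
  from continuous_map_compose[OF continuous_map_compose[OF this
        continuous_map_component_injection[where X = "\<lambda>i. berk_affine nu rf_const (coord_ring n {i})", OF e]]
      quotient_imp_continuous_map[OF Gr_class_quotient_map]]
  show ?thesis by (simp add: o_def chart_section_def[abs_def])
qed

lemma chart_section_unique:
  assumes X: "X \<in> topspace (TGr nu n)" and e: "e \<in> pairs n" "X \<in> TP_chart n e"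
    and j: "j \<in> pairs n" "X \<in> TP_chart n j"
  shows "chart_section e X = chart_section j X"
proof -
  obtain \<gamma> where \<gamma>: "\<gamma> \<in> chart_points nu n e" and Xg: "X = trop n (Gr_class nu n (e, \<gamma>))"
    and ce: "TP_coords n e X = pl_values n e \<gamma>"
    using TGr_point_in_chart[OF X e] by blast
  have "trop_vector n e \<gamma> j \<noteq> -\<infinity>"
    using j(2) TP_class_in_chart[OF trop_vector_mem[OF \<gamma> e(1)] j(1)] unfolding Xg trop_Gr_class[OF \<gamma> e(1)] by simp
  then have nz: "\<gamma> (plucker j / plucker e) \<noteq> 0" using j(1) by (auto simp: trop_vector_def ext_ln_def)
  let ?\<gamma> = "change_chart n e j \<gamma>" and ?\<theta> = "max_point nu n e (pl_values n e \<gamma>)"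
  have p: "?\<gamma> \<in> chart_points nu n j" by (rule change_chart_point[OF nu \<gamma> e(1) j(1) nz])
  have "TP_coords n j X = trop_normalize n j (trop_vector n e \<gamma>)"
    unfolding Xg trop_Gr_class[OF \<gamma> e(1)] by (rule TP_coords_class[OF trop_vector_mem[OF \<gamma> e(1)] j(1)])
  also have "\<dots> = pl_values n j ?\<gamma>"
    using trop_normalize_rel(1)[OF trop_vector_change_chart[OF \<gamma> e(1) j(1) nz] j(1)]
      trop_vector_normalize[OF p j(1)] by simp
  finally have cj: "TP_coords n j X = pl_values n j ?\<gamma>" .
  have "is_max_point nu n e (pl_values n e \<gamma>) ?\<theta>"
    by (rule is_max_point_max_point[OF nu e(1)]) (use \<gamma> in blast)
  then have \<theta>: "?\<theta> \<in> chart_points nu n e" by (simp add: is_max_point_def)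
  note m = max_point_change_chart[OF e(1) j(1) \<gamma> nz]
  have "((e, ?\<theta>), (j, change_chart n e j ?\<theta>)) \<in> chart_glue nu n"
    using chart_glue_iff[OF nu \<theta> e(1)] j(1) m(2) by simp
  then show ?thesis
    unfolding chart_section_def ce cj m(1) by (rule chart_glue_class_eq[OF nu])
qed

lemma trop_chart_section:
  assumes X: "X \<in> topspace (TGr nu n)" and e: "e \<in> pairs n" "X \<in> TP_chart n e"
  shows "trop n (chart_section e X) = X"
proof -
  obtain \<gamma> where \<gamma>: "\<gamma> \<in> chart_points nu n e" and Xg: "X = trop n (Gr_class nu n (e, \<gamma>))"
    and ce: "TP_coords n e X = pl_values n e \<gamma>"
    using TGr_point_in_chart[OF X e] by blast
  let ?\<theta> = "max_point nu n e (pl_values n e \<gamma>)"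
  have "is_max_point nu n e (pl_values n e \<gamma>) ?\<theta>"
    by (rule is_max_point_max_point[OF nu e(1)]) (use \<gamma> in blast)
  then have \<theta>: "?\<theta> \<in> chart_points nu n e" and val: "pl_values n e ?\<theta> = pl_values n e \<gamma>"
    by (auto simp: is_max_point_def)
  have "trop_vector n e ?\<theta> = trop_vector n e \<gamma>"
    unfolding trop_vector_def
  proof (rule restrict_ext)
    fix m assume "m \<in> pairs n"
    then show "ext_ln (?\<theta> (plucker m / plucker e)) = ext_ln (\<gamma> (plucker m / plucker e))"
      using fun_cong[OF val, of m] by (simp add: pl_values_def)
  qed
  then have "trop n (Gr_class nu n (e, ?\<theta>)) = X"
    unfolding Xg trop_Gr_class[OF \<theta> e(1)] trop_Gr_class[OF \<gamma> e(1)] by (simp only:)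
  then show ?thesis unfolding chart_section_def ce .
qed

text \<open>Pasting over the open cover by charts. The formula on each chart is kept because
  closedness of the image is checked chart by chart.\<close>

lemma continuous_section_exists:
  obtains \<sigma> where "continuous_map (TGr nu n) (Gr_an nu n) \<sigma>"
    "\<And>X e. \<lbrakk>e \<in> pairs n; X \<in> topspace (TGr nu n); X \<in> TP_chart n e\<rbrakk> \<Longrightarrow> \<sigma> X = chart_section e X"
proof -
  have cover: "\<exists>e\<in>pairs n. X \<in> TP_chart n e" if X: "X \<in> topspace (TGr nu n)" for X
  proof -
    obtain i \<gamma> where "i \<in> pairs n" "\<gamma> \<in> chart_points nu n i" "X = trop n (Gr_class nu n (i, \<gamma>))"
      by (rule TGr_cases[OF X])
    then show ?thesis using trop_in_TP_chart by blast
  qed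
  have ope: "openin (TGr nu n) (topspace (TGr nu n) \<inter> TP_chart n e)" if "e \<in> pairs n" for e
    unfolding TGr_def topspace_TGr[unfolded TGr_def]
    using openin_subtopology_Int2[OF openin_TP_chart[OF that]] by blast
  let ?T = "\<lambda>e. topspace (TGr nu n) \<inter> TP_chart n e"
  have cov: "topspace (TGr nu n) \<subseteq> (\<Union>e\<in>pairs n. ?T e)" using cover by blast
  have agree: "chart_section e X = chart_section j X"
    if "e \<in> pairs n" "j \<in> pairs n" "X \<in> topspace (TGr nu n) \<inter> ?T e \<inter> ?T j" for e j X
    using that chart_section_unique[of X e j] by blast
  show ?thesis
  proof (rule pasting_lemma_exists[where X = "TGr nu n" and Y = "Gr_an nu n" and I = "pairs n" and T = ?T
        and f = chart_section, OF cov ope continuous_map_chart_section agree])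
    fix g assume g: "continuous_map (TGr nu n) (Gr_an nu n) g"
      "\<And>X e. \<lbrakk>e \<in> pairs n; X \<in> topspace (TGr nu n) \<inter> ?T e\<rbrakk> \<Longrightarrow> g X = chart_section e X"
    show ?thesis by (rule that[OF g(1)]) (use g(2) in simp)
  qed
qed

text \<open>In the quotient topology closedness is tested on the charts. The only possible preimage
  of a point under \<open>\<sigma>\<close> is its own tropicalization, so the point lies in the
  image exactly if it is the greatest one of its fibre.\<close>

lemma closedin_section_image:
  assumes \<sigma>: "continuous_map (TGr nu n) (Gr_an nu n) \<sigma>"
    and eq: "\<And>X e. \<lbrakk>e \<in> pairs n; X \<in> topspace (TGr nu n); X \<in> TP_chart n e\<rbrakk> \<Longrightarrow> \<sigma> X = chart_section e X"
    and inv: "\<And>X. X \<in> topspace (TGr nu n) \<Longrightarrow> trop n (\<sigma> X) = X"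
  shows "closedin (Gr_an nu n) (\<sigma> ` topspace (TGr nu n))"
proof -
  let ?C = "\<sigma> ` topspace (TGr nu n)"
  have iff: "Gr_class nu n (i, \<gamma>) \<in> ?C \<longleftrightarrow> \<gamma> = max_point nu n i (pl_values n i \<gamma>)"
    if i: "i \<in> pairs n" and \<gamma>: "\<gamma> \<in> chart_points nu n i" for i \<gamma>
  proof -
    let ?X = "trop n (Gr_class nu n (i, \<gamma>))"
    have X: "?X \<in> topspace (TGr nu n)" unfolding topspace_TGr topspace_Gr_an using i \<gamma> by (intro imageI SigmaI)
    have "TP_coords n i ?X = pl_values n i \<gamma>"
      unfolding trop_Gr_class[OF \<gamma> i] TP_coords_class[OF trop_vector_mem[OF \<gamma> i] i]
      by (rule trop_vector_normalize[OF \<gamma> i])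
    then have \<sigma>X: "\<sigma> ?X = Gr_class nu n (i, max_point nu n i (pl_values n i \<gamma>))"
      using eq[OF i X trop_in_TP_chart[OF \<gamma> i]] by (simp add: chart_section_def)
    have "is_max_point nu n i (pl_values n i \<gamma>) (max_point nu n i (pl_values n i \<gamma>))"
      by (rule is_max_point_max_point[OF nu i]) (use \<gamma> in blast)
    then have \<theta>: "max_point nu n i (pl_values n i \<gamma>) \<in> chart_points nu n i" by (simp add: is_max_point_def)
    show ?thesis
    proof
      assume "Gr_class nu n (i, \<gamma>) \<in> ?C"
      then obtain X where "X \<in> topspace (TGr nu n)" and X_eq: "Gr_class nu n (i, \<gamma>) = \<sigma> X" by (elim imageE)
      then have "X = ?X" using inv[of X] by (simp only:)
      then have "Gr_class nu n (i, \<gamma>) = \<sigma> ?X" using X_eq by (simp only:)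
      then show "\<gamma> = max_point nu n i (pl_values n i \<gamma>)"
        unfolding \<sigma>X by (rule chart_glue_class_inj[OF nu \<gamma> \<theta> i])
    next
      assume "\<gamma> = max_point nu n i (pl_values n i \<gamma>)"
      then have "Gr_class nu n (i, \<gamma>) = \<sigma> ?X" using \<sigma>X by simp
      then show "Gr_class nu n (i, \<gamma>) \<in> ?C" using X by (rule image_eqI)
    qed
  qed
  define C where "C = ?C"
  note iff = iff[folded C_def]
  have "closedin (Gr_charts nu n) {x \<in> topspace (Gr_charts nu n). Gr_class nu n x \<in> C}"
    unfolding closedin_sum_topology topspace_Gr_charts
  proof (intro conjI ballI)
    fix i assume i: "i \<in> pairs n"
    let ?B = "berk_affine nu rf_const (coord_ring n {i})"
    have "{\<gamma>. (i, \<gamma>) \<in> {x \<in> Sigma (pairs n) (chart_points nu n). Gr_class nu n x \<in> C}}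
        = {\<gamma> \<in> topspace ?B. \<gamma> = (max_point nu n i \<circ> pl_values n i) \<gamma>}"
      using i iff[OF i] by (auto simp: topspace_berk_affine)
    moreover have "closedin ?B \<dots>"
    proof (rule closedin_continuous_maps_eq)
      show "Hausdorff_space ?B"
        unfolding berk_affine_def
        by (rule Hausdorff_space_subtopology, unfold Hausdorff_space_product_topology)
          (intro disjI2 ballI Hausdorff_space_euclidean)
      show "continuous_map ?B ?B (\<lambda>\<gamma>. \<gamma>)" by simp
      show "continuous_map ?B ?B (max_point nu n i \<circ> pl_values n i)"
        by (rule continuous_map_compose[OF continuous_map_pl_values[OF i] continuous_map_max_point[OF nu i]])
    qed
    ultimately show "closedin ?B {\<gamma>. (i, \<gamma>) \<in> {x \<in> Sigma (pairs n) (chart_points nu n). Gr_class nu n x \<in> C}}"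
      by simp
  qed (auto simp: topspace_berk_affine)
  moreover have "C \<subseteq> topspace (Gr_an nu n)"
    unfolding C_def by (rule continuous_map_image_subset_topspace[OF \<sigma>])
  ultimately have "closedin (Gr_an nu n) C"
    using Gr_class_quotient_map unfolding quotient_map_closedin by blast
  then show ?thesis unfolding C_def .
qed

end

theorem theorem1p1:
  fixes nu :: "'k::field \<Rightarrow> real" and n :: nat
  assumes "complete_nonarch_field nu"
    and "n \<ge> 2"
  shows "(\<exists>\<sigma>. continuous_map (TGr nu n) (Gr_an nu n) \<sigma> \<and>
              (\<forall>x\<in>topspace (TGr nu n). trop n (\<sigma> x) = x)) \<and>
         (\<exists>C. closedin (Gr_an nu n) C \<and>
              TGr nu n homeomorphic_space subtopology (Gr_an nu n) C)"
proof -
  note nu = assms(1)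
  obtain \<sigma> where \<sigma>: "continuous_map (TGr nu n) (Gr_an nu n) \<sigma>"
    and eq: "\<And>X e. \<lbrakk>e \<in> pairs n; X \<in> topspace (TGr nu n); X \<in> TP_chart n e\<rbrakk> \<Longrightarrow> \<sigma> X = chart_section nu n e X"
    using continuous_section_exists[OF nu] by blast
  have inv: "trop n (\<sigma> X) = X" if X: "X \<in> topspace (TGr nu n)" for X
  proof -
    obtain i \<gamma> where "i \<in> pairs n" "\<gamma> \<in> chart_points nu n i" "X = trop n (Gr_class nu n (i, \<gamma>))"
      by (rule TGr_cases[OF nu X])
    then have "i \<in> pairs n" "X \<in> TP_chart n i" using trop_in_TP_chart[OF nu] by auto
    then show ?thesis using eq X trop_chart_section[OF nu X] by simp
  qed
  let ?C = "\<sigma> ` topspace (TGr nu n)"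
  \<comment> \<open>On the image of \<open>\<sigma>\<close> the inverse is \<open>trop\<close>,
    whose continuity is already known.\<close>
  have "homeomorphic_maps (TGr nu n) (subtopology (Gr_an nu n) ?C) \<sigma> (trop n)"
    unfolding homeomorphic_maps_def
  proof (intro conjI ballI)
    show "continuous_map (TGr nu n) (subtopology (Gr_an nu n) ?C) \<sigma>"
      using \<sigma> by (auto simp: continuous_map_in_subtopology)
    show "continuous_map (subtopology (Gr_an nu n) ?C) (TGr nu n) (trop n)"
      unfolding TGr_def continuous_map_in_subtopology
      using continuous_map_from_subtopology[OF continuous_map_trop[OF nu]] by auto
  qed (auto simp: inv)
  then have "TGr nu n homeomorphic_space subtopology (Gr_an nu n) ?C"
    unfolding homeomorphic_space_def by blast
  moreover have "closedin (Gr_an nu n) ?C"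
    by (rule closedin_section_image[OF nu \<sigma> eq inv])
  ultimately show ?thesis using \<sigma> inv by blast
qed

end
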